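(* Let $R\in C^0([1,+\infty),\mathrm{Sym}_n(\mathbb{R}))$ and let $l_R=-\frac{d^2}{dt^2}+\frac{R(t)}{t^2}$ on $[1,+\infty)$. (1) If $\liminf_{t\to+\infty}R(t)>-1/4$, then every self-adjoint extension of (the minimal operator of) $l_R$ has finite Morse index. (2) If $\limsup_{t\to+\infty}R(t)<-1/4$, then every self-adjoint extension of (the minimal operator of) $l_R$ has infinite Morse index.
   Context: The minimal operator is the closure of $l_R$ on $C_0^\infty((1,+\infty),\mathbb{R}^n)$ in $L^2((1,+\infty),\mathbb{R}^n)$. For symmetric-matrix-valued $R$: $\liminf_{t\to+\infty}R(t)>-1/4$ means that the $\liminf$ of the smallest eigenvalue of $R(t)$ is $>-1/4$; $\limsup_{t\to+\infty}R(t)<-1/4$ means that the $\limsup$ of the largest eigenvalue of $R(t)$ is $<-1/4$. The Morse index of a self-adjoint operator is the maximal dimension (possibly $+\infty$) of its negative spectral subspace. *)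

theory Defs
  imports "HOL-Analysis.Analysis"
begin

definition halfline :: "real measure"
  where "halfline = restrict_space lborel {1<..}"

definition square_integrable :: "(real \<Rightarrow> 'v::euclidean_space) \<Rightarrow> bool"
  where "square_integrable f \<longleftrightarrow>
    f \<in> borel_measurable halfline \<and> integrable halfline (\<lambda>t. (norm (f t))\<^sup>2)"

lemma square_integrable_zero: "square_integrable (\<lambda>_. 0)"
  by (simp add: square_integrable_def)

lemma square_integrable_inner:
  fixes f g :: "real \<Rightarrow> 'v::euclidean_space"
  assumes "square_integrable f" "square_integrable g"
  shows "integrable halfline (\<lambda>t. f t \<bullet> g t)"
proof (rule Bochner_Integration.integrable_bound)
  show "integrable halfline (\<lambda>t. (norm (f t))\<^sup>2 + (norm (g t))\<^sup>2)"
    using assms by (simp add: square_integrable_def)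
  show "(\<lambda>t. f t \<bullet> g t) \<in> borel_measurable halfline"
    using assms by (intro borel_measurable_inner) (simp_all add: square_integrable_def)
  have "\<bar>x \<bullet> y\<bar> \<le> (norm x)\<^sup>2 + (norm y)\<^sup>2" for x y :: 'v
  proof -
    have "\<bar>x \<bullet> y\<bar> \<le> norm x * norm y" by (rule Cauchy_Schwarz_ineq2)
    also have "2 * (norm x * norm y) \<le> (norm x)\<^sup>2 + (norm y)\<^sup>2"
      using sum_squares_bound[of "norm x" "norm y"] by (simp add: mult.assoc)
    then have "norm x * norm y \<le> (norm x)\<^sup>2 + (norm y)\<^sup>2"
      using mult_nonneg_nonneg[OF norm_ge_zero[of x] norm_ge_zero[of y]] by linarith
    finally show ?thesis .
  qed
  then show "AE t in halfline. norm (f t \<bullet> g t) \<le> norm ((norm (f t))\<^sup>2 + (norm (g t))\<^sup>2)"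
    by (intro AE_I2) (simp add: abs_of_nonneg)
qed

lemma square_integrable_add:
  fixes f g :: "real \<Rightarrow> 'v::euclidean_space"
  assumes "square_integrable f" "square_integrable g"
  shows "square_integrable (\<lambda>t. f t + g t)"
proof -
  have "integrable halfline (\<lambda>t. (norm (f t))\<^sup>2 + 2 * (f t \<bullet> g t) + (norm (g t))\<^sup>2)"
    using assms square_integrable_inner[OF assms] by (simp add: square_integrable_def)
  moreover have "(norm (x + y))\<^sup>2 = (norm x)\<^sup>2 + 2 * (x \<bullet> y) + (norm y)\<^sup>2" for x y :: 'v
    by (simp add: power2_norm_eq_inner inner_add_left inner_add_right inner_commute)
  moreover have "(\<lambda>t. f t + g t) \<in> borel_measurable halfline"
    using assms by (intro borel_measurable_add) (simp_all add: square_integrable_def)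
  ultimately show ?thesis
    by (simp add: square_integrable_def)
qed

lemma square_integrable_scaleR:
  "square_integrable f \<Longrightarrow> square_integrable (\<lambda>t. c *\<^sub>R f t)"
  by (auto simp: square_integrable_def power_mult_distrib)

lemma square_integrable_uminus:
  "square_integrable f \<Longrightarrow> square_integrable (\<lambda>t. - f t)"
  by (auto simp: square_integrable_def)

definition ae_equal :: "(real \<Rightarrow> 'v::euclidean_space) \<Rightarrow> (real \<Rightarrow> 'v) \<Rightarrow> bool"
  where "ae_equal f g \<longleftrightarrow>
    square_integrable f \<and> square_integrable g \<and> (AE t in halfline. f t = g t)"

lemma part_equivp_ae_equal: "part_equivp ae_equal"
proof (rule part_equivpI)
  show "\<exists>f. ae_equal f f"
    using square_integrable_zero by (auto simp: ae_equal_def)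
  show "symp ae_equal"
    by (auto intro!: sympI simp: ae_equal_def elim: AE_mp)
  show "transp ae_equal"
  proof (rule transpI)
    fix f g h :: "real \<Rightarrow> 'v::euclidean_space"
    assume "ae_equal f g" and "ae_equal g h"
    then have "AE t in halfline. f t = g t" "AE t in halfline. g t = h t"
      and "square_integrable f" "square_integrable h"
      by (auto simp: ae_equal_def)
    then show "ae_equal f h"
      by (auto simp: ae_equal_def elim: AE_mp)
  qed
qed

quotient_type (overloaded) 'v L2 = "real \<Rightarrow> 'v::euclidean_space" / partial: ae_equal
  morphisms rep_L2 L2_class
  by (rule part_equivp_ae_equal)

instantiation L2 :: (euclidean_space) real_inner
begin

lift_definition zero_L2 :: "'a L2" is "\<lambda>_. 0"
  using square_integrable_zero by (simp add: ae_equal_def)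

lift_definition plus_L2 :: "'a L2 \<Rightarrow> 'a L2 \<Rightarrow> 'a L2" is "\<lambda>f g t. f t + g t"
  by (auto simp: ae_equal_def square_integrable_add elim: AE_mp)

lift_definition uminus_L2 :: "'a L2 \<Rightarrow> 'a L2" is "\<lambda>f t. - f t"
  by (auto simp: ae_equal_def square_integrable_uminus)

lift_definition scaleR_L2 :: "real \<Rightarrow> 'a L2 \<Rightarrow> 'a L2" is "\<lambda>c f t. c *\<^sub>R f t"
  by (auto simp: ae_equal_def square_integrable_scaleR elim: AE_mp)

lift_definition inner_L2 :: "'a L2 \<Rightarrow> 'a L2 \<Rightarrow> real"
  is "\<lambda>f g. \<integral>t. f t \<bullet> g t \<partial>halfline"
  by (rule integral_cong_AE) (auto simp: ae_equal_def square_integrable_def elim: AE_mp)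

definition minus_L2 :: "'a L2 \<Rightarrow> 'a L2 \<Rightarrow> 'a L2"
  where "minus_L2 u v = u + - v"

definition norm_L2 :: "'a L2 \<Rightarrow> real"
  where "norm_L2 u = sqrt (u \<bullet> u)"

definition sgn_L2 :: "'a L2 \<Rightarrow> 'a L2"
  where "sgn_L2 u = inverse (norm u) *\<^sub>R u"

definition dist_L2 :: "'a L2 \<Rightarrow> 'a L2 \<Rightarrow> real"
  where "dist_L2 u v = norm (u - v)"

definition uniformity_L2 :: "('a L2 \<times> 'a L2) filter"
  where "uniformity_L2 = (INF e\<in>{0<..}. principal {(u, v). dist u v < e})"

definition open_L2 :: "'a L2 set \<Rightarrow> bool"
  where "open_L2 U \<longleftrightarrow> (\<forall>u\<in>U. eventually (\<lambda>(u', v). u' = u \<longrightarrow> v \<in> U) uniformity)"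

instance
proof
  fix u v w :: "'a L2" and a b :: real and U :: "'a L2 set"
  show "u + v + w = u + (v + w)"
    by transfer (auto simp: ae_equal_def square_integrable_add add.assoc)
  show "u + v = v + u"
    by transfer (auto simp: ae_equal_def square_integrable_add add.commute)
  show "0 + u = u"
    by transfer (auto simp: ae_equal_def)
  show "- u + u = 0"
    by transfer (auto simp: ae_equal_def square_integrable_zero)
  show "u - v = u + - v"
    by (rule minus_L2_def)
  show "a *\<^sub>R (u + v) = a *\<^sub>R u + a *\<^sub>R v"
    by transfer (auto simp: ae_equal_def square_integrable_add square_integrable_scaleR
        scaleR_add_right)
  show "(a + b) *\<^sub>R u = a *\<^sub>R u + b *\<^sub>R u"
    by transfer (auto simp: ae_equal_def square_integrable_add square_integrable_scaleR
        scaleR_add_left)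
  show "a *\<^sub>R b *\<^sub>R u = (a * b) *\<^sub>R u"
    by transfer (auto simp: ae_equal_def square_integrable_scaleR)
  show "1 *\<^sub>R u = u"
    by transfer (auto simp: ae_equal_def)
  show "u \<bullet> v = v \<bullet> u"
    by transfer (simp add: inner_commute)
  show "(u + v) \<bullet> w = u \<bullet> w + v \<bullet> w"
    by transfer (simp add: ae_equal_def inner_add_left square_integrable_inner)
  show "(a *\<^sub>R u) \<bullet> v = a * (u \<bullet> v)"
    by transfer simp
  show "0 \<le> u \<bullet> u"
    by transfer simp
  show "u \<bullet> u = 0 \<longleftrightarrow> u = 0"
  proof (transfer, goal_cases)
    case (1 f)
    then have f: "square_integrable f"
      by (simp add: ae_equal_def)
    have "(\<integral>t. f t \<bullet> f t \<partial>halfline) = 0 \<longleftrightarrow> (AE t in halfline. f t \<bullet> f t = 0)"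
      by (intro integral_nonneg_eq_0_iff_AE square_integrable_inner f) auto
    then show ?case
      using f by (simp add: ae_equal_def square_integrable_zero)
  qed
qed (simp_all only: norm_L2_def sgn_L2_def dist_L2_def uniformity_L2_def open_L2_def)

end


text \<open>
  An unbounded operator is identified with its graph, so \<open>A \<subseteq> B\<close> says that \<open>B\<close> extends \<open>A\<close>, and
  the closure of an operator is the topological closure of its graph.
\<close>

definition operator :: "('h::real_inner \<times> 'h) set \<Rightarrow> bool"
  where "operator A \<longleftrightarrow> subspace A \<and> single_valued A"

definition adjoint_graph :: "('h::real_inner \<times> 'h) set \<Rightarrow> ('h \<times> 'h) set"
  where "adjoint_graph A = {(y, z). \<forall>(x, w)\<in>A. w \<bullet> y = x \<bullet> z}"

definition self_adjoint :: "('h::real_inner \<times> 'h) set \<Rightarrow> bool"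
  where "self_adjoint A \<longleftrightarrow>
    operator A \<and> closure (Domain A) = UNIV \<and> adjoint_graph A = A"

definition orthogonal_projection :: "('h::real_inner \<Rightarrow> 'h) \<Rightarrow> bool"
  where "orthogonal_projection P \<longleftrightarrow>
    linear P \<and> P \<circ> P = P \<and> (\<forall>x y. P x \<bullet> y = x \<bullet> P y)"

text \<open>Only the values of \<open>E\<close> on Borel sets are relevant.\<close>

definition projection_valued_measure :: "(real set \<Rightarrow> 'h::real_inner \<Rightarrow> 'h) \<Rightarrow> bool"
  where "projection_valued_measure E \<longleftrightarrow>
    (\<forall>S\<in>sets borel. orthogonal_projection (E S)) \<and>
    E UNIV = id \<and>
    (\<forall>S :: nat \<Rightarrow> real set. range S \<subseteq> sets borel \<longrightarrow> disjoint_family S \<longrightarrow>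
      (\<forall>x. (\<lambda>i. E (S i) x) sums E (\<Union>i. S i) x))"

definition scalar_measure :: "(real set \<Rightarrow> 'h::real_inner \<Rightarrow> 'h) \<Rightarrow> 'h \<Rightarrow> real measure"
  where "scalar_measure E x = measure_of UNIV (sets borel) (\<lambda>S. ennreal (E S x \<bullet> x))"

text \<open>
  This says that \<open>A\<close> is the integral of the identity function against \<open>E\<close>, with its natural
  domain. Prescribing only the diagonal \<open>y \<bullet> x\<close> for \<open>(x, y) \<in> A\<close> suffices, by polarization,
  because a self-adjoint \<open>A\<close> is symmetric.  By the spectral theorem exactly one \<open>E\<close> (on Borel
  sets) is the spectral measure of a given self-adjoint operator on a Hilbert space.
\<close>

definition spectral_measure ::
    "('h::real_inner \<times> 'h) set \<Rightarrow> (real set \<Rightarrow> 'h \<Rightarrow> 'h) \<Rightarrow> bool"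
  where "spectral_measure A E \<longleftrightarrow>
    self_adjoint A \<and> projection_valued_measure E \<and>
    Domain A = {x. integrable (scalar_measure E x) (\<lambda>s. s\<^sup>2)} \<and>
    (\<forall>(x, y)\<in>A. y \<bullet> x = (\<integral>s. s \<partial>scalar_measure E x))"

definition edim :: "'h::real_vector set \<Rightarrow> enat"
  where "edim V = (SUP B\<in>{B. B \<subseteq> V \<and> finite B \<and> independent B}. enat (card B))"

text \<open>
  Spectral measures of the same operator agree on the Borel set \<open>{..<0}\<close>, so the choice below
  is immaterial.
\<close>

definition negative_spectral_subspace :: "('h::real_inner \<times> 'h) set \<Rightarrow> 'h set"
  where "negative_spectral_subspace A = range ((SOME E. spectral_measure A E) {..<0})"

definition morse_index :: "('h::real_inner \<times> 'h) set \<Rightarrow> enat"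
  where "morse_index A = edim (negative_spectral_subspace A)"


definition smooth :: "(real \<Rightarrow> 'v::real_normed_vector) \<Rightarrow> bool"
  where "smooth f \<longleftrightarrow> (\<exists>D :: nat \<Rightarrow> real \<Rightarrow> 'v. D 0 = f \<and>
    (\<forall>k t. (D k has_vector_derivative D (Suc k) t) (at t)))"

text \<open>Functions on the half-line with compact support there are extended by zero to the line.\<close>

definition test_function :: "(real \<Rightarrow> 'v::real_normed_vector) \<Rightarrow> bool"
  where "test_function \<phi> \<longleftrightarrow>
    smooth \<phi> \<and> (\<exists>K. compact K \<and> K \<subseteq> {1<..} \<and> (\<forall>t. t \<notin> K \<longrightarrow> \<phi> t = 0))"

definition l_expr :: "(real \<Rightarrow> real^'n^'n) \<Rightarrow> (real \<Rightarrow> real^'n) \<Rightarrow> real \<Rightarrow> real^'n"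
  where "l_expr R \<phi> t =
    - vector_derivative (\<lambda>s. vector_derivative \<phi> (at s)) (at t) + (1 / t\<^sup>2) *\<^sub>R (R t *v \<phi> t)"

definition minimal_operator :: "(real \<Rightarrow> real^'n^'n) \<Rightarrow> ((real^'n) L2 \<times> (real^'n) L2) set"
  where "minimal_operator R =
    closure {(L2_class \<phi>, L2_class (l_expr R \<phi>)) | \<phi>. test_function \<phi>}"

definition eigenvalues :: "real^'n^'n \<Rightarrow> real set"
  where "eigenvalues M = {\<mu>. \<exists>v. v \<noteq> 0 \<and> M *v v = \<mu> *\<^sub>R v}"

definition smallest_eigenvalue :: "real^'n^'n \<Rightarrow> real"
  where "smallest_eigenvalue M = Min (eigenvalues M)"

definition largest_eigenvalue :: "real^'n^'n \<Rightarrow> real"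
  where "largest_eigenvalue M = Max (eigenvalues M)"

end

theory Submission
  imports Defs "HOL-Probability.Distribution_Functions" "HOL-Real_Asymp.Real_Asymp"
begin

text \<open>
  The theorem is about the sign of the quadratic form of a self-adjoint operator \<open>A\<close>, and two
  abstract principles turn form estimates into statements about the Morse index. If finitely many
  linear functionals on the domain of \<open>A\<close> have a common kernel on which \<open>A x \<bullet> x \<ge> 0\<close>, then the
  negative spectral subspace is finite-dimensional (\<open>morse_index_finite\<close>), because a vector of the
  range of \<open>E {-k..<0}\<close> has negative form value unless it is zero. If the form is negative definite
  on infinitely many mutually form-orthogonal directions, then the negative spectral subspace is
  infinite-dimensional (\<open>morse_index_infinite\<close>), because \<open>E {..<0}\<close> is injective on their span.

  The Morse index is defined through a choice of spectral measure, so the existence of one, that is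
  the spectral theorem for unbounded self-adjoint operators on a real Hilbert space, has to be
  established (\<open>exists_spectral_measure\<close>). Projecting orthogonally onto the graph of \<open>A\<close> produces
  the commuting bounded operators \<open>B = (1 + A\<^sup>2)\<^sup>-\<^sup>1\<close> and \<open>C = A (1 + A\<^sup>2)\<^sup>-\<^sup>1\<close>. The bounded operator
  \<open>C - l B\<close> has the sign of \<open>A - l\<close>, and the kernel of its positive part, built from square roots,
  is the spectral subspace of \<open>(-\<infinity>, l]\<close>. Stieltjes measures and a Dynkin argument extend these
  projections to all Borel sets; on the range belonging to a bounded interval \<open>A\<close> is bounded by
  the end points of the interval, which identifies the domain and the form of \<open>A\<close>.

  For the first claim, an element \<open>u\<close> of the domain of an extension \<open>A\<close> solves
  \<open>u'' = R u / t\<^sup>2 - A u\<close> weakly, hence has a continuously differentiable representative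
  (\<open>weak_regularity\<close>) whose point values are linear functionals. Let \<open>u\<close> vanish at finitely many
  points: at \<open>1\<close>, and on a fine grid up to a point \<open>T\<close> after which \<open>R \<ge> -1/4\<close>. Then the form on
  \<open>[1, b]\<close> is nonnegative for \<open>b \<ge> T\<close>: on the short grid intervals the kinetic energy wins, and
  beyond \<open>T\<close> this is the inequality of Hardy. The boundary term at \<open>b\<close> is half the derivative
  of \<open>\<bar>u\<bar>\<^sup>2\<close> and cannot stay above a positive constant, since \<open>u\<close> is square-integrable; so
  \<open>A u \<bullet> u \<ge> 0\<close>. This treats the limit-point and the limit-circle case at infinity alike.

  For the second claim, let \<open>R \<le> -(1/4 + c\<^sup>2)\<close> from \<open>T\<close> on. The substitution
  \<open>u = t\<^sup>1\<^sup>/\<^sup>2 f(ln t)\<close> turns the form of \<open>-u'' - (1/4 + c\<^sup>2) u / t\<^sup>2\<close> into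
  \<open>\<integral> f'\<^sup>2 - c\<^sup>2 f\<^sup>2\<close>, which is negative for a sufficiently stretched bump \<open>f\<close>; the translates
  of \<open>f\<close> provide infinitely many test functions with disjoint supports (\<open>negative_test_functions\<close>).
\<close>

section \<open>Orthogonal projections in a Hilbert space\<close>

text \<open>
  A sequence in \<open>V\<close> minimizing the distance to \<open>x\<close> is Cauchy by the parallelogram identity. Moving
  its limit \<open>p\<close> inside \<open>V\<close> cannot decrease the distance to \<open>x\<close>, which forces orthogonality.
\<close>

lemma exists_orthogonal_decomposition:
  fixes V :: "'h::{real_inner,banach} set"
  assumes "closed V" "subspace V"
  shows "\<exists>p\<in>V. \<forall>v\<in>V. (x - p) \<bullet> v = 0"
proof -
  define d where "d = infdist x V"
  have ne: "V \<noteq> {}" using assms(2) subspace_0 by blast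
  have d0: "d \<ge> 0" unfolding d_def by (rule infdist_nonneg)
  have le: "d \<le> norm (x - v)" if "v \<in> V" for v
    unfolding d_def using infdist_le[OF that, of x] by (simp add: dist_norm)
  have "\<exists>v\<in>V. norm (x - v) < d + 1 / Suc n" for n :: nat
  proof (rule ccontr)
    assume "\<not> ?thesis"
    then have "d + 1 / Suc n \<le> dist x v" if "v \<in> V" for v
      using that by (force simp: dist_norm not_less)
    then have "d + 1 / Suc n \<le> infdist x V"
      using ne by (auto simp: infdist_def intro!: cINF_greatest)
    then show False unfolding d_def by (simp add: field_simps)
  qed
  then obtain v where v: "\<And>n. v n \<in> V" "\<And>n::nat. norm (x - v n) < d + 1 / Suc n"
    by metis
  have mid: "(norm (v m - v n))\<^sup>2 \<le> 2 * (norm (x - v m))\<^sup>2 + 2 * (norm (x - v n))\<^sup>2 - 4 * d\<^sup>2" for m n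
  proof -
    have "(1/2) *\<^sub>R (v m + v n) \<in> V"
      using v assms(2) by (intro subspace_scale subspace_add) auto
    then have "d\<^sup>2 \<le> (norm (x - (1/2) *\<^sub>R (v m + v n)))\<^sup>2"
      using le d0 by (intro power_mono) auto
    moreover have "(norm (v m - v n))\<^sup>2 + 4 * (norm (x - (1/2) *\<^sub>R (v m + v n)))\<^sup>2
      = 2 * (norm (x - v m))\<^sup>2 + 2 * (norm (x - v n))\<^sup>2"
      by (simp add: power2_norm_eq_inner inner_diff inner_add algebra_simps inner_commute)
    ultimately show ?thesis by linarith
  qed
  have "Cauchy v"
  proof (rule metric_CauchyI)
    fix e :: real assume e: "e > 0"
    have "(\<lambda>n. 4 * (d + 1 / real (Suc n))\<^sup>2 - 4 * d\<^sup>2) \<longlonglongrightarrow> 4 * (d + 0)\<^sup>2 - 4 * d\<^sup>2"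
      by (intro tendsto_intros LIMSEQ_Suc[OF lim_1_over_n])
    then have "\<forall>\<^sub>F n in sequentially. 4 * (d + 1 / real (Suc n))\<^sup>2 - 4 * d\<^sup>2 < e\<^sup>2"
      using e by (intro order_tendstoD) auto
    then obtain M where M: "4 * (d + 1 / real (Suc M))\<^sup>2 - 4 * d\<^sup>2 < e\<^sup>2"
      unfolding eventually_sequentially by blast
    show "\<exists>M. \<forall>m\<ge>M. \<forall>n\<ge>M. dist (v m) (v n) < e"
    proof (intro exI allI impI)
      fix m n assume mn: "m \<ge> M" "n \<ge> M"
      have b: "(norm (x - v k))\<^sup>2 \<le> (d + 1 / real (Suc M))\<^sup>2" if "k \<ge> M" for k
      proof (rule power_mono)
        have "1 / real (Suc k) \<le> 1 / real (Suc M)"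
          using that by (simp add: field_simps)
        then show "norm (x - v k) \<le> d + 1 / real (Suc M)"
          using v(2)[of k] by linarith
      qed simp
      have "(norm (v m - v n))\<^sup>2 < e\<^sup>2"
        using mid[of m n] b[OF mn(1)] b[OF mn(2)] M by linarith
      then show "dist (v m) (v n) < e"
        using e by (simp add: dist_norm power_less_imp_less_base)
    qed
  qed
  then obtain p where p: "v \<longlonglongrightarrow> p"
    using Cauchy_convergent convergent_def by blast
  have pV: "p \<in> V" using closed_sequentially[OF assms(1) _ p] v(1) by blast
  have "(\<lambda>n. d + 1 / real (Suc n)) \<longlonglongrightarrow> d + 0"
    by (intro tendsto_intros LIMSEQ_Suc[OF lim_1_over_n])
  moreover have "(\<lambda>n. norm (x - v n)) \<longlonglongrightarrow> norm (x - p)"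
    by (intro tendsto_intros p)
  ultimately have np: "norm (x - p) \<le> d"
    using v(2) by (intro LIMSEQ_le[of "\<lambda>n. norm (x - v n)"]) (auto intro: less_imp_le)
  have "(x - p) \<bullet> w = 0" if w: "w \<in> V" for w
  proof (rule ccontr)
    assume nz: "(x - p) \<bullet> w \<noteq> 0"
    then have ww: "w \<bullet> w > 0" by auto
    \<comment> \<open>the minimizer of the distance from \<open>x - p\<close> to the line spanned by \<open>w\<close>\<close>
    define t where "t = ((x - p) \<bullet> w) / (w \<bullet> w)"
    have "p + t *\<^sub>R w \<in> V" using pV w assms(2) by (intro subspace_add subspace_scale)
    then have "(norm (x - p))\<^sup>2 \<le> (norm (x - (p + t *\<^sub>R w)))\<^sup>2"
      using le np by (intro power_mono) (auto intro: order_trans)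
    also have "\<dots> = (norm ((x - p) - t *\<^sub>R w))\<^sup>2" by (simp add: algebra_simps)
    also have "\<dots> = (norm (x - p))\<^sup>2 - 2 * t * ((x - p) \<bullet> w) + t\<^sup>2 * (w \<bullet> w)"
      unfolding power2_norm_eq_inner
      by (simp add: inner_diff_left[of "x - p"] inner_diff_right[of _ "x - p"] inner_commute power2_eq_square)
    also have "\<dots> = (norm (x - p))\<^sup>2 - ((x - p) \<bullet> w)\<^sup>2 / (w \<bullet> w)"
      using ww by (simp add: t_def field_simps power2_eq_square)
    finally show False using nz ww by (simp add: field_simps)
  qed
  then show ?thesis using pV by blast
qed

definition proj :: "'h::real_inner set \<Rightarrow> 'h \<Rightarrow> 'h"
  where "proj V x = (SOME p. p \<in> V \<and> (\<forall>v\<in>V. (x - p) \<bullet> v = 0))"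

context
  fixes V :: "'h::{real_inner,banach} set"
  assumes V: "closed V" "subspace V"
begin

lemma proj_in: "proj V x \<in> V"
  and proj_orthogonal: "v \<in> V \<Longrightarrow> (x - proj V x) \<bullet> v = 0"
proof -
  have "proj V x \<in> V \<and> (\<forall>v\<in>V. (x - proj V x) \<bullet> v = 0)"
    unfolding proj_def using exists_orthogonal_decomposition[OF V, of x]
    by (intro someI_ex[of "\<lambda>p. p \<in> V \<and> (\<forall>v\<in>V. (x - p) \<bullet> v = 0)"]) blast
  then show "proj V x \<in> V" "v \<in> V \<Longrightarrow> (x - proj V x) \<bullet> v = 0" by blast+
qed

lemma proj_unique:
  assumes "p \<in> V" "\<And>v. v \<in> V \<Longrightarrow> (x - p) \<bullet> v = 0"
  shows "proj V x = p"
proof -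
  have m: "p - proj V x \<in> V" using assms proj_in V by (intro subspace_diff)
  have "(p - proj V x) \<bullet> (p - proj V x) = 0"
    using assms(2)[OF m] proj_orthogonal[OF m, of x] by (simp add: inner_diff_left)
  then show ?thesis by simp
qed

lemma proj_of_mem: "x \<in> V \<Longrightarrow> proj V x = x"
  by (rule proj_unique) auto

lemma orthogonal_projection_proj: "orthogonal_projection (proj V)"
  unfolding orthogonal_projection_def
proof (intro conjI allI)
  show "linear (proj V)"
  proof (rule linearI)
    fix x y :: 'h and c :: real
    show "proj V (x + y) = proj V x + proj V y"
    proof (rule proj_unique)
      fix v assume v: "v \<in> V"
      show "(x + y - (proj V x + proj V y)) \<bullet> v = 0"
        using proj_orthogonal[OF v, of x] proj_orthogonal[OF v, of y]
        by (simp add: inner_diff_left inner_add_left)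
    qed (intro subspace_add proj_in V)
    show "proj V (c *\<^sub>R x) = c *\<^sub>R proj V x"
    proof (rule proj_unique)
      fix v assume v: "v \<in> V"
      show "(c *\<^sub>R x - c *\<^sub>R proj V x) \<bullet> v = 0"
        using proj_orthogonal[OF v, of x] by (simp add: inner_diff_left)
    qed (intro subspace_scale proj_in V)
  qed
  show "proj V \<circ> proj V = proj V" by (auto simp: proj_of_mem proj_in)
  fix x y
  show "proj V x \<bullet> y = x \<bullet> proj V y"
    using proj_orthogonal[OF proj_in, of x y] proj_orthogonal[OF proj_in, of y x]
      inner_commute[of x "proj V y"] inner_commute[of "proj V x" "proj V y"]
      inner_commute[of "proj V x" y]
    by (simp add: inner_diff_left)
qed

text \<open>
  By symmetry \<open>D\<close> also maps the orthogonal complement of \<open>V\<close> into itself.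
\<close>

lemma proj_commute:
  assumes "linear D" "\<And>x y. D x \<bullet> y = x \<bullet> D y" "\<And>x. x \<in> V \<Longrightarrow> D x \<in> V"
  shows "proj V (D x) = D (proj V x)"
proof (rule proj_unique)
  show "D (proj V x) \<in> V" using assms proj_in by blast
  fix v assume v: "v \<in> V"
  have "D x - D (proj V x) = D (x - proj V x)" using assms(1) by (simp add: linear_diff)
  then show "(D x - D (proj V x)) \<bullet> v = 0"
    using assms v proj_orthogonal by simp
qed

end

lemma orthogonal_projectionD:
  assumes "orthogonal_projection P"
  shows "linear P" "P (P x) = P x" "P x \<bullet> y = x \<bullet> P y"
  using assms unfolding orthogonal_projection_def by (auto simp: fun_eq_iff)

lemma orthogonal_projection_inner:
  "orthogonal_projection P \<Longrightarrow> P x \<bullet> x = (norm (P x))\<^sup>2"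
  using orthogonal_projectionD[of P] by (metis power2_norm_eq_inner)

lemma orthogonal_projection_pythagoras:
  assumes "orthogonal_projection P"
  shows "(norm x)\<^sup>2 = (norm (P x))\<^sup>2 + (norm (x - P x))\<^sup>2"
proof -
  have "P x \<bullet> (x - P x) = 0"
    using orthogonal_projectionD[OF assms] by (metis inner_diff_right right_minus_eq)
  then show ?thesis
    by (simp add: power2_norm_eq_inner inner_diff inner_commute)
qed

lemma orthogonal_projection_norm_le:
  assumes "orthogonal_projection P" shows "norm (P x) \<le> norm x"
proof (rule power2_le_imp_le)
  show "(norm (P x))\<^sup>2 \<le> (norm x)\<^sup>2"
    using orthogonal_projection_pythagoras[OF assms, of x] by simp
qed simp

lemma orthogonal_projection_bounded_linear:
  assumes "orthogonal_projection P" shows "bounded_linear P"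
proof -
  have "\<exists>K. \<forall>x. norm (P x) \<le> norm x * K"
    using orthogonal_projection_norm_le[OF assms] by (intro exI[of _ 1]) simp
  then show ?thesis
    using orthogonal_projectionD(1)[OF assms]
    by (simp add: bounded_linear_def bounded_linear_axioms_def linear_conv_bounded_linear)
qed

text \<open>
  Polarization recovers a symmetric operator from its quadratic form.
\<close>

lemma orthogonal_projection_eqI:
  assumes P: "orthogonal_projection P" and Q: "orthogonal_projection Q"
    and eq: "\<And>x. P x \<bullet> x = Q x \<bullet> x"
  shows "P = Q"
proof
  fix x
  have b: "P x \<bullet> y = Q x \<bullet> y" for y
  proof -
    have "P (x + y) \<bullet> (x + y) = Q (x + y) \<bullet> (x + y)" by (rule eq)
    then have "P x \<bullet> y + P y \<bullet> x = Q x \<bullet> y + Q y \<bullet> x"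
      using eq[of x] eq[of y] orthogonal_projectionD(1)[OF P] orthogonal_projectionD(1)[OF Q]
      by (simp add: linear_add inner_add algebra_simps)
    moreover have "P y \<bullet> x = P x \<bullet> y" "Q y \<bullet> x = Q x \<bullet> y"
      using orthogonal_projectionD(3)[OF P] orthogonal_projectionD(3)[OF Q] by (metis inner_commute)+
    ultimately show ?thesis by simp
  qed
  have "(P x - Q x) \<bullet> (P x - Q x) = 0"
    using b[of "P x - Q x"] by (simp add: inner_diff_left)
  then show "P x = Q x" by simp
qed

section \<open>Absolute values of bounded symmetric operators\<close>

definition symmetric :: "('h::real_inner \<Rightarrow>\<^sub>L 'h) \<Rightarrow> bool"
  where "symmetric C \<longleftrightarrow> (\<forall>x y. C x \<bullet> y = x \<bullet> C y)"

definition commute :: "('h::real_normed_vector \<Rightarrow>\<^sub>L 'h) \<Rightarrow> ('h \<Rightarrow>\<^sub>L 'h) \<Rightarrow> bool"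
  where "commute C D \<longleftrightarrow> (\<forall>x. C (D x) = D (C x))"

lemma symmetricD: "symmetric C \<Longrightarrow> C x \<bullet> y = x \<bullet> C y"
  by (simp add: symmetric_def)

lemma commuteD: "commute C D \<Longrightarrow> C (D x) = D (C x)"
  by (simp add: commute_def)

lemma commute_sym: "commute C D \<Longrightarrow> commute D C"
  by (simp add: commute_def)

text \<open>
  A fixed point \<open>Y\<close> of the iteration \<open>Y \<mapsto> (X + Y\<^sup>2) / 2\<close> satisfies \<open>(1 - Y)\<^sup>2 = 1 - X\<close>, so that
  \<open>1 - Y\<close> is a square root of \<open>1 - X\<close>. If \<open>\<parallel>X\<parallel> \<le> 1\<close>, the same iteration
  with the number \<open>1\<close> in place of \<open>X\<close> dominates it in norm.
\<close>

primrec sqrt_iter :: "('h::real_normed_vector \<Rightarrow>\<^sub>L 'h) \<Rightarrow> nat \<Rightarrow> ('h \<Rightarrow>\<^sub>L 'h)" where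
  "sqrt_iter X 0 = 0"
| "sqrt_iter X (Suc n) = (1/2) *\<^sub>R (X + (sqrt_iter X n o\<^sub>L sqrt_iter X n))"

primrec sqrt_iter_bound :: "nat \<Rightarrow> real" where
  "sqrt_iter_bound 0 = 0"
| "sqrt_iter_bound (Suc n) = (1 + (sqrt_iter_bound n)\<^sup>2) / 2"

lemma sqrt_iter_bound: "0 \<le> sqrt_iter_bound n \<and> sqrt_iter_bound n \<le> 1"
proof (induction n)
  case (Suc n)
  then have "(sqrt_iter_bound n)\<^sup>2 \<le> 1" by (simp add: power_le_one)
  then show ?case by simp
qed simp

lemma commute_sqrt_iter: "commute Z X \<Longrightarrow> commute Z (sqrt_iter X n)"
  by (induction n) (auto simp: commute_def blinfun.add_left blinfun.add_right
      blinfun.scaleR_left blinfun.scaleR_right blinfun.zero_left blinfun.zero_right)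

lemma symmetric_sqrt_iter: "symmetric X \<Longrightarrow> symmetric (sqrt_iter X n)"
  by (induction n) (auto simp: symmetric_def blinfun.add_left 
      blinfun.scaleR_left blinfun.zero_left inner_add_left inner_add_right)

text \<open>
  The iterates commute, so a difference of consecutive squares factors, and both factors are
  bounded by the corresponding factors of the scalar iteration. Telescoping against the increasing
  bounded scalar sequence makes the iteration Cauchy in the operator norm.
\<close>

lemma sqrt_iter_step:
  assumes "norm X \<le> 1"
  shows "norm (sqrt_iter X n) \<le> sqrt_iter_bound n \<and>
    norm (sqrt_iter X (Suc n) - sqrt_iter X n) \<le> sqrt_iter_bound (Suc n) - sqrt_iter_bound n"
proof (induction n)
  case 0
  then show ?case using assms by simp
next
  case (Suc n)
  let ?Y = "sqrt_iter X" and ?y = sqrt_iter_bound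
  have c: "commute (?Y (Suc n)) (?Y n)"
    by (intro commute_sqrt_iter commute_sym[OF commute_sqrt_iter]) (simp add: commute_def)
  have 1: "norm (?Y (Suc n)) \<le> ?y (Suc n)"
    using Suc norm_triangle_sub[of "?Y (Suc n)" "?Y n"] by linarith
  have "?Y (Suc (Suc n)) - ?Y (Suc n) =
      (1/2) *\<^sub>R ((?Y (Suc n) - ?Y n) o\<^sub>L (?Y (Suc n) + ?Y n))"
  proof (rule blinfun_eqI)
    fix x
    have Z: "(1/2) *\<^sub>R (X + (Z o\<^sub>L Z)) - (1/2) *\<^sub>R (X + (W o\<^sub>L W)) =
      (1/2) *\<^sub>R ((Z o\<^sub>L Z) - (W o\<^sub>L W))" for Z W :: "'a \<Rightarrow>\<^sub>L 'a"
      by (simp add: algebra_simps)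
    have "?Y (Suc (Suc n)) - ?Y (Suc n) =
      (1/2) *\<^sub>R ((?Y (Suc n) o\<^sub>L ?Y (Suc n)) - (?Y n o\<^sub>L ?Y n))"
      unfolding sqrt_iter.simps(2)[of X "Suc n"] by (subst (2) sqrt_iter.simps(2)) (rule Z)
    then show "blinfun_apply (?Y (Suc (Suc n)) - ?Y (Suc n)) x =
      ((1/2) *\<^sub>R ((?Y (Suc n) - ?Y n) o\<^sub>L (?Y (Suc n) + ?Y n))) x"
      using commuteD[OF c, of x]
      by (simp del: sqrt_iter.simps add: blinfun.diff_left blinfun.add_left blinfun.add_right blinfun.scaleR_left)
  qed
  then have "norm (?Y (Suc (Suc n)) - ?Y (Suc n)) =
      norm ((?Y (Suc n) - ?Y n) o\<^sub>L (?Y (Suc n) + ?Y n)) / 2" by (simp del: sqrt_iter.simps)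
  also have "\<dots> \<le> norm (?Y (Suc n) - ?Y n) * norm (?Y (Suc n) + ?Y n) / 2"
    by (intro divide_right_mono norm_blinfun_compose) simp
  also have "\<dots> \<le> (?y (Suc n) - ?y n) * (?y (Suc n) + ?y n) / 2"
  proof (intro divide_right_mono mult_mono)
    show "norm (?Y (Suc n) + ?Y n) \<le> ?y (Suc n) + ?y n"
      using 1 Suc norm_triangle_ineq[of "?Y (Suc n)" "?Y n"] by linarith
    show "norm (?Y (Suc n) - ?Y n) \<le> ?y (Suc n) - ?y n" using Suc by blast
    then show "0 \<le> ?y (Suc n) - ?y n" using norm_ge_zero order_trans by blast
  qed auto
  also have "\<dots> = ?y (Suc (Suc n)) - ?y (Suc n)"
    unfolding sqrt_iter_bound.simps(2)[of "Suc n"] unfolding sqrt_iter_bound.simps(2)[of n]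
    by (simp add: field_simps power2_eq_square)
  finally show ?case using 1 by blast
qed

lemma exists_sqrt_one_minus:
  fixes X :: "'h::{real_inner,banach} \<Rightarrow>\<^sub>L 'h"
  assumes nX: "norm X \<le> 1" and sX: "symmetric X"
  obtains Y where "norm Y \<le> 1" "symmetric Y" "\<And>Z. commute Z X \<Longrightarrow> commute Z Y"
    "\<And>x. (x - Y x) - Y (x - Y x) = x - X x"
proof -
  let ?Y = "sqrt_iter X" and ?y = sqrt_iter_bound
  note step = sqrt_iter_step[OF nX]
  have inc: "incseq ?y"
  proof (rule incseq_SucI)
    fix n show "?y n \<le> ?y (Suc n)" using step[of n] norm_ge_zero[of "?Y (Suc n) - ?Y n"] by linarith
  qed
  have diff: "norm (?Y (n + k) - ?Y n) \<le> ?y (n + k) - ?y n" for n k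
  proof (induction k)
    case (Suc k)
    then show ?case
      using step[of "n + k"] norm_triangle_ineq[of "?Y (Suc (n + k)) - ?Y (n + k)" "?Y (n + k) - ?Y n"]
      by (simp del: sqrt_iter.simps sqrt_iter_bound.simps)
  qed simp
  have diff': "norm (?Y m - ?Y n) \<le> \<bar>?y m - ?y n\<bar>" for m n
  proof (cases "n \<le> m")
    case True then show ?thesis using diff[of n "m - n"] by simp
  next
    case False then show ?thesis using diff[of m "n - m"] by (simp add: norm_minus_commute)
  qed
  have "convergent ?y"
    using inc sqrt_iter_bound by (intro Bseq_mono_convergent BseqI'[of _ 1]) (auto simp: incseq_def)
  then have "Cauchy ?y" by (rule convergent_Cauchy)
  then have "Cauchy ?Y"
    unfolding Cauchy_def dist_norm using diff' by (metis order_le_less_trans real_norm_def)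
  then obtain Y where Y: "?Y \<longlonglongrightarrow> Y"
    using Cauchy_convergent convergent_def by blast
  have Yx: "(\<lambda>n. ?Y n x) \<longlonglongrightarrow> Y x" for x
    by (intro tendsto_intros Y)
  have "Y = (1/2) *\<^sub>R (X + (Y o\<^sub>L Y))"
  proof (rule LIMSEQ_unique[OF LIMSEQ_Suc[OF Y]])
    show "(\<lambda>n. ?Y (Suc n)) \<longlonglongrightarrow> (1/2) *\<^sub>R (X + (Y o\<^sub>L Y))"
      unfolding sqrt_iter.simps
      by (intro tendsto_intros Y bounded_bilinear.tendsto[OF bounded_bilinear_blinfun_compose])
  qed
  then have "Y x = (1/2) *\<^sub>R (X x + Y (Y x))" for x
    by (metis blinfun.add_left blinfun.scaleR_left blinfun_apply_blinfun_compose)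
  then have "2 *\<^sub>R Y x = 2 *\<^sub>R (1/2) *\<^sub>R (X x + Y (Y x))" for x by metis
  then have "2 *\<^sub>R Y x = X x + Y (Y x)" for x by simp
  then have eq: "Y x + Y x = X x + Y (Y x)" for x by (simp add: scaleR_2)
  show thesis
  proof
    show "norm Y \<le> 1"
      using step sqrt_iter_bound
      by (intro LIMSEQ_le_const2[OF tendsto_norm[OF Y]]) (meson order_trans)
    show "symmetric Y"
      unfolding symmetric_def
    proof (intro allI)
      fix x y
      show "Y x \<bullet> y = x \<bullet> Y y"
      proof (rule LIMSEQ_unique)
        show "(\<lambda>n. ?Y n x \<bullet> y) \<longlonglongrightarrow> Y x \<bullet> y" by (intro tendsto_intros Yx)
        have "(\<lambda>n. x \<bullet> ?Y n y) \<longlonglongrightarrow> x \<bullet> Y y" by (intro tendsto_intros Yx)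
        then show "(\<lambda>n. ?Y n x \<bullet> y) \<longlonglongrightarrow> x \<bullet> Y y"
          using symmetric_sqrt_iter[OF sX] by (simp add: symmetricD)
      qed
    qed
    fix Z assume Z: "commute Z X"
    show "commute Z Y"
      unfolding commute_def
    proof
      fix x
      show "Z (Y x) = Y (Z x)"
      proof (rule LIMSEQ_unique)
        show "(\<lambda>n. Z (?Y n x)) \<longlonglongrightarrow> Z (Y x)" by (intro tendsto_intros Yx)
        show "(\<lambda>n. Z (?Y n x)) \<longlonglongrightarrow> Y (Z x)"
          using Yx[of "Z x"] unfolding commuteD[OF commute_sqrt_iter[OF Z]] .
      qed
    qed
  next
    fix x
    show "(x - Y x) - Y (x - Y x) = x - X x"
      using eq[of x] by (simp add: blinfun.diff_right algebra_simps)
  qed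
qed

text \<open>
  Two square roots in succession: with \<open>c > \<parallel>C\<parallel>\<close>, the first one turns \<open>C\<^sup>2 / c\<^sup>2\<close> into \<open>\<bar>C\<bar> / c\<close>,
  the second one yields, after rescaling, \<open>T\<close> with \<open>T\<^sup>2 = \<bar>C\<bar>\<close>. Working with this root of \<open>\<bar>C\<bar>\<close> makes positivity
  visible: the form of \<open>\<bar>C\<bar>\<close> at \<open>x\<close> is \<open>\<parallel>T x\<parallel>\<^sup>2\<close>.
\<close>

lemma exists_root_abs:
  fixes C :: "'h::{real_inner,banach} \<Rightarrow>\<^sub>L 'h"
  assumes C: "symmetric C"
  obtains T where "symmetric T" "\<And>Z. commute Z C \<Longrightarrow> commute Z T"
    "\<And>x. T (T (T (T x))) = C (C x)"
proof -
  define c where "c = norm C + 1"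
  have c: "c > 0" unfolding c_def using norm_ge_zero[of C] by linarith
  define C0 where "C0 = (1/c) *\<^sub>R C"
  have C0: "symmetric C0" using C unfolding C0_def symmetric_def by (simp add: blinfun.scaleR_left)
  have "norm C0 \<le> 1" unfolding C0_def using c by (simp add: c_def)
  then have nC0: "norm (C0 x) \<le> norm x" for x
    using norm_blinfun[of C0 x] by (metis mult_left_le_one_le norm_ge_zero order_trans)
  define X where "X = id_blinfun - (C0 o\<^sub>L C0)"
  have Xx: "X x = x - C0 (C0 x)" for x unfolding X_def by (simp add: blinfun.diff_left)
  have "norm X \<le> 1"
  proof (rule norm_blinfun_bound)
    fix x
    have "(norm (X x))\<^sup>2 = (norm x)\<^sup>2 - 2 * (C0 (C0 x) \<bullet> x) + (norm (C0 (C0 x)))\<^sup>2"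
      unfolding Xx power2_norm_eq_inner by (simp add: inner_diff inner_commute)
    also have "C0 (C0 x) \<bullet> x = (norm (C0 x))\<^sup>2"
      using symmetricD[OF C0] by (simp add: power2_norm_eq_inner)
    also have "(norm x)\<^sup>2 - 2 * (norm (C0 x))\<^sup>2 + (norm (C0 (C0 x)))\<^sup>2 \<le> (norm x)\<^sup>2"
      using power_mono[OF nC0[of "C0 x"] norm_ge_zero, of 2] zero_le_power2[of "norm (C0 x)"] by linarith
    finally have "norm (X x) \<le> norm x" by (rule power2_le_imp_le) simp
    then show "norm (X x) \<le> 1 * norm x" by simp
  qed simp
  moreover have "symmetric X"
    using C0 unfolding symmetric_def Xx by (simp add: inner_diff)
  ultimately obtain Y where Y: "norm Y \<le> 1" "symmetric Y" "\<And>Z. commute Z X \<Longrightarrow> commute Z Y"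
    "\<And>x. (x - Y x) - Y (x - Y x) = x - X x" using exists_sqrt_one_minus by blast
  obtain W where W: "norm W \<le> 1" "symmetric W" "\<And>Z. commute Z Y \<Longrightarrow> commute Z W"
    "\<And>x. (x - W x) - W (x - W x) = x - Y x" using exists_sqrt_one_minus Y by blast
  define T where "T = sqrt c *\<^sub>R (id_blinfun - W)"
  have Tx: "T x = sqrt c *\<^sub>R (x - W x)" for x
    unfolding T_def by (simp add: blinfun.diff_left blinfun.scaleR_left)
  have TT: "T (T x) = c *\<^sub>R (x - Y x)" for x
  proof -
    have "T (T x) = (sqrt c * sqrt c) *\<^sub>R ((x - W x) - W (x - W x))"
      unfolding Tx blinfun.scaleR_right scaleR_diff_right[symmetric] scaleR_scaleR ..
    then show ?thesis unfolding W(4) using c by simp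
  qed
  show thesis
  proof
    show "symmetric T" using W(2) unfolding symmetric_def Tx by (simp add: inner_diff)
    fix x
    have "T (T (T (T x))) = (c * c) *\<^sub>R ((x - Y x) - Y (x - Y x))"
      unfolding TT[of "T (T x)"] unfolding TT[of x] blinfun.scaleR_right scaleR_diff_right[symmetric] scaleR_scaleR ..
    also have "\<dots> = (c * c) *\<^sub>R C0 (C0 x)" unfolding Y(4) Xx by simp
    also have "\<dots> = C (C x)" unfolding C0_def using c by (simp add: blinfun.scaleR_left blinfun.scaleR_right)
    finally show "T (T (T (T x))) = C (C x)" .
  next
    fix Z assume Z: "commute Z C"
    have "commute Z X" using Z unfolding commute_def Xx C0_def
      by (simp add: blinfun.diff_right blinfun.scaleR_left blinfun.scaleR_right)
    then have "commute Z W" using Y(3) W(3) by blast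
    then show "commute Z T" unfolding commute_def Tx by (simp add: blinfun.diff_right blinfun.scaleR_right)
  qed
qed

definition root_abs :: "('h::real_inner \<Rightarrow>\<^sub>L 'h) \<Rightarrow> ('h \<Rightarrow>\<^sub>L 'h)"
  where "root_abs C = (SOME T. symmetric T \<and> (\<forall>Z. commute Z C \<longrightarrow> commute Z T) \<and>
    (\<forall>x. T (T (T (T x))) = C (C x)))"

text \<open>
  The kernel of \<open>\<bar>C\<bar> + C\<close>, that is of twice the positive part of \<open>C\<close>, where \<open>\<bar>C\<bar>\<close> is the square of
  \<open>root_abs C\<close>. This is the spectral subspace of \<open>C\<close> for \<open>(-\<infinity>, 0]\<close>.
\<close>

definition nonpos_part :: "('h::real_inner \<Rightarrow>\<^sub>L 'h) \<Rightarrow> 'h set"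
  where "nonpos_part C = {x. C x = - root_abs C (root_abs C x)}"

context
  fixes C :: "'h::{real_inner,banach} \<Rightarrow>\<^sub>L 'h"
  assumes C: "symmetric C"
begin

lemma root_abs:
  shows symmetric_root_abs: "symmetric (root_abs C)"
    and commute_root_abs: "commute Z C \<Longrightarrow> commute Z (root_abs C)"
    and root_abs_power4: "root_abs C (root_abs C (root_abs C (root_abs C x))) = C (C x)"
proof -
  have "\<exists>T. symmetric T \<and> (\<forall>Z. commute Z C \<longrightarrow> commute Z T) \<and>
    (\<forall>x. T (T (T (T x))) = C (C x))" using exists_root_abs[OF C] by metis
  from someI_ex[OF this, folded root_abs_def]
  show "symmetric (root_abs C)" "commute Z C \<Longrightarrow> commute Z (root_abs C)"
    "root_abs C (root_abs C (root_abs C (root_abs C x))) = C (C x)" by blast+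
qed

lemma commute_C_root_abs: "C (root_abs C x) = root_abs C (C x)"
  using commute_root_abs[of C] by (simp add: commute_def)

lemma closed_nonpos_part: "closed (nonpos_part C)"
  unfolding nonpos_part_def by (intro closed_Collect_eq continuous_intros)

lemma subspace_nonpos_part: "subspace (nonpos_part C)"
  unfolding nonpos_part_def
  by (rule subspaceI) (auto simp: blinfun.add_right blinfun.scaleR_right)

lemma nonpos_part_invariant:
  assumes "commute D C" "x \<in> nonpos_part C" shows "D x \<in> nonpos_part C"
  using assms commute_root_abs[OF assms(1)] unfolding nonpos_part_def commute_def
  by (simp, metis blinfun.minus_right)

lemma root_abs_inner: "root_abs C (root_abs C x) \<bullet> x = (norm (root_abs C x))\<^sup>2"
  using symmetric_root_abs by (simp add: symmetric_def power2_norm_eq_inner)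

lemma inner_le_0_on_nonpos_part: "x \<in> nonpos_part C \<Longrightarrow> C x \<bullet> x \<le> 0"
  unfolding nonpos_part_def by (simp add: root_abs_inner)

text \<open>
  Since \<open>(\<bar>C\<bar> + C) (\<bar>C\<bar> - C) = 0\<close>, the range of the symmetric operator \<open>\<bar>C\<bar> - C\<close> lies in the
  nonpositive part, so \<open>\<bar>C\<bar> - C\<close> vanishes on the orthogonal complement.
\<close>

lemma eq_abs_on_orthogonal:
  assumes "\<And>y. y \<in> nonpos_part C \<Longrightarrow> x \<bullet> y = 0"
  shows "C x = root_abs C (root_abs C x)"
proof -
  let ?T = "root_abs C"
  let ?D = "?T (?T x) - C x"
  have "?T (?T ?D) - C ?D \<in> nonpos_part C"
    unfolding nonpos_part_def
    by (simp add: blinfun.diff_right root_abs_power4 commute_C_root_abs)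
  then have "x \<bullet> (?T (?T ?D) - C ?D) = 0" by (rule assms)
  then have "?D \<bullet> ?D = 0"
    using symmetricD[OF C] symmetricD[OF symmetric_root_abs] by (simp add: inner_diff_right inner_diff_left blinfun.diff_right)
  then show ?thesis by simp
qed

text \<open>
  On the complement the form of \<open>C\<close> is that of \<open>\<bar>C\<bar>\<close>; if it is not positive at \<open>x\<close>, then
  \<open>C x = 0\<close>, and the kernel of \<open>C\<close> belongs to the nonpositive part.
\<close>

lemma orthogonal_nonpos_part_eq_0:
  assumes "\<And>y. y \<in> nonpos_part C \<Longrightarrow> x \<bullet> y = 0" "C x \<bullet> x \<le> 0"
  shows "x = 0"
proof -
  have eq: "C x = root_abs C (root_abs C x)" using eq_abs_on_orthogonal assms by blast
  then have "norm (root_abs C x) ^ 2 \<le> 0" using assms(2) root_abs_inner by simp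
  then have "root_abs C x = 0" by simp
  then have "x \<in> nonpos_part C" unfolding nonpos_part_def using eq by simp
  then have "x \<bullet> x = 0" using assms(1) by blast
  then show ?thesis by simp
qed

lemma inner_ge_0_on_orthogonal:
  assumes "\<And>y. y \<in> nonpos_part C \<Longrightarrow> x \<bullet> y = 0"
  shows "C x \<bullet> x \<ge> 0"
  using eq_abs_on_orthogonal[OF assms] by (simp add: root_abs_inner)

end

text \<open>
  The roots \<open>T\<close> of \<open>\<bar>C\<bar>\<close> and \<open>U\<close> of \<open>\<bar>D\<bar>\<close> commute, hence
  \<open>C x \<bullet> D x = - (T\<^sup>2 x \<bullet> U\<^sup>2 x) = - \<parallel>U T x\<parallel>\<^sup>2\<close>.
\<close>

lemma inner_opposite_signs:
  fixes C D :: "'h::{real_inner,banach} \<Rightarrow>\<^sub>L 'h"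
  assumes C: "symmetric C" and D: "symmetric D" and CD: "commute C D"
    and x: "\<And>y. y \<in> nonpos_part C \<Longrightarrow> x \<bullet> y = 0" "x \<in> nonpos_part D"
  shows "C x \<bullet> D x \<le> 0"
proof -
  let ?T = "root_abs C" and ?U = "root_abs D"
  have c: "commute ?U ?T"
    using CD C D by (intro commute_root_abs[OF C] commute_sym[OF commute_root_abs[OF D]])
  have "C x = ?T (?T x)" using eq_abs_on_orthogonal[OF C x(1)] by blast
  moreover have "D x = - ?U (?U x)" using x(2) unfolding nonpos_part_def by simp
  ultimately have "C x \<bullet> D x = - (?T (?T x) \<bullet> ?U (?U x))" by simp
  also have "?T (?T x) \<bullet> ?U (?U x) = ?T x \<bullet> ?T (?U (?U x))"
    using symmetricD[OF symmetric_root_abs[OF C]] by simp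
  also have "\<dots> = ?T x \<bullet> ?U (?U (?T x))" using commuteD[OF c] by simp
  also have "\<dots> = (norm (?U (?T x)))\<^sup>2"
    using symmetricD[OF symmetric_root_abs[OF D]] by (simp add: power2_norm_eq_inner)
  finally show ?thesis by simp
qed

section \<open>Monotone families of projections\<close>

lemma convergent_of_monotone_norms:
  fixes u :: "nat \<Rightarrow> 'h::{real_inner,banach}"
  assumes "monoseq (\<lambda>n. (norm (u n))\<^sup>2)" "\<And>n. norm (u n) \<le> K"
    and d: "\<And>m n. m \<le> n \<Longrightarrow> (norm (u n - u m))\<^sup>2 \<le> \<bar>(norm (u n))\<^sup>2 - (norm (u m))\<^sup>2\<bar>"
  shows "convergent u"
proof -
  have "Bseq (\<lambda>n. (norm (u n))\<^sup>2)"
    using assms(2) by (intro BseqI'[of _ "K\<^sup>2"]) (simp add: power_mono)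
  then have C: "Cauchy (\<lambda>n. (norm (u n))\<^sup>2)"
    using assms(1) Bseq_monoseq_convergent convergent_Cauchy by blast
  have d': "(norm (u n - u m))\<^sup>2 \<le> \<bar>(norm (u n))\<^sup>2 - (norm (u m))\<^sup>2\<bar>" for m n
    using d[of m n] d[of n m] by (cases "m \<le> n") (simp_all add: norm_minus_commute abs_minus_commute)
  have "Cauchy u"
  proof (rule metric_CauchyI)
    fix e :: real assume e: "e > 0"
    then obtain M where M: "\<And>m n. m \<ge> M \<Longrightarrow> n \<ge> M \<Longrightarrow> dist ((norm (u m))\<^sup>2) ((norm (u n))\<^sup>2) < e\<^sup>2"
      using metric_CauchyD[OF C, of "e\<^sup>2"] by auto
    show "\<exists>M. \<forall>m\<ge>M. \<forall>n\<ge>M. dist (u m) (u n) < e"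
    proof (intro exI allI impI)
      fix m n assume "m \<ge> M" "n \<ge> M"
      then have "(norm (u m - u n))\<^sup>2 < e\<^sup>2"
        using d'[of m n] M[of m n] by (simp add: dist_real_def)
      then show "dist (u m) (u n) < e"
        using e by (simp add: dist_norm power_less_imp_less_base)
    qed
  qed
  then show ?thesis by (rule Cauchy_convergent)
qed

lemma proj_nested:
  fixes V W :: "'h::{real_inner,banach} set"
  assumes V: "closed V" "subspace V" and W: "closed W" "subspace W" and VW: "V \<subseteq> W"
  shows "proj W (proj V x) = proj V x" "proj V (proj W x) = proj V x"
    "(norm (proj W x - proj V x))\<^sup>2 = (norm (proj W x))\<^sup>2 - (norm (proj V x))\<^sup>2"
proof -
  show 1: "proj W (proj V x) = proj V x"
    using proj_of_mem[OF W] proj_in[OF V] VW by blast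
  show 2: "proj V (proj W x) = proj V x"
  proof (rule proj_unique[OF V])
    fix v assume v: "v \<in> V"
    show "(proj W x - proj V x) \<bullet> v = 0"
      using proj_orthogonal[OF V v, of x] proj_orthogonal[OF W, of v x] v VW
      by (auto simp: inner_diff_left)
  qed (rule proj_in[OF V])
  show "(norm (proj W x - proj V x))\<^sup>2 = (norm (proj W x))\<^sup>2 - (norm (proj V x))\<^sup>2"
    using orthogonal_projection_pythagoras[OF orthogonal_projection_proj[OF V], of "proj W x"]
    unfolding 2 by simp
qed

lemma proj_decseq_tendsto:
  fixes V :: "nat \<Rightarrow> 'h::{real_inner,banach} set"
  assumes V: "\<And>n. closed (V n)" "\<And>n. subspace (V n)" and dec: "decseq V"
    and W: "closed W" "subspace W" "W = (\<Inter>n. V n)"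
  shows "(\<lambda>n. proj (V n) x) \<longlonglongrightarrow> proj W x"
proof -
  let ?u = "\<lambda>n. proj (V n) x"
  note op = orthogonal_projection_proj[OF V]
  have eq: "(norm (?u n - ?u m))\<^sup>2 = (norm (?u m))\<^sup>2 - (norm (?u n))\<^sup>2" if "m \<le> n" for m n
    using proj_nested(3)[OF V(1,2) V(1,2), of n m x] that dec
    by (metis decseqD norm_minus_commute)
  have "decseq (\<lambda>n. (norm (?u n))\<^sup>2)"
    unfolding decseq_def using eq by (metis diff_ge_0_iff_ge zero_le_power2)
  then have "convergent ?u"
    using eq orthogonal_projection_norm_le[OF op]
    by (intro convergent_of_monotone_norms[of _ "norm x"]) (auto simp: decseq_imp_monoseq)
  then obtain p where p: "?u \<longlonglongrightarrow> p" unfolding convergent_def by blast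
  have "p \<in> V n" for n
  proof (rule Lim_in_closed_set[OF V(1) _ _ p])
    show "\<forall>\<^sub>F m in sequentially. ?u m \<in> V n"
      using eventually_ge_at_top[of n]
      by eventually_elim (metis dec decseqD in_mono proj_in V)
  qed simp
  then have pW: "p \<in> W" using W by blast
  have "proj W x = p"
  proof (rule proj_unique[OF W(1,2) pW])
    fix v assume "v \<in> W"
    then have "(\<lambda>n. (x - ?u n) \<bullet> v) = (\<lambda>n. 0)" using W proj_orthogonal[OF V] by auto
    moreover have "(\<lambda>n. (x - ?u n) \<bullet> v) \<longlonglongrightarrow> (x - p) \<bullet> v" by (intro tendsto_intros p)
    ultimately show "(x - p) \<bullet> v = 0" using LIMSEQ_unique tendsto_const by metis
  qed
  then show ?thesis using p by simp
qed

lemma proj_incseq_tendsto: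
  fixes V :: "nat \<Rightarrow> 'h::{real_inner,banach} set"
  assumes V: "\<And>n. closed (V n)" "\<And>n. subspace (V n)" and inc: "incseq V"
    and dense: "\<And>z. (\<And>n v. v \<in> V n \<Longrightarrow> z \<bullet> v = 0) \<Longrightarrow> z = 0"
  shows "(\<lambda>n. proj (V n) x) \<longlonglongrightarrow> x"
proof -
  let ?u = "\<lambda>n. proj (V n) x"
  note op = orthogonal_projection_proj[OF V]
  have eq: "(norm (?u n - ?u m))\<^sup>2 = (norm (?u n))\<^sup>2 - (norm (?u m))\<^sup>2" if "m \<le> n" for m n
    using proj_nested(3)[OF V(1,2) V(1,2), of m n x] that inc by (metis incseqD)
  have "incseq (\<lambda>n. (norm (?u n))\<^sup>2)"
    unfolding incseq_def using eq by (metis diff_ge_0_iff_ge zero_le_power2)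
  then have "convergent ?u"
    using eq orthogonal_projection_norm_le[OF op]
    by (intro convergent_of_monotone_norms[of _ "norm x"]) (auto simp: incseq_imp_monoseq)
  then obtain p where p: "?u \<longlonglongrightarrow> p" unfolding convergent_def by blast
  have "x - p = 0"
  proof (rule dense)
    fix n v assume v: "v \<in> V n"
    have "\<forall>\<^sub>F m in sequentially. (x - ?u m) \<bullet> v = 0"
      using eventually_ge_at_top[of n]
      by eventually_elim (metis inc incseqD in_mono proj_orthogonal V v)
    then have "(\<lambda>n. (x - ?u n) \<bullet> v) \<longlonglongrightarrow> 0" by (rule tendsto_eventually)
    moreover have "(\<lambda>n. (x - ?u n) \<bullet> v) \<longlonglongrightarrow> (x - p) \<bullet> v" by (intro tendsto_intros p)
    ultimately show "(x - p) \<bullet> v = 0" using LIMSEQ_unique by blast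
  qed
  then show ?thesis using p by simp
qed

text \<open>
  On the range of \<open>P i\<close> the summand \<open>P i\<close> alone exhausts the bound, so the other projections vanish
  there: the ranges are mutually orthogonal and the partial sums are again projections.
\<close>

lemma orthogonal_projection_sums:
  fixes P :: "nat \<Rightarrow> 'h::{real_inner,banach} \<Rightarrow> 'h"
  assumes P: "\<And>i. orthogonal_projection (P i)"
    and le: "\<And>x n. (\<Sum>i<n. P i x \<bullet> x) \<le> (norm x)\<^sup>2"
  obtains Q where "orthogonal_projection Q" "\<And>x. (\<lambda>i. P i x) sums Q x"
proof -
  note PD = orthogonal_projectionD[OF P]
  have nonneg: "P i x \<bullet> x \<ge> 0" for i x using orthogonal_projection_inner[OF P, of i x] by simp
  have orth: "P j (P i x) = 0" if "i \<noteq> j" for i j x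
  proof -
    let ?y = "P i x"
    have "(\<Sum>k\<in>{i,j}. P k ?y \<bullet> ?y) \<le> (\<Sum>k<Suc (max i j). P k ?y \<bullet> ?y)"
      using nonneg by (intro sum_mono2) auto
    also have "\<dots> \<le> (norm ?y)\<^sup>2" by (rule le)
    finally have "(norm (P j ?y))\<^sup>2 \<le> 0"
      using that orthogonal_projection_inner[OF P, of j ?y] by (simp add: PD(2) power2_norm_eq_inner)
    then show ?thesis by simp
  qed
  define S where "S n x = (\<Sum>i<n. P i x)" for n x
  have nS: "(norm (S n x))\<^sup>2 = (\<Sum>i<n. P i x \<bullet> x)" for n x
  proof (induction n)
    case (Suc n)
    have "S n x \<bullet> P n x = 0"
      unfolding S_def inner_sum_left
    proof (rule sum.neutral, rule ballI)
      fix i assume "i \<in> {..<n}"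
      then have "P n (P i x) = 0" using orth by auto
      then show "P i x \<bullet> P n x = 0" using PD(3)[of n "P i x" x] by simp
    qed
    moreover have "S (Suc n) x = S n x + P n x" by (simp add: S_def)
    ultimately show ?case
      using Suc orthogonal_projection_inner[OF P, of n x]
      by (simp add: power2_norm_eq_inner inner_add inner_commute)
  qed (simp add: S_def)
  have PS: "P j (S n x) = (if j < n then P j x else 0)" for j n x
  proof -
    have "P j (S n x) = (\<Sum>i<n. P j (P i x))"
      unfolding S_def using PD(1) by (rule linear_sum)
    also have "\<dots> = (\<Sum>i<n. if i = j then P j x else 0)"
      using orth PD(2) by (intro sum.cong) auto
    finally show ?thesis by simp
  qed
  have conv: "convergent (\<lambda>n. S n x)" for x
  proof (rule convergent_of_monotone_norms[of _ "norm x"])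
    show "monoseq (\<lambda>n. (norm (S n x))\<^sup>2)"
      unfolding nS using nonneg by (intro incseq_imp_monoseq incseq_SucI) simp
    show "norm (S n x) \<le> norm x" for n
      using le[of x n] unfolding nS[symmetric] by (rule power2_le_imp_le) simp
    fix m n :: nat assume mn: "m \<le> n"
    have "S m x \<bullet> S n x = (norm (S m x))\<^sup>2"
    proof -
      have "S m x \<bullet> S n x = (\<Sum>i<m. P i x \<bullet> S n x)" by (simp add: S_def inner_sum_left)
      also have "\<dots> = (\<Sum>i<m. x \<bullet> P i (S n x))" using PD(3) by simp
      also have "\<dots> = (\<Sum>i<m. P i x \<bullet> x)"
        using mn by (intro sum.cong) (auto simp: PS inner_commute)
      finally show ?thesis using nS by simp
    qed
    then have "(norm (S n x - S m x))\<^sup>2 = (norm (S n x))\<^sup>2 - (norm (S m x))\<^sup>2"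
      by (simp add: power2_norm_eq_inner inner_diff inner_commute)
    then show "(norm (S n x - S m x))\<^sup>2 \<le> \<bar>(norm (S n x))\<^sup>2 - (norm (S m x))\<^sup>2\<bar>" by simp
  qed
  define Q where "Q x = lim (\<lambda>n. S n x)" for x
  have Q: "(\<lambda>n. S n x) \<longlonglongrightarrow> Q x" for x
    unfolding Q_def using conv by (simp add: convergent_LIMSEQ_iff)
  have linS: "linear (S n)" for n
    unfolding S_def using PD(1) by (intro linear_compose_sum) auto
  have sym: "Q x \<bullet> y = x \<bullet> Q y" for x y
  proof (rule LIMSEQ_unique)
    show "(\<lambda>n. S n x \<bullet> y) \<longlonglongrightarrow> Q x \<bullet> y" by (intro tendsto_intros Q)
    have "(\<lambda>n. x \<bullet> S n y) \<longlonglongrightarrow> x \<bullet> Q y" by (intro tendsto_intros Q)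
    moreover have "S n x \<bullet> y = x \<bullet> S n y" for n
      using PD(3) by (simp add: S_def inner_sum_left inner_sum_right)
    ultimately show "(\<lambda>n. S n x \<bullet> y) \<longlonglongrightarrow> x \<bullet> Q y" by simp
  qed
  have QS: "Q (S n x) = S n x" for n x
  proof (rule LIMSEQ_unique[OF Q])
    have "S m (S n x) = S n x" if "m \<ge> n" for m
    proof -
      have "S m (S n x) = (\<Sum>i<m. if i < n then P i x else 0)" by (simp only: S_def[of m] PS)
      also have "\<dots> = (\<Sum>i\<in>{..<m} \<inter> {i. i < n}. P i x)"
        by (simp add: sum.If_cases)
      also have "{..<m} \<inter> {i. i < n} = {..<n}" using that by auto
      finally show ?thesis by (simp add: S_def)
    qed
    then show "(\<lambda>m. S m (S n x)) \<longlonglongrightarrow> S n x"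
      by (intro tendsto_eventually) (use eventually_ge_at_top[of n] in \<open>eventually_elim, auto\<close>)
  qed
  have idem: "Q (Q x) = Q x" for x
  proof -
    have "Q (Q x) \<bullet> y = Q x \<bullet> y" for y
    proof (rule LIMSEQ_unique)
      have "(\<lambda>n. S n x \<bullet> Q y) \<longlonglongrightarrow> Q x \<bullet> Q y" by (intro tendsto_intros Q)
      moreover have "S n x \<bullet> Q y = S n x \<bullet> y" for n using sym[of "S n x" y] QS by simp
      ultimately show "(\<lambda>n. S n x \<bullet> y) \<longlonglongrightarrow> Q (Q x) \<bullet> y"
        using sym[of "Q x" y] by simp
      show "(\<lambda>n. S n x \<bullet> y) \<longlonglongrightarrow> Q x \<bullet> y" by (intro tendsto_intros Q)
    qed
    then have "(Q (Q x) - Q x) \<bullet> (Q (Q x) - Q x) = 0" by (simp add: inner_diff_left)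
    then show ?thesis by simp
  qed
  have "linear Q"
  proof (rule linearI)
    fix x y :: 'h and c :: real
    show "Q (x + y) = Q x + Q y"
      using linS by (intro LIMSEQ_unique[OF Q]) (simp add: linear_add, intro tendsto_intros Q)
    show "Q (c *\<^sub>R x) = c *\<^sub>R Q x"
      using linS by (intro LIMSEQ_unique[OF Q]) (simp add: linear_scale, intro tendsto_intros Q)
  qed
  then have "orthogonal_projection Q"
    unfolding orthogonal_projection_def using idem sym by auto
  moreover have "(\<lambda>i. P i x) sums Q x" for x
    unfolding sums_def using Q[of x] by (simp add: S_def)
  ultimately show thesis by (rule that)
qed

section \<open>Spectral projections of a self-adjoint operator\<close>

lemma closed_adjoint_graph: "closed (adjoint_graph A)"
proof -
  have "adjoint_graph A = (\<Inter>a\<in>A. {p. snd a \<bullet> fst p = fst a \<bullet> snd p})"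
    unfolding adjoint_graph_def by fastforce
  moreover have "closed \<dots>"
    by (intro closed_INT ballI closed_Collect_eq continuous_intros)
  ultimately show ?thesis by simp
qed

locale self_adjoint_operator =
  fixes A :: "('h::{real_inner,banach} \<times> 'h) set"
  assumes self_adjoint: "self_adjoint A"
begin

lemma closed_A: "closed A"
  using self_adjoint closed_adjoint_graph[of A] unfolding self_adjoint_def by metis

lemma subspace_A: "subspace A"
  using self_adjoint unfolding self_adjoint_def operator_def by blast

lemma unique: "(x, y) \<in> A \<Longrightarrow> (x, z) \<in> A \<Longrightarrow> y = z"
  using self_adjoint unfolding self_adjoint_def operator_def single_valued_def by blast

text \<open>
  A quarter turn of \<open>'h \<times> 'h\<close> maps the orthogonal complement of the graph onto the adjoint graph.
\<close>

lemma in_A_iff_orthogonal: "(q, - p) \<in> A \<longleftrightarrow> (\<forall>a\<in>A. (p, q) \<bullet> a = 0)"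
proof -
  have "(q, - p) \<in> A \<longleftrightarrow> (q, - p) \<in> adjoint_graph A"
    using self_adjoint unfolding self_adjoint_def by simp
  also have "\<dots> \<longleftrightarrow> (\<forall>a\<in>A. (p, q) \<bullet> a = 0)"
    unfolding adjoint_graph_def by (auto simp: inner_commute algebra_simps)
  finally show ?thesis .
qed

text \<open>
  These are \<open>B = (1 + A\<^sup>2)\<^sup>-\<^sup>1\<close> and \<open>C = A (1 + A\<^sup>2)\<^sup>-\<^sup>1\<close>: decomposing \<open>(x, 0)\<close> into an element of the
  graph and one of its rotated copy means solving \<open>x = v + A\<^sup>2 v\<close>, and then \<open>B x = v\<close>, \<open>C x = A v\<close>.
\<close>

definition B :: "'h \<Rightarrow>\<^sub>L 'h" where "B = Blinfun (\<lambda>x. fst (proj A (x, 0)))"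
definition C :: "'h \<Rightarrow>\<^sub>L 'h" where "C = Blinfun (\<lambda>x. snd (proj A (x, 0)))"

lemma BC_eq: "proj A (x, 0) = (B x, C x)"
proof -
  note bl = orthogonal_projection_bounded_linear[OF orthogonal_projection_proj[OF closed_A subspace_A]]
  have p: "bounded_linear (\<lambda>x::'h. (x, 0::'h))"
    by (intro bounded_linear_Pair bounded_linear_ident bounded_linear_zero)
  have "bounded_linear (\<lambda>x. fst (proj A (x, 0)))" "bounded_linear (\<lambda>x. snd (proj A (x, 0)))"
    using bounded_linear_compose[OF bounded_linear_fst bounded_linear_compose[OF bl p]]
      bounded_linear_compose[OF bounded_linear_snd bounded_linear_compose[OF bl p]] by auto
  then show ?thesis unfolding B_def C_def by (simp add: bounded_linear_Blinfun_apply)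
qed

lemma BC_in: "(B x, C x) \<in> A"
  using proj_in[OF closed_A subspace_A] BC_eq by metis

lemma CB_in: "(C x, x - B x) \<in> A"
proof -
  have "\<forall>a\<in>A. ((x, 0) - (B x, C x)) \<bullet> a = 0"
    using proj_orthogonal[OF closed_A subspace_A] BC_eq by metis
  then have "(- C x, - (x - B x)) \<in> A"
    using in_A_iff_orthogonal[of "- C x" "x - B x"] by simp
  from subspace_scale[OF subspace_A this, of "-1"] show ?thesis by simp
qed

text \<open>
  As a block matrix the projection onto the graph has rows \<open>B, C\<close> and \<open>C, 1 - B\<close>. Symmetry and
  idempotence of this matrix give the symmetry of \<open>B\<close> and \<open>C\<close>, their commutation, and the identity
  \<open>B x \<bullet> x = \<parallel>B x\<parallel>\<^sup>2 + \<parallel>C x\<parallel>\<^sup>2\<close>.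
\<close>

lemma proj_A: "proj A (x, y) = (B x + C y, C x + (y - B y))"
proof -
  have "proj A (0, y) = (C y, y - B y)"
  proof (rule proj_unique[OF closed_A subspace_A CB_in])
    have "(B (- y), C (- y)) \<in> A" by (rule BC_in)
    then have "\<forall>a\<in>A. (- C y, B y) \<bullet> a = 0"
      using in_A_iff_orthogonal[of "B y" "- C y"] subspace_scale[OF subspace_A BC_in[of y], of 1]
      by simp
    then show "((0, y) - (C y, y - B y)) \<bullet> v = 0" if "v \<in> A" for v
      using that by simp
  qed
  moreover have "proj A (x, y) = proj A (x, 0) + proj A (0, y)"
    using linear_add[OF orthogonal_projectionD(1)[OF orthogonal_projection_proj[OF closed_A subspace_A]], of "(x,0)" "(0,y)"]
    by simp
  ultimately show ?thesis by (simp add: BC_eq)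
qed

lemma in_A_iff: "(x, y) \<in> A \<longleftrightarrow> x = B x + C y \<and> y = C x + (y - B y)"
proof -
  have "(x, y) \<in> A \<longleftrightarrow> proj A (x, y) = (x, y)"
    using proj_of_mem[OF closed_A subspace_A] proj_in[OF closed_A subspace_A] by metis
  then show ?thesis unfolding proj_A by auto
qed

lemma symmetric_B: "symmetric B" and symmetric_C: "symmetric C"
proof -
  note sym = orthogonal_projectionD(3)[OF orthogonal_projection_proj[OF closed_A subspace_A]]
  show "symmetric B"
    unfolding symmetric_def using sym[of "(_,0)" "(_,0)"] by (simp add: BC_eq)
  show "symmetric C"
    unfolding symmetric_def using sym[of "(_,0)" "(0,_)"] by (simp add: proj_A)
qed

lemma commute_BC: "commute C B"
proof -
  have "C (B x) = B (C x)" for x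
    using BC_in[of x] unfolding in_A_iff[of "B x"] by (simp add: algebra_simps)
  then show ?thesis by (simp add: commute_def)
qed

lemma B_inner: "B x \<bullet> x = (norm (B x))\<^sup>2 + (norm (C x))\<^sup>2"
  using orthogonal_projection_inner[OF orthogonal_projection_proj[OF closed_A subspace_A], of "(x,0)"]
  by (simp add: BC_eq norm_Pair)

lemma B_nonneg: "B x \<bullet> x \<ge> 0" unfolding B_inner by simp

lemma B_eq_0: assumes "B x \<bullet> x \<le> 0" shows "x = 0"
proof -
  have "(norm (B x))\<^sup>2 + (norm (C x))\<^sup>2 \<le> 0" using assms B_inner by simp
  then have "(norm (B x))\<^sup>2 = 0" "(norm (C x))\<^sup>2 = 0"
    by (smt (verit) zero_le_power2)+
  then have "B x = 0" "C x = 0" by auto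
  then have "(0, x) \<in> A" using CB_in[of x] by simp
  moreover have "(0, 0) \<in> A" using subspace_0[OF subspace_A] by (simp add: zero_prod_def)
  ultimately show ?thesis using unique by blast
qed

text \<open>
  The graph is the set of fixed points of \<open>proj A\<close>, and \<open>P \<times> P\<close> commutes with its blocks.
\<close>

lemma reduces:
  assumes "linear P" "\<And>x. P (B x) = B (P x)" "\<And>x. P (C x) = C (P x)" "(x, y) \<in> A"
  shows "(P x, P y) \<in> A"
proof -
  have "x = B x + C y" "y = C x + (y - B y)" using assms(4) in_A_iff by blast+
  then have "P x = P (B x + C y)" "P y = P (C x + (y - B y))" by (auto intro: arg_cong[of _ _ P])
  moreover have "P (B x + C y) = B (P x) + C (P y)" "P (C x + (y - B y)) = C (P x) + (P y - B (P y))"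
    by (simp_all add: linear_add[OF assms(1)] linear_diff[OF assms(1)] assms(2,3))
  ultimately show ?thesis unfolding in_A_iff by metis
qed

text \<open>
  The operator \<open>C - l B = (A - l) (1 + A\<^sup>2)\<^sup>-\<^sup>1\<close> is bounded and has the sign of \<open>A - l\<close>, so that its
  nonpositive part is the spectral subspace of \<open>A\<close> for \<open>(-\<infinity>, l]\<close>.
\<close>

definition shift :: "real \<Rightarrow> 'h \<Rightarrow>\<^sub>L 'h" where "shift l = C - l *\<^sub>R B"
definition M :: "real \<Rightarrow> 'h set" where "M l = nonpos_part (shift l)"
abbreviation PM :: "real \<Rightarrow> 'h \<Rightarrow> 'h" where "PM l \<equiv> proj (M l)"

lemma shift_apply: "shift l x = C x - l *\<^sub>R B x"
  by (simp add: shift_def blinfun.diff_left blinfun.scaleR_left)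

lemma symmetric_shift: "symmetric (shift l)"
  using symmetric_B symmetric_C
  by (simp add: symmetric_def shift_apply inner_diff_left inner_diff_right)

lemma commute_B_shift: "commute B (shift l)" and commute_C_shift: "commute C (shift l)"
  using commute_BC by (simp_all add: commute_def shift_apply blinfun.diff_right blinfun.scaleR_right)

lemma commute_shift_shift: "commute (shift l) (shift m)"
  using commute_BC unfolding commute_def shift_apply
  by (simp add: blinfun.diff_right blinfun.scaleR_right algebra_simps)

lemma closed_M: "closed (M l)" and subspace_M: "subspace (M l)"
  unfolding M_def by (rule closed_nonpos_part subspace_nonpos_part symmetric_shift)+

lemmas proj_M = orthogonal_projection_proj[OF closed_M subspace_M]

lemma invariant_M: "commute D (shift l) \<Longrightarrow> x \<in> M l \<Longrightarrow> D x \<in> M l"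
  unfolding M_def using nonpos_part_invariant[OF symmetric_shift] .

lemma PM_commute: 
  assumes "commute D (shift l)" "symmetric D"
  shows "PM l (D x) = D (PM l x)"
  using assms invariant_M
  by (intro proj_commute[OF closed_M subspace_M]) (auto simp: symmetric_def blinfun.bounded_linear_right bounded_linear.linear)

lemma M_le: "x \<in> M l \<Longrightarrow> C x \<bullet> x \<le> l * (B x \<bullet> x)"
  using inner_le_0_on_nonpos_part[OF symmetric_shift, of x l]
  by (simp add: M_def shift_apply inner_diff_left)

lemma M_ge: "(\<And>y. y \<in> M l \<Longrightarrow> x \<bullet> y = 0) \<Longrightarrow> C x \<bullet> x \<ge> l * (B x \<bullet> x)"
  using inner_ge_0_on_orthogonal[OF symmetric_shift, of l x]
  by (simp add: M_def shift_apply inner_diff_left)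

lemma M_ortho_eq_0:
  assumes "\<And>y. y \<in> M l \<Longrightarrow> x \<bullet> y = 0" "C x \<bullet> x \<le> l * (B x \<bullet> x)"
  shows "x = 0"
  using assms unfolding M_def
  by (intro orthogonal_nonpos_part_eq_0[OF symmetric_shift]) (auto simp: shift_apply inner_diff_left)

lemma PM_remainder:
  assumes "x \<in> M m"
  shows "x - PM l x \<in> M m" "y \<in> M l \<Longrightarrow> (x - PM l x) \<bullet> y = 0"
proof -
  show "(x - PM l x) \<bullet> y = 0" if "y \<in> M l"
    using proj_orthogonal[OF closed_M subspace_M that] .
  let ?P = "Blinfun (PM l)"
  have P: "?P x = PM l x" for x
    using orthogonal_projection_bounded_linear[OF proj_M] by (simp add: bounded_linear_Blinfun_apply)
  have "commute ?P (shift m)"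
    unfolding commute_def P using PM_commute[OF commute_shift_shift symmetric_shift] by simp
  from invariant_M[OF this assms] show "x - PM l x \<in> M m"
    using assms by (auto simp: P intro: subspace_diff[OF subspace_M])
qed

text \<open>
  On the part of \<open>M l\<close> orthogonal to \<open>M m\<close> the form of \<open>C\<close> is at most \<open>l\<close> times and at least \<open>m\<close>
  times that of \<open>B\<close>, and the form of \<open>B\<close> is positive definite. The same comparison yields the
  right-continuity of \<open>l \<mapsto> M l\<close> and its limits at \<open>\<plusminus>\<infinity>\<close>.
\<close>

lemma M_mono: assumes "l \<le> m" shows "M l \<subseteq> M m"
proof
  fix x assume x: "x \<in> M l"
  let ?z = "x - PM m x"
  have "C ?z \<bullet> ?z \<le> l * (B ?z \<bullet> ?z)" using PM_remainder(1)[OF x] by (rule M_le)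
  also have "\<dots> \<le> m * (B ?z \<bullet> ?z)" using assms B_nonneg by (intro mult_right_mono)
  finally have "?z = 0" using PM_remainder(2)[OF x] by (intro M_ortho_eq_0[of m]) auto
  then show "x \<in> M m" using proj_in[OF closed_M subspace_M, of m x] by simp
qed

lemma M_Inter: 
  assumes "f \<longlonglongrightarrow> l" "\<And>n::nat. l \<le> f n" shows "M l = (\<Inter>n. M (f n))"
proof
  show "M l \<subseteq> (\<Inter>n. M (f n))" using M_mono assms(2) by blast
  show "(\<Inter>n. M (f n)) \<subseteq> M l"
  proof
    fix x assume x: "x \<in> (\<Inter>n. M (f n))"
    let ?z = "x - PM l x"
    have "?z \<in> M (f n)" for n using x PM_remainder by blast
    then have "C ?z \<bullet> ?z \<le> f n * (B ?z \<bullet> ?z)" for n by (rule M_le)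
    moreover have "(\<lambda>n. f n * (B ?z \<bullet> ?z)) \<longlonglongrightarrow> l * (B ?z \<bullet> ?z)" by (intro tendsto_intros assms)
    ultimately have "C ?z \<bullet> ?z \<le> l * (B ?z \<bullet> ?z)"
      using LIMSEQ_le_const by blast
    moreover have "x \<in> M (f 0)" using x by blast
    ultimately have "?z = 0" using PM_remainder(2) by (intro M_ortho_eq_0[of l]) auto
    then show "x \<in> M l" using proj_in[OF closed_M subspace_M, of l x] by simp
  qed
qed

lemma M_Inter_bot: "(\<Inter>n. M (- real n)) = {0}"
proof
  show "{0} \<subseteq> (\<Inter>n. M (- real n))" using subspace_0[OF subspace_M] by blast
  show "(\<Inter>n. M (- real n)) \<subseteq> {0}"
  proof
    fix z assume z: "z \<in> (\<Inter>n. M (- real n))"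
    have "B z \<bullet> z \<le> 0"
    proof (rule ccontr)
      assume a: "\<not> B z \<bullet> z \<le> 0"
      obtain n :: nat where "- (C z \<bullet> z) < real n * (B z \<bullet> z)"
        using reals_Archimedean3[of "B z \<bullet> z"] a by auto
      moreover have "C z \<bullet> z \<le> - real n * (B z \<bullet> z)" using z by (intro M_le) blast
      ultimately show False by simp
    qed
    then show "z \<in> {0}" using B_eq_0 by simp
  qed
qed

lemma M_dense: assumes "\<And>n v. v \<in> M (real n) \<Longrightarrow> z \<bullet> v = 0" shows "z = 0"
proof -
  have "B z \<bullet> z \<le> 0"
  proof (rule ccontr)
    assume a: "\<not> B z \<bullet> z \<le> 0"
    obtain n :: nat where "C z \<bullet> z < real n * (B z \<bullet> z)"
      using reals_Archimedean3[of "B z \<bullet> z"] a by auto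
    moreover have "C z \<bullet> z \<ge> real n * (B z \<bullet> z)" using assms by (intro M_ge) blast
    ultimately show False by simp
  qed
  then show "z = 0" using B_eq_0 by simp
qed

definition F :: "'h \<Rightarrow> real \<Rightarrow> real" where "F x l = (norm (PM l x))\<^sup>2"

lemma F_mono: "l \<le> m \<Longrightarrow> F x l \<le> F x m"
  unfolding F_def using proj_nested(3)[OF closed_M subspace_M closed_M subspace_M M_mono, of l m x]
  by (smt (verit) zero_le_power2)

lemma F_right_cont: "continuous (at_right a) (F x)"
  unfolding continuous_within
proof (rule tendsto_at_right_sequentially[where b="a + 1"])
  fix f :: "nat \<Rightarrow> real" assume f: "decseq f" "f \<longlonglongrightarrow> a" "\<And>n. a < f n"
  have "(\<lambda>n. PM (f n) x) \<longlonglongrightarrow> PM a x"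
  proof (rule proj_decseq_tendsto)
    show "decseq (\<lambda>n. M (f n))" using f(1) M_mono by (auto simp: decseq_def)
    show "M a = (\<Inter>n. M (f n))" using f by (intro M_Inter) (auto intro: less_imp_le)
  qed (rule closed_M subspace_M)+
  then show "(\<lambda>n. F x (f n)) \<longlonglongrightarrow> F x a" unfolding F_def by (intro tendsto_intros)
qed simp

lemma PM_at_bot: "(\<lambda>n. PM (- real n) x) \<longlonglongrightarrow> 0"
proof -
  have "(\<lambda>n. PM (- real n) x) \<longlonglongrightarrow> proj {0} x"
  proof (rule proj_decseq_tendsto)
    show "decseq (\<lambda>n. M (- real n))" unfolding decseq_def using M_mono by simp
    show "{0} = (\<Inter>n. M (- real n))" by (rule M_Inter_bot[symmetric])
  qed (auto simp: closed_M subspace_M subspace_single_0)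
  moreover have "proj {0} x = 0" by (intro proj_unique) (auto simp: subspace_single_0)
  ultimately show ?thesis by simp
qed

lemma PM_at_top: "(\<lambda>n. PM (real n) x) \<longlonglongrightarrow> x"
proof (rule proj_incseq_tendsto)
  show "incseq (\<lambda>n. M (real n))" unfolding incseq_def using M_mono by simp
  show "z = 0" if "\<And>n v. v \<in> M (real n) \<Longrightarrow> z \<bullet> v = 0" for z using M_dense that .
qed (rule closed_M subspace_M)+

lemma F_at_bot: "(F x \<longlongrightarrow> 0) at_bot"
proof -
  have "(\<lambda>n. F x (- real n)) \<longlonglongrightarrow> 0\<^sup>2"
    unfolding F_def by (intro tendsto_intros tendsto_norm_zero PM_at_bot)
  then have "((\<lambda>l. - F x (- l)) \<longlongrightarrow> - 0) at_top"
    by (intro tendsto_at_topI_sequentially_real monoI tendsto_minus) (auto simp: F_mono)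
  then have "((\<lambda>l. F x (- l)) \<longlongrightarrow> 0) at_top" using tendsto_minus[of _ "- 0 :: real"] by fastforce
  from filterlim_compose[OF this filterlim_uminus_at_top_at_bot] show ?thesis by simp
qed

lemma F_at_top: "(F x \<longlongrightarrow> (norm x)\<^sup>2) at_top"
proof (rule tendsto_at_topI_sequentially_real)
  show "mono (F x)" by (intro monoI F_mono)
  show "(\<lambda>n. F x (real n)) \<longlonglongrightarrow> (norm x)\<^sup>2" unfolding F_def by (intro tendsto_intros PM_at_top)
qed

definition mu :: "'h \<Rightarrow> real measure" where "mu x = interval_measure (F x)"

lemma sets_mu [simp, measurable_cong]: "sets (mu x) = sets borel" and space_mu [simp]: "space (mu x) = UNIV"
  by (simp_all add: mu_def)

lemma emeasure_mu_UNIV: "emeasure (mu x) UNIV = ennreal ((norm x)\<^sup>2)"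
  unfolding mu_def by (intro interval_measure_UNIV F_mono F_right_cont F_at_bot F_at_top) auto

lemma finite_measure_mu: "finite_measure (mu x)"
  by (rule finite_measureI) (simp add: emeasure_mu_UNIV)

lemma measure_mu_UNIV: "measure (mu x) UNIV = (norm x)\<^sup>2"
  by (simp add: measure_def emeasure_mu_UNIV)

lemma measure_mu_atMost: "measure (mu x) {..l} = (norm (PM l x))\<^sup>2"
proof -
  have "emeasure (mu x) {..l} = ennreal (F x l)"
    unfolding mu_def by (intro emeasure_interval_measure_Iic F_mono F_right_cont F_at_bot)
  then show ?thesis by (simp add: measure_def F_def)
qed

text \<open>
  Characterizing the spectral projection of \<open>S\<close> by its quadratic form makes it unique, and makes the
  sets that have one a Dynkin system.
\<close>

definition represents :: "real set \<Rightarrow> ('h \<Rightarrow> 'h) \<Rightarrow> bool"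
  where "represents S P \<longleftrightarrow> orthogonal_projection P \<and> (\<forall>x. P x \<bullet> x = measure (mu x) S)"

lemma represents_unique: "represents S P \<Longrightarrow> represents S Q \<Longrightarrow> P = Q"
  unfolding represents_def by (intro orthogonal_projection_eqI) auto

lemma represents_atMost: "represents {..l} (PM l)"
  unfolding represents_def
  using proj_M orthogonal_projection_inner[OF proj_M] by (auto simp: measure_mu_atMost)

lemma orthogonal_projection_complement:
  assumes "orthogonal_projection P" shows "orthogonal_projection (\<lambda>x. x - P x)"
  using orthogonal_projectionD[OF assms] unfolding orthogonal_projection_def
  by (auto simp: fun_eq_iff linear_diff inner_diff intro!: linear_compose_sub linear_ident)

lemma represents_Compl:
  assumes "S \<in> sets borel" "represents S P" shows "represents (UNIV - S) (\<lambda>x. x - P x)"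
proof -
  have "measure (mu x) (UNIV - S) = measure (mu x) UNIV - measure (mu x) S" for x
    using finite_measure.finite_measure_compl[OF finite_measure_mu, of S x] assms by simp
  then show ?thesis
    using assms(2) orthogonal_projection_complement unfolding represents_def
    by (auto simp: inner_diff_left measure_mu_UNIV power2_norm_eq_inner)
qed

lemma represents_UN:
  fixes S :: "nat \<Rightarrow> real set"
  assumes "disjoint_family S" "range S \<subseteq> sets borel" "\<And>i. represents (S i) (P i)"
  obtains Q where "represents (\<Union>i. S i) Q" "\<And>x. (\<lambda>i. P i x) sums Q x"
proof -
  have sums: "(\<lambda>i. measure (mu x) (S i)) sums measure (mu x) (\<Union>i. S i)" for x
    using finite_measure.finite_measure_UNION[OF finite_measure_mu, of S x] assms by simp
  have "(\<Sum>i<n. P i x \<bullet> x) \<le> (norm x)\<^sup>2" for x n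
  proof -
    have "(\<Sum>i<n. P i x \<bullet> x) = (\<Sum>i<n. measure (mu x) (S i))"
      using assms(3) by (simp add: represents_def)
    also have "\<dots> \<le> measure (mu x) (\<Union>i. S i)"
      using sum_le_suminf[of "\<lambda>i. measure (mu x) (S i)" "{..<n}"] sums[of x]
      by (auto simp: sums_iff)
    also have "\<dots> \<le> (norm x)\<^sup>2"
      using finite_measure.bounded_measure[OF finite_measure_mu, of x] measure_mu_UNIV[of x] by simp
    finally show ?thesis .
  qed
  then obtain Q where Q: "orthogonal_projection Q" "\<And>x. (\<lambda>i. P i x) sums Q x"
    using orthogonal_projection_sums[of P] assms(3) unfolding represents_def by metis
  have "(\<lambda>i. P i x \<bullet> x) sums (Q x \<bullet> x)" for x
    using bounded_linear.sums[OF bounded_linear_inner_left Q(2)] .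
  then have "Q x \<bullet> x = measure (mu x) (\<Union>i. S i)" for x
    using sums[of x] assms(3) unfolding represents_def by (metis (lifting) sums_unique2 sums_cong)
  then show thesis using that[of Q] Q unfolding represents_def by blast
qed

text \<open>
  Half-lines are represented by \<open>PM l\<close>, complements by \<open>1 - P\<close>, and disjoint unions by orthogonal
  sums, so the Dynkin system theorem reaches all Borel sets.
\<close>

lemma exists_represents:
  assumes "S \<in> sets borel" shows "\<exists>P. represents S P"
proof -
  have "Int_stable (range (\<lambda>a::real. {..a}))" by (auto simp: Int_stable_def)
  moreover have "range (\<lambda>a::real. {..a}) \<subseteq> Pow UNIV" by simp
  moreover have "S \<in> sigma_sets UNIV (range (\<lambda>a::real. {..a}))"
    using assms unfolding borel_eq_atMost by simp
  ultimately show ?thesis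
  proof (induction rule: sigma_sets_induct_disjoint)
    case (basic A) then show ?case using represents_atMost by blast
  next
    case empty
    have "represents {} (\<lambda>_. 0)"
      unfolding represents_def orthogonal_projection_def by (auto simp: linear_zero fun_eq_iff)
    then show ?case by blast
  next
    case (compl A)
    then have "A \<in> sets borel" unfolding borel_eq_atMost by simp
    then show ?case using compl represents_Compl by blast
  next
    case (union A)
    then have "range A \<subseteq> sets borel" unfolding borel_eq_atMost by simp
    moreover obtain P where "\<And>i. represents (A i) (P i)" using union(3) by metis
    ultimately show ?case using represents_UN[OF union(1)] by metis
  qed
qed

definition spec :: "real set \<Rightarrow> 'h \<Rightarrow> 'h" where "spec S = (SOME P. represents S P)"

lemma represents_spec: "S \<in> sets borel \<Longrightarrow> represents S (spec S)"
  unfolding spec_def using exists_represents by (rule someI_ex)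

lemma spec_eqI: "S \<in> sets borel \<Longrightarrow> represents S P \<Longrightarrow> spec S = P"
  using represents_spec represents_unique by blast

lemma spec_inner: "S \<in> sets borel \<Longrightarrow> spec S x \<bullet> x = measure (mu x) S"
  using represents_spec unfolding represents_def by blast

lemma projection_valued_measure_spec: "projection_valued_measure spec"
  unfolding projection_valued_measure_def
proof (intro conjI ballI allI impI)
  show "orthogonal_projection (spec S)" if "S \<in> sets borel" for S
    using represents_spec[OF that] unfolding represents_def by blast
  have "represents UNIV id"
    unfolding represents_def orthogonal_projection_def
    by (auto simp: measure_mu_UNIV power2_norm_eq_inner linear_id)
  then show "spec UNIV = id" by (intro spec_eqI) auto
  fix S :: "nat \<Rightarrow> real set" and x
  assume S: "range S \<subseteq> sets borel" "disjoint_family S"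
  obtain Q where "represents (\<Union>i. S i) Q" "\<And>x. (\<lambda>i. spec (S i) x) sums Q x"
    using represents_UN[OF S(2,1), of "\<lambda>i. spec (S i)"] represents_spec S(1) by blast
  moreover have "(\<Union>i. S i) \<in> sets borel" using S(1) by auto
  ultimately show "(\<lambda>i. spec (S i) x) sums spec (\<Union>i. S i) x" using spec_eqI by metis
qed

lemma scalar_measure_spec: "scalar_measure spec x = mu x"
proof -
  have "scalar_measure spec x = measure_of UNIV (sets borel) (emeasure (mu x))"
    unfolding scalar_measure_def
  proof (rule measure_of_eq)
    fix S assume "S \<in> sigma_sets UNIV (sets (borel :: real measure))"
    then have S: "S \<in> sets borel" using sets.sigma_sets_eq[of "borel::real measure"] by simp
    show "ennreal (spec S x \<bullet> x) = emeasure (mu x) S"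
      using finite_measure.emeasure_eq_measure[OF finite_measure_mu] spec_inner[OF S] by simp
  qed simp
  also have "\<dots> = mu x" using measure_of_of_measure[of "mu x"] by simp
  finally show ?thesis .
qed

end

section \<open>The spectral theorem\<close>

lemma subspace_closure:
  fixes S :: "'a::real_normed_vector set"
  assumes "subspace S" shows "subspace (closure S)"
proof (rule subspaceI)
  show "0 \<in> closure S" using assms subspace_0 closure_subset by blast
  fix x assume "x \<in> closure S"
  then obtain f where f: "\<And>n. f n \<in> S" "f \<longlonglongrightarrow> x" unfolding closure_sequential by blast
  show "c *\<^sub>R x \<in> closure S" for c
    unfolding closure_sequential using f assms
    by (intro exI[of _ "\<lambda>n. c *\<^sub>R f n"]) (auto intro: tendsto_intros subspace_scale)
  fix y assume "y \<in> closure S"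
  then obtain g where g: "\<And>n. g n \<in> S" "g \<longlonglongrightarrow> y" unfolding closure_sequential by blast
  show "x + y \<in> closure S"
    unfolding closure_sequential using f g assms
    by (intro exI[of _ "\<lambda>n. f n + g n"]) (auto intro: tendsto_intros subspace_add)
qed

text \<open>
  Bisection halves the factor \<open>b - a\<close> of the bound, while the two values of \<open>m\<close> add up to the old one.
\<close>

lemma additive_interval_function_eq_0:
  fixes D m :: "real \<Rightarrow> real \<Rightarrow> real"
  assumes D: "\<And>a b c. p \<le> a \<Longrightarrow> a \<le> b \<Longrightarrow> b \<le> c \<Longrightarrow> c \<le> q \<Longrightarrow> D a c = D a b + D b c"
    and m: "\<And>a b c. p \<le> a \<Longrightarrow> a \<le> b \<Longrightarrow> b \<le> c \<Longrightarrow> c \<le> q \<Longrightarrow> m a c = m a b + m b c"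
    and le: "\<And>a b. p \<le> a \<Longrightarrow> a \<le> b \<Longrightarrow> b \<le> q \<Longrightarrow> \<bar>D a b\<bar> \<le> K * (b - a) * m a b"
    and "p \<le> q"
  shows "D p q = 0"
proof -
  have bound: "\<bar>D a b\<bar> \<le> K * (b - a) * m a b / 2 ^ n" if "p \<le> a" "a \<le> b" "b \<le> q" for n a b
    using that
  proof (induction n arbitrary: a b)
    case 0 then show ?case using le by simp
  next
    case (Suc n)
    let ?c = "(a + b) / 2"
    have "D a b = D a ?c + D ?c b" "m a b = m a ?c + m ?c b"
      using Suc.prems by (auto intro: D m)
    moreover have "\<bar>D a ?c\<bar> \<le> K * (?c - a) * m a ?c / 2 ^ n" "\<bar>D ?c b\<bar> \<le> K * (b - ?c) * m ?c b / 2 ^ n"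
      by (rule Suc.IH; use Suc.prems in simp)+
    moreover have "K * (?c - a) * m a ?c / 2 ^ n + K * (b - ?c) * m ?c b / 2 ^ n =
      K * (b - a) * (m a ?c + m ?c b) / 2 ^ Suc n" by (simp add: field_simps)
    ultimately show ?case by simp
  qed
  have "(\<lambda>n. K * (q - p) * m p q * (1/2) ^ n) \<longlonglongrightarrow> K * (q - p) * m p q * 0"
    by (intro tendsto_intros LIMSEQ_power_zero) auto
  then have "\<bar>D p q\<bar> \<le> K * (q - p) * m p q * 0"
    using bound[of p q] \<open>p \<le> q\<close>
    by (intro LIMSEQ_le_const) (auto simp: power_one_over divide_simps)
  then show ?thesis by simp
qed

lemma set_integral_Ioc_bounds:
  fixes f :: "real \<Rightarrow> real"
  assumes "finite_measure N" "sets N = sets borel" "f \<in> borel_measurable borel"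
    and f: "\<And>s. a < s \<Longrightarrow> s \<le> b \<Longrightarrow> c \<le> f s \<and> f s \<le> d"
  shows "set_integrable N {a<..b} f"
    and "c * measure N {a<..b} \<le> (LINT s:{a<..b}|N. f s)"
    and "(LINT s:{a<..b}|N. f s) \<le> d * measure N {a<..b}"
proof -
  interpret finite_measure N by fact
  have meas [measurable]: "f \<in> borel_measurable N" using assms measurable_cong_sets by blast
  have ab [measurable]: "{a<..b} \<in> sets N" using assms(2) by simp
  show i: "set_integrable N {a<..b} f"
    unfolding set_integrable_def
    by (rule integrable_const_bound[where B="max \<bar>c\<bar> \<bar>d\<bar>"])
       (use f in \<open>fastforce simp: indicator_def intro!: AE_I2\<close>, measurable)
  have k: "set_integrable N {a<..b} (\<lambda>_. k)" "(LINT s:{a<..b}|N. k) = k * measure N {a<..b}" for k :: real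
    unfolding set_integrable_def set_lebesgue_integral_def
    by (auto simp: emeasure_eq_measure mult.commute less_top[symmetric])
  show "c * measure N {a<..b} \<le> (LINT s:{a<..b}|N. f s)"
    "(LINT s:{a<..b}|N. f s) \<le> d * measure N {a<..b}"
    unfolding k(2)[symmetric] using f by (auto intro!: set_integral_mono k i)
qed

context self_adjoint_operator
begin

lemma PM_PM: "l \<le> m \<Longrightarrow> PM m (PM l x) = PM l x" "l \<le> m \<Longrightarrow> PM l (PM m x) = PM l x"
  using proj_nested(1,2)[OF closed_M subspace_M closed_M subspace_M M_mono] by blast+

lemma spec_Ioc: assumes "a \<le> b" shows "spec {a<..b} = (\<lambda>x. PM b x - PM a x)"
proof (rule spec_eqI)
  note PD = orthogonal_projectionD[OF proj_M]
  have "emeasure (mu x) {a<..b} = ennreal (F x b - F x a)" for x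
    unfolding mu_def using assms by (intro emeasure_interval_measure_Ioc F_mono F_right_cont)
  then have m: "measure (mu x) {a<..b} = F x b - F x a" for x
    using F_mono[OF assms] by (simp add: measure_def)
  show "represents {a<..b} (\<lambda>x. PM b x - PM a x)"
    unfolding represents_def m orthogonal_projection_def
    using PD PM_PM[OF assms]
    by (auto simp: fun_eq_iff inner_diff linear_diff F_def orthogonal_projection_inner[OF proj_M]
        intro!: linear_compose_sub)
qed simp

lemma orthogonal_projection_spec: "S \<in> sets borel \<Longrightarrow> orthogonal_projection (spec S)"
  using represents_spec unfolding represents_def by blast

lemma norm_spec: "S \<in> sets borel \<Longrightarrow> (norm (spec S x))\<^sup>2 = measure (mu x) S"
  using orthogonal_projection_inner[OF orthogonal_projection_spec] spec_inner by metis

lemma spec_Ioc_add: "a \<le> b \<Longrightarrow> b \<le> c \<Longrightarrow> spec {a<..c} x = spec {a<..b} x + spec {b<..c} x"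
  by (simp add: spec_Ioc)

lemma spec_Ioc_orth: "a \<le> b \<Longrightarrow> b \<le> c \<Longrightarrow> spec {a<..b} (spec {b<..c} x) = 0"
  using PM_PM[of a b] PM_PM[of a c] PM_PM[of b c] PM_PM[of b b] PM_PM[of a a]
  by (simp add: spec_Ioc linear_diff[OF orthogonal_projectionD(1)[OF proj_M]])

lemma spec_Ioc_tendsto: "(\<lambda>n. spec {- real n<..real n} x) \<longlonglongrightarrow> x"
proof -
  have "(\<lambda>n. PM (real n) x - PM (- real n) x) \<longlonglongrightarrow> x - 0"
    by (intro tendsto_diff PM_at_top PM_at_bot)
  then show ?thesis by (simp add: spec_Ioc)
qed

lemma spec_Ioc_reduces:
  assumes "a \<le> b" "(x, y) \<in> A" shows "(spec {a<..b} x, spec {a<..b} y) \<in> A"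
proof (rule reduces[OF _ _ _ assms(2)])
  show "linear (spec {a<..b})" by (intro orthogonal_projectionD(1) orthogonal_projection_spec) simp
  fix x
  show "spec {a<..b} (B x) = B (spec {a<..b} x)"
    using PM_commute[OF commute_B_shift symmetric_B] by (simp add: spec_Ioc assms blinfun.diff_right)
  show "spec {a<..b} (C x) = C (spec {a<..b} x)"
    using PM_commute[OF commute_C_shift symmetric_C] by (simp add: spec_Ioc assms blinfun.diff_right)
qed

text \<open>
  The vector \<open>z\<close> lies in the spectral subspace of \<open>(a, b]\<close>. There \<open>C - a B\<close> and \<open>C - b B\<close> have
  opposite signs, which bounds \<open>C w\<close> by a multiple of \<open>B w\<close>. Vectors of the form \<open>B w\<close> are dense in
  this subspace and satisfy \<open>A (B w) = C w\<close>, so closedness of \<open>A\<close> carries the inequality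
  \<open>(A - a) (A - b) \<le> 0\<close> over to the whole subspace.
\<close>

lemma band_in_domain:
  assumes ab: "a \<le> b" and z: "z \<in> M b" "\<And>y. y \<in> M a \<Longrightarrow> z \<bullet> y = 0"
  obtains y where "(z, y) \<in> A" "(y - a *\<^sub>R z) \<bullet> (y - b *\<^sub>R z) \<le> 0"
proof -
  define Z where "Z = {z\<in>M b. \<forall>y\<in>M a. z \<bullet> y = 0}"
  have zZ: "z \<in> Z" using z by (simp add: Z_def)
  have subZ: "subspace Z"
    unfolding Z_def using subspace_M[of b]
    by (intro subspaceI) (auto simp: subspace_0 subspace_add subspace_scale inner_add_left)
  have "Z = M b \<inter> (\<Inter>y\<in>M a. {z. z \<bullet> y = 0})" unfolding Z_def by auto
  also have "closed \<dots>" by (intro closed_Int closed_M closed_INT ballI closed_Collect_eq continuous_intros)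
  finally have clZ: "closed Z" .
  have BZ: "B w \<in> Z" if "w \<in> Z" for w
    using that invariant_M[OF commute_B_shift] symmetricD[OF symmetric_B] unfolding Z_def by auto
  define c where "c = (a + b) / 2" define r where "r = (b - a) / 2"
  have ineq: "(C w - a *\<^sub>R B w) \<bullet> (C w - b *\<^sub>R B w) \<le> 0" if "w \<in> Z" for w
    using inner_opposite_signs[OF symmetric_shift symmetric_shift commute_shift_shift, of a w b] that
    unfolding Z_def M_def by (auto simp: shift_apply)
  have bound: "norm (C w) \<le> (\<bar>c\<bar> + r) * norm (B w)" if "w \<in> Z" for w
  proof -
    have "(norm (C w - c *\<^sub>R B w))\<^sup>2 = (C w - a *\<^sub>R B w) \<bullet> (C w - b *\<^sub>R B w) + (r * norm (B w))\<^sup>2"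
      unfolding power_mult_distrib power2_norm_eq_inner c_def r_def
      by (simp add: inner_diff inner_commute field_simps power2_eq_square)
    then have "(norm (C w - c *\<^sub>R B w))\<^sup>2 \<le> (r * norm (B w))\<^sup>2" using ineq[OF that] by simp
    then have "norm (C w - c *\<^sub>R B w) \<le> r * norm (B w)"
      using ab by (intro power2_le_imp_le[of "norm _"]) (auto simp: r_def)
    then show ?thesis
      using norm_triangle_ineq2[of "C w" "c *\<^sub>R B w"] by (simp add: algebra_simps)
  qed
  define N where "N = closure (B ` Z)"
  have "subspace (B ` Z)"
    using subZ by (intro linear_subspace_image) (simp add: blinfun.bounded_linear_right bounded_linear.linear)
  then have N: "closed N" "subspace N" unfolding N_def by (auto intro: subspace_closure)
  have NZ: "N \<subseteq> Z" unfolding N_def using clZ BZ by (intro closure_minimal) auto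
  \<comment> \<open>a vector of \<open>Z\<close> orthogonal to \<open>B ` Z\<close> is zero, because the form of \<open>B\<close> is positive definite\<close>
  have "z \<in> N"
  proof -
    let ?w = "z - proj N z"
    have w: "?w \<in> Z" using zZ proj_in[OF N, of z] NZ by (intro subspace_diff[OF subZ]) auto
    then have "B ?w \<in> N" unfolding N_def using closure_subset[of "B ` Z"] by (meson imageI subsetD)
    then have "?w \<bullet> B ?w = 0" by (rule proj_orthogonal[OF N])
    then have "?w = 0" using B_eq_0[of ?w] by (simp add: inner_commute)
    then show ?thesis using proj_in[OF N, of z] by simp
  qed
  then obtain u where u: "\<And>n. u n \<in> B ` Z" "u \<longlonglongrightarrow> z"
    unfolding N_def closure_sequential by (elim exE conjE) (rule that; blast)
  from u(1) have "\<forall>n. \<exists>v. v \<in> Z \<and> u n = B v" by blast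
  then obtain w where w: "\<And>n. w n \<in> Z" "\<And>n. u n = B (w n)" by (meson choice)
  have "Cauchy (\<lambda>n. C (w n))"
  proof (rule metric_CauchyI)
    fix e :: real assume e: "e > 0"
    let ?K = "\<bar>c\<bar> + r + 1"
    have K: "?K > 0" using ab by (simp add: r_def add_nonneg_pos)
    have "Cauchy u" using u(2) by (rule LIMSEQ_imp_Cauchy)
    then obtain n0 where n0: "\<And>m n. m \<ge> n0 \<Longrightarrow> n \<ge> n0 \<Longrightarrow> dist (u m) (u n) < e / ?K"
      using metric_CauchyD[of u "e / ?K"] e K by (metis divide_pos_pos)
    show "\<exists>M. \<forall>m\<ge>M. \<forall>n\<ge>M. dist (C (w m)) (C (w n)) < e"
    proof (intro exI allI impI)
      fix m n assume mn: "m \<ge> n0" "n \<ge> n0"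
      have "dist (C (w m)) (C (w n)) = norm (C (w m - w n))" by (simp add: dist_norm blinfun.diff_right)
      also have "\<dots> \<le> (\<bar>c\<bar> + r) * norm (B (w m - w n))"
        using w by (intro bound subspace_diff[OF subZ])
      also have "\<dots> \<le> ?K * norm (B (w m - w n))" by (intro mult_right_mono) auto
      also have "\<dots> = ?K * dist (u m) (u n)" by (simp add: w(2) dist_norm blinfun.diff_right)
      also have "\<dots> < e" using n0[OF mn] K by (simp add: pos_less_divide_eq mult.commute)
      finally show "dist (C (w m)) (C (w n)) < e" .
    qed
  qed
  then obtain y where y: "(\<lambda>n. C (w n)) \<longlonglongrightarrow> y"
    using Cauchy_convergent convergent_def by blast
  show thesis
  proof
    show "(z, y) \<in> A"
    proof (rule closed_sequentially[OF closed_A])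
      show "(u n, C (w n)) \<in> A" for n using BC_in w(2) by simp
      show "(\<lambda>n. (u n, C (w n))) \<longlonglongrightarrow> (z, y)" by (intro tendsto_Pair u y)
    qed
    show "(y - a *\<^sub>R z) \<bullet> (y - b *\<^sub>R z) \<le> 0"
    proof (rule LIMSEQ_le_const2)
      show "(\<lambda>n. (C (w n) - a *\<^sub>R u n) \<bullet> (C (w n) - b *\<^sub>R u n)) \<longlonglongrightarrow> (y - a *\<^sub>R z) \<bullet> (y - b *\<^sub>R z)"
        by (intro tendsto_intros y u)
      show "\<exists>N. \<forall>n\<ge>N. (C (w n) - a *\<^sub>R u n) \<bullet> (C (w n) - b *\<^sub>R u n) \<le> 0"
        using ineq w by simp
    qed
  qed
qed

text \<open>
  The value of \<open>A\<close> at the component of \<open>x\<close> in the spectral subspace of \<open>(a, b]\<close>; it is unique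
  because \<open>A\<close> is single-valued.
\<close>

definition cut :: "real \<Rightarrow> real \<Rightarrow> 'h \<Rightarrow> 'h" where
  "cut a b x = (SOME y. (spec {a<..b} x, y) \<in> A)"

lemma cut:
  assumes "a \<le> b"
  shows cut_in: "(spec {a<..b} x, cut a b x) \<in> A"
    and cut_inner_le: "(cut a b x - a *\<^sub>R spec {a<..b} x) \<bullet> (cut a b x - b *\<^sub>R spec {a<..b} x) \<le> 0"
proof -
  let ?z = "spec {a<..b} x"
  have "PM b ?z = ?z" "PM a ?z = 0"
    using PM_PM[of a b] PM_PM[of b b] PM_PM[of a a] assms
    by (simp_all add: spec_Ioc linear_diff[OF orthogonal_projectionD(1)[OF proj_M]])
  then have "?z \<in> M b" "\<And>y. y \<in> M a \<Longrightarrow> ?z \<bullet> y = 0"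
    using proj_in[OF closed_M subspace_M, of b ?z] proj_orthogonal[OF closed_M subspace_M, of _ a ?z]
    by auto
  then obtain y where y: "(?z, y) \<in> A" "(y - a *\<^sub>R ?z) \<bullet> (y - b *\<^sub>R ?z) \<le> 0"
    using band_in_domain[OF assms] by blast
  then have "(?z, cut a b x) \<in> A" unfolding cut_def by (intro someI)
  moreover from this have "cut a b x = y" using y unique by blast
  ultimately show "(?z, cut a b x) \<in> A" "(cut a b x - a *\<^sub>R ?z) \<bullet> (cut a b x - b *\<^sub>R ?z) \<le> 0"
    using y by auto
qed

lemma cut_eq: "a \<le> b \<Longrightarrow> (x, y) \<in> A \<Longrightarrow> cut a b x = spec {a<..b} y"
  using spec_Ioc_reduces cut_in unique by blast

lemma cut_add: assumes "a \<le> b" "b \<le> c" shows "cut a c x = cut a b x + cut b c x"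
proof (rule unique[OF cut_in])
  show "(spec {a<..c} x, cut a b x + cut b c x) \<in> A"
    using subspace_add[OF subspace_A cut_in[OF assms(1)] cut_in[OF assms(2)], of x x] assms
    by (simp add: spec_Ioc_add[of a b c])
qed (use assms in simp)

lemma spec_cut: assumes "a \<le> b" shows "spec {a<..b} (cut a b x) = cut a b x"
proof -
  have "spec {a<..b} (spec {a<..b} x) = spec {a<..b} x"
    by (intro orthogonal_projectionD(2) orthogonal_projection_spec) simp
  then show ?thesis
    using spec_Ioc_reduces[OF assms cut_in[OF assms]] cut_in[OF assms] unique by metis
qed

lemma cut_orth: assumes "a \<le> b" "b \<le> c" shows "cut a b x \<bullet> cut b c x = 0"
proof -
  have "cut a b x \<bullet> cut b c x = spec {a<..b} (cut a b x) \<bullet> spec {b<..c} (cut b c x)"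
    using spec_cut assms by simp
  also have "\<dots> = cut a b x \<bullet> spec {a<..b} (spec {b<..c} (cut b c x))"
    by (intro orthogonal_projectionD(3) orthogonal_projection_spec) simp
  finally show ?thesis using spec_Ioc_orth assms by simp
qed

lemma cut_inner_spec: "a \<le> b \<Longrightarrow> cut a b x \<bullet> spec {a<..b} x = cut a b x \<bullet> x"
  using orthogonal_projectionD(3)[OF orthogonal_projection_spec, of "{a<..b}" "cut a b x" x] spec_cut
  by simp

lemma measure_mu_Ioc_add:
  "a \<le> b \<Longrightarrow> b \<le> c \<Longrightarrow> measure (mu x) {a<..c} = measure (mu x) {a<..b} + measure (mu x) {b<..c}"
  using finite_measure.finite_measure_Union[OF finite_measure_mu, of "{a<..b}" x "{b<..c}"]
  by (simp add: ivl_disj_un)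

lemma set_integral_Ioc_add:
  fixes f :: "real \<Rightarrow> real"
  assumes "a \<le> b" "b \<le> c" "continuous_on UNIV f"
  shows "(LINT s:{a<..c}|mu x. f s) = (LINT s:{a<..b}|mu x. f s) + (LINT s:{b<..c}|mu x. f s)"
proof -
  have si: "set_integrable (mu x) {p<..q} f" for p q
  proof -
    have "bounded (f ` {p..q})"
      using assms(3) by (intro compact_imp_bounded compact_continuous_image) (auto intro: continuous_on_subset)
    then obtain K where "\<forall>s\<in>{p..q}. \<bar>f s\<bar> \<le> K" unfolding bounded_iff by auto
    then show ?thesis
      using assms(3) by (intro set_integral_Ioc_bounds(1)[of _ _ _ _ "- K" K] finite_measure_mu)
        (auto simp: abs_le_iff borel_measurable_continuous_onI intro: minus_le_iff[THEN iffD1])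
  qed
  have "{a<..c} = {a<..b} \<union> {b<..c}" using assms by auto
  then show ?thesis using set_integral_Un[OF _ si si] by simp
qed

text \<open>
  Both sides are additive in the interval, and both lie between \<open>a\<close> and \<open>b\<close> times the measure of
  \<open>(a, b]\<close>.
\<close>

lemma cut_inner:
  assumes "p \<le> q" shows "cut p q x \<bullet> x = (LINT s:{p<..q}|mu x. s)"
proof -
  have "cut p q x \<bullet> x - (LINT s:{p<..q}|mu x. s) = 0"
  proof (rule additive_interval_function_eq_0[where K=1 and p=p and q=q
        and D="\<lambda>a b. cut a b x \<bullet> x - (LINT s:{a<..b}|mu x. s)" and m="\<lambda>a b. measure (mu x) {a<..b}"])
    fix a b :: real assume ab: "a \<le> b"
    let ?y = "cut a b x" and ?z = "spec {a<..b} x" and ?m = "measure (mu x) {a<..b}"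
    have zz: "?z \<bullet> ?z = ?m" using norm_spec[of "{a<..b}" x] by (simp add: power2_norm_eq_inner)
    have "(a + b) * (?y \<bullet> ?z) \<ge> ?y \<bullet> ?y + a * b * ?m"
      using cut_inner_le[OF ab, of x] zz by (simp add: inner_diff inner_commute algebra_simps)
    moreover have "0 \<le> (?y - a *\<^sub>R ?z) \<bullet> (?y - a *\<^sub>R ?z)" "0 \<le> (?y - b *\<^sub>R ?z) \<bullet> (?y - b *\<^sub>R ?z)" by simp_all
    then have "0 \<le> ?y \<bullet> ?y - 2 * a * (?y \<bullet> ?z) + a * a * ?m" "0 \<le> ?y \<bullet> ?y - 2 * b * (?y \<bullet> ?z) + b * b * ?m"
      using zz by (simp_all add: inner_diff inner_commute algebra_simps)
    ultimately have "(b - a) * (?y \<bullet> ?z) \<ge> (b - a) * (a * ?m)" "(b - a) * (?y \<bullet> ?z) \<le> (b - a) * (b * ?m)"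
      by (simp_all add: algebra_simps)
    then have "a < b \<Longrightarrow> a * ?m \<le> ?y \<bullet> ?z" "a < b \<Longrightarrow> ?y \<bullet> ?z \<le> b * ?m"
      by simp_all
    moreover have "a * ?m \<le> (LINT s:{a<..b}|mu x. s)" "(LINT s:{a<..b}|mu x. s) \<le> b * ?m"
      by (rule set_integral_Ioc_bounds(2)[OF finite_measure_mu sets_mu, of _ _ _ _ b]
        set_integral_Ioc_bounds(3)[OF finite_measure_mu sets_mu, of _ _ _ a]; simp)+
    \<comment> \<open>dividing by \<open>b - a\<close> leaves out the degenerate interval\<close>
    moreover have "?y = 0" if "a = b"
    proof -
      have "?z = 0" using spec_Ioc[OF ab] that by simp
      then have "(0, ?y) \<in> A" "(0, 0) \<in> A"
        using cut_in[OF ab, of x] subspace_0[OF subspace_A] by (simp_all add: zero_prod_def)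
      then show ?thesis using unique by blast
    qed
    ultimately show "\<bar>?y \<bullet> x - (LINT s:{a<..b}|mu x. s)\<bar> \<le> 1 * (b - a) * ?m"
      using ab cut_inner_spec[OF ab, of x] by (cases "a = b") (auto simp: abs_le_iff algebra_simps)
  next
    fix a b c :: real assume "a \<le> b" "b \<le> c"
    then show "cut a c x \<bullet> x - (LINT s:{a<..c}|mu x. s) =
       cut a b x \<bullet> x - (LINT s:{a<..b}|mu x. s) + (cut b c x \<bullet> x - (LINT s:{b<..c}|mu x. s))"
      by (simp add: cut_add[of a b c] set_integral_Ioc_add[of a b c] inner_add_left)
  qed ((rule measure_mu_Ioc_add; assumption), rule assms)
  then show ?thesis by simp
qed

text \<open>
  Completing squares at the midpoint \<open>c\<close> of \<open>(a, b]\<close> and inserting the first moments from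
  \<open>cut_inner\<close> leaves \<open>\<parallel>(A - c) z\<parallel>\<^sup>2\<close> on one side and the integral of \<open>(s - c)\<^sup>2\<close> on the other. Both
  are at most \<open>(b - a)\<^sup>2 / 4\<close> times the measure of \<open>(a, b]\<close>.
\<close>

lemma norm_cut:
  assumes "p \<le> q" shows "(norm (cut p q x))\<^sup>2 = (LINT s:{p<..q}|mu x. s\<^sup>2)"
proof -
  have "(norm (cut p q x))\<^sup>2 - (LINT s:{p<..q}|mu x. s\<^sup>2) = 0"
  proof (rule additive_interval_function_eq_0[where K="q - p" and p=p and q=q
        and D="\<lambda>a b. (norm (cut a b x))\<^sup>2 - (LINT s:{a<..b}|mu x. s\<^sup>2)" and m="\<lambda>a b. measure (mu x) {a<..b}"])
    fix a b assume ab: "p \<le> a" "a \<le> b" "b \<le> q"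
    let ?y = "cut a b x" and ?z = "spec {a<..b} x" and ?m = "measure (mu x) {a<..b}"
    define c where "c = (a + b) / 2"
    have zz: "?z \<bullet> ?z = ?m" using norm_spec[of "{a<..b}" x] by (simp add: power2_norm_eq_inner)
    note bounds = set_integral_Ioc_bounds[OF finite_measure_mu sets_mu]
    have sq: "0 \<le> (s - c)\<^sup>2 \<and> (s - c)\<^sup>2 \<le> ((b - a) / 2)\<^sup>2" if "a < s" "s \<le> b" for s
      using that unfolding c_def by (auto intro!: abs_le_square_iff[THEN iffD1] simp: abs_le_iff field_simps)
    have i1: "set_integrable (mu x) {a<..b} (\<lambda>s. s)" by (rule bounds(1)[of _ _ _ a b]) auto
    have i2: "set_integrable (mu x) {a<..b} (\<lambda>s. (s - c)\<^sup>2)" using sq by (rule bounds(1)[rotated]) auto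
    have i0: "set_integrable (mu x) {a<..b} (\<lambda>s. c\<^sup>2)" by (rule bounds(1)[of _ _ _ "c\<^sup>2" "c\<^sup>2"]) auto
    have c0: "(LINT s:{a<..b}|mu x. c\<^sup>2) = c\<^sup>2 * ?m"
      using bounds(2)[of "\<lambda>_. c\<^sup>2" a b "c\<^sup>2" "c\<^sup>2" x] bounds(3)[of "\<lambda>_. c\<^sup>2" a b "c\<^sup>2" "c\<^sup>2" x] by simp
    have "(LINT s:{a<..b}|mu x. s\<^sup>2) = (LINT s:{a<..b}|mu x. (s - c)\<^sup>2 + (2 * c * s - c\<^sup>2))"
      by (intro arg_cong[of _ _ "\<lambda>f. set_lebesgue_integral _ _ f"]) (auto simp: fun_eq_iff power2_eq_square algebra_simps)
    also have "\<dots> = (LINT s:{a<..b}|mu x. (s - c)\<^sup>2) + (2 * c * (LINT s:{a<..b}|mu x. s) - c\<^sup>2 * ?m)"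
      using i0 i1 i2 c0 by (simp add: set_integral_add set_integral_diff)
    also have "(LINT s:{a<..b}|mu x. s) = ?y \<bullet> ?z"
      using cut_inner[OF ab(2)] cut_inner_spec[OF ab(2)] by simp
    finally have e1: "(LINT s:{a<..b}|mu x. s\<^sup>2) = (LINT s:{a<..b}|mu x. (s - c)\<^sup>2) + (2 * c * (?y \<bullet> ?z) - c\<^sup>2 * ?m)" .
    have e2: "(norm ?y)\<^sup>2 = (norm (?y - c *\<^sub>R ?z))\<^sup>2 + (2 * c * (?y \<bullet> ?z) - c\<^sup>2 * ?m)"
      unfolding power2_norm_eq_inner zz[symmetric] by (simp add: inner_diff inner_commute algebra_simps power2_eq_square)
    have "(norm (?y - c *\<^sub>R ?z))\<^sup>2 = (?y - a *\<^sub>R ?z) \<bullet> (?y - b *\<^sub>R ?z) + ((b - a) / 2)\<^sup>2 * ?m"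
      unfolding power2_norm_eq_inner c_def zz[symmetric]
      by (simp add: inner_diff inner_commute field_simps power2_eq_square)
    then have b1: "(norm (?y - c *\<^sub>R ?z))\<^sup>2 \<le> ((b - a) / 2)\<^sup>2 * ?m" using cut_inner_le[OF ab(2)] by simp
    have b2: "0 * ?m \<le> (LINT s:{a<..b}|mu x. (s - c)\<^sup>2)" "(LINT s:{a<..b}|mu x. (s - c)\<^sup>2) \<le> ((b - a) / 2)\<^sup>2 * ?m"
      by (rule bounds(2)[OF _ sq] bounds(3)[OF _ sq]; simp)+
    have "((b - a) / 2)\<^sup>2 \<le> (q - p) * (b - a)"
    proof -
      have "((b - a) / 2)\<^sup>2 \<le> (b - a) * (b - a)"
        by (simp add: power2_eq_square)
      also have "\<dots> \<le> (q - p) * (b - a)" using ab by (intro mult_right_mono) auto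
      finally show ?thesis .
    qed
    then have "((b - a) / 2)\<^sup>2 * ?m \<le> (q - p) * (b - a) * ?m" by (intro mult_right_mono) auto
    then show "\<bar>(norm ?y)\<^sup>2 - (LINT s:{a<..b}|mu x. s\<^sup>2)\<bar> \<le> (q - p) * (b - a) * ?m"
      unfolding e1 e2 using b1 b2 zero_le_power2[of "norm (?y - c *\<^sub>R ?z)"] by linarith
  next
    fix a b c :: real assume "a \<le> b" "b \<le> c"
    moreover from this have "(norm (cut a c x))\<^sup>2 = (norm (cut a b x))\<^sup>2 + (norm (cut b c x))\<^sup>2"
      using cut_orth[of a b c x] unfolding power2_norm_eq_inner
      by (simp add: cut_add[of a b c] inner_add inner_commute)
    ultimately show "(norm (cut a c x))\<^sup>2 - (LINT s:{a<..c}|mu x. s\<^sup>2) =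
       (norm (cut a b x))\<^sup>2 - (LINT s:{a<..b}|mu x. s\<^sup>2) + ((norm (cut b c x))\<^sup>2 - (LINT s:{b<..c}|mu x. s\<^sup>2))"
      by (simp add: set_integral_Ioc_add[of a b c] continuous_intros)
  qed ((rule measure_mu_Ioc_add; assumption), rule assms)
  then show ?thesis by simp
qed

lemma set_integral_Ioc_tendsto:
  fixes f :: "real \<Rightarrow> real"
  assumes "integrable (mu x) f"
  shows "(\<lambda>n. LINT s:{- real n<..real n}|mu x. f s) \<longlonglongrightarrow> (\<integral>s. f s \<partial>mu x)"
  unfolding set_lebesgue_integral_def
proof (rule integral_dominated_convergence[where w="\<lambda>s. \<bar>f s\<bar>"])
  show "AE s in mu x. (\<lambda>n. indicat_real {- real n<..real n} s *\<^sub>R f s) \<longlonglongrightarrow> f s"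
  proof (rule AE_I2)
    fix s :: real
    obtain k :: nat where k: "\<bar>s\<bar> < k" using reals_Archimedean2 by blast
    have "\<forall>\<^sub>F n in sequentially. indicat_real {- real n<..real n} s *\<^sub>R f s = f s"
      using eventually_ge_at_top[of k] by eventually_elim (use k in \<open>auto simp: indicator_def\<close>)
    then show "(\<lambda>n. indicat_real {- real n<..real n} s *\<^sub>R f s) \<longlonglongrightarrow> f s" by (rule tendsto_eventually)
  qed
qed (use assms in \<open>auto simp: indicator_def intro!: AE_I2\<close>)

lemma norm_cut_diff:
  assumes "m \<le> n"
  shows "(norm (cut (- real n) (real n) x - cut (- real m) (real m) x))\<^sup>2 =
    (norm (cut (- real n) (real n) x))\<^sup>2 - (norm (cut (- real m) (real m) x))\<^sup>2"
proof -
  let ?m = "real m" and ?n = "real n"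
  have 1: "cut (- ?n) ?n x = cut (- ?n) (- ?m) x + cut (- ?m) ?n x" by (rule cut_add) (use assms in auto)
  have 2: "cut (- ?m) ?n x = cut (- ?m) ?m x + cut ?m ?n x" by (rule cut_add) (use assms in auto)
  have 3: "cut (- ?n) (- ?m) x \<bullet> cut (- ?m) ?m x = 0" by (rule cut_orth) (use assms in auto)
  have 4: "cut (- ?m) ?m x \<bullet> cut ?m ?n x = 0" by (rule cut_orth) (use assms in auto)
  show ?thesis unfolding 1 2 power2_norm_eq_inner using 3 4
    by (simp add: inner_add inner_diff inner_commute)
qed

lemma incseq_norm_cut: "incseq (\<lambda>n. (norm (cut (- real n) (real n) x))\<^sup>2)"
proof (unfold incseq_def, intro allI impI)
  fix m n :: nat assume "m \<le> n"
  from norm_cut_diff[OF this, of x] zero_le_power2[of "norm (cut (- real n) (real n) x - cut (- real m) (real m) x)"]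
  show "(norm (cut (- real m) (real m) x))\<^sup>2 \<le> (norm (cut (- real n) (real n) x))\<^sup>2" by simp
qed

text \<open>
  The vectors \<open>cut (-n) n x\<close> have orthogonal increments, and their squared norms are the truncated
  second moments of \<open>x\<close>. As \<open>A\<close> is closed, \<open>x\<close> is in its domain if and only if they converge.
\<close>

lemma Domain_iff: "x \<in> Domain A \<longleftrightarrow> integrable (mu x) (\<lambda>s. s\<^sup>2)"
proof
  assume "x \<in> Domain A"
  then obtain y where y: "(x, y) \<in> A" by blast
  let ?f = "\<lambda>n s. indicat_real {- real n<..real n} s *\<^sub>R s\<^sup>2"
  have int: "integrable (mu x) (?f n)" for n
  proof -
    have "0 \<le> s\<^sup>2 \<and> s\<^sup>2 \<le> (real n)\<^sup>2" if "- real n < s" "s \<le> real n" for s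
      using that by (auto intro!: abs_le_square_iff[THEN iffD1])
    from set_integral_Ioc_bounds(1)[OF finite_measure_mu sets_mu _ this]
    show ?thesis unfolding set_integrable_def by auto
  qed
  have eq: "(\<integral>s. ?f n s \<partial>mu x) = (norm (cut (- real n) (real n) x))\<^sup>2" for n
    using norm_cut[of "- real n" "real n" x] by (simp add: set_lebesgue_integral_def)
  have "incseq (\<lambda>n. \<integral>s. ?f n s \<partial>mu x)"
    unfolding eq by (rule incseq_norm_cut)
  moreover have "(\<integral>s. ?f n s \<partial>mu x) \<le> (norm y)\<^sup>2" for n
    unfolding eq using cut_eq[OF _ y, of "- real n" "real n"]
      orthogonal_projection_norm_le[OF orthogonal_projection_spec] by (simp add: power_mono)
  ultimately obtain L where "(\<lambda>n. \<integral>s. ?f n s \<partial>mu x) \<longlonglongrightarrow> L"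
    using incseq_convergent[of "\<lambda>n. \<integral>s. ?f n s \<partial>mu x" "(norm y)\<^sup>2"] by blast
  moreover have "(\<lambda>n. ?f n s) \<longlonglongrightarrow> s\<^sup>2" for s
  proof -
    obtain k :: nat where k: "\<bar>s\<bar> < k" using reals_Archimedean2 by blast
    have "\<forall>\<^sub>F n in sequentially. ?f n s = s\<^sup>2"
      using eventually_ge_at_top[of k] by eventually_elim (use k in \<open>auto simp: indicator_def\<close>)
    then show ?thesis by (rule tendsto_eventually)
  qed
  moreover have "mono (\<lambda>n. ?f n s)" for s
    by (rule monoI) (auto simp: indicator_def)
  ultimately show "integrable (mu x) (\<lambda>s. s\<^sup>2)"
    using int by (intro integrable_monotone_convergence[of "mu x" ?f "\<lambda>s. s\<^sup>2" L] AE_I2) simp_all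
next
  assume int: "integrable (mu x) (\<lambda>s. s\<^sup>2)"
  let ?c = "\<lambda>n. cut (- real n) (real n) x"
  have "convergent ?c"
  proof (rule convergent_of_monotone_norms)
    show "monoseq (\<lambda>n. (norm (?c n))\<^sup>2)"
      using norm_cut_diff by (intro incseq_imp_monoseq, unfold incseq_def) (metis diff_ge_0_iff_ge zero_le_power2)
    show "norm (?c n) \<le> sqrt (\<integral>s. s\<^sup>2 \<partial>mu x)" for n
    proof (rule real_le_rsqrt)
      have "(norm (?c n))\<^sup>2 = (\<integral>s. indicat_real {- real n<..real n} s *\<^sub>R s\<^sup>2 \<partial>mu x)"
        using norm_cut[of "- real n" "real n" x] by (simp add: set_lebesgue_integral_def)
      also have "\<dots> \<le> (\<integral>s. s\<^sup>2 \<partial>mu x)"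
        by (rule integral_mono[OF integrable_mult_indicator[OF _ int] int]) (auto simp: indicator_def)
      finally show "(norm (?c n))\<^sup>2 \<le> (\<integral>s. s\<^sup>2 \<partial>mu x)" .
    qed
  qed (use norm_cut_diff in simp)
  then obtain y where "?c \<longlonglongrightarrow> y" unfolding convergent_def by blast
  then have "(\<lambda>n. (spec {- real n<..real n} x, ?c n)) \<longlonglongrightarrow> (x, y)"
    by (intro tendsto_Pair spec_Ioc_tendsto)
  then have "(x, y) \<in> A"
    by (rule closed_sequentially[OF closed_A, rotated]) (rule cut_in, simp)
  then show "x \<in> Domain A" by blast
qed

lemma inner_eq_integral: assumes xy: "(x, y) \<in> A" shows "y \<bullet> x = (\<integral>s. s \<partial>mu x)"
proof -
  have i2: "integrable (mu x) (\<lambda>s. s\<^sup>2)" using xy Domain_iff by blast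
  have le: "\<bar>s\<bar> \<le> 1 + s\<^sup>2" for s :: real
  proof -
    have "0 \<le> (\<bar>s\<bar> - 1/2)\<^sup>2" by simp
    then show ?thesis by (simp add: power2_eq_square algebra_simps)
  qed
  have "integrable (mu x) (\<lambda>s. s)"
  proof (rule Bochner_Integration.integrable_bound)
    show "integrable (mu x) (\<lambda>s. 1 + s\<^sup>2)"
      by (intro Bochner_Integration.integrable_add i2 finite_measure.integrable_const[OF finite_measure_mu])
    show "AE s in mu x. norm s \<le> norm (1 + s\<^sup>2)" using le by (intro AE_I2) (simp add: abs_of_nonneg)
  qed simp
  then have "(\<lambda>n. LINT s:{- real n<..real n}|mu x. s) \<longlonglongrightarrow> (\<integral>s. s \<partial>mu x)"
    by (rule set_integral_Ioc_tendsto)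
  moreover have "(LINT s:{- real n<..real n}|mu x. s) = spec {- real n<..real n} y \<bullet> x" for n
    using cut_inner[of "- real n" "real n" x] cut_eq[OF _ xy, of "- real n" "real n"] by simp
  moreover have "(\<lambda>n. spec {- real n<..real n} y \<bullet> x) \<longlonglongrightarrow> y \<bullet> x"
    by (intro tendsto_intros spec_Ioc_tendsto)
  ultimately show ?thesis using LIMSEQ_unique by auto
qed

theorem spectral_measure_spec: "spectral_measure A spec"
  unfolding spectral_measure_def scalar_measure_spec
  using self_adjoint projection_valued_measure_spec Domain_iff inner_eq_integral by auto

end

theorem exists_spectral_measure:
  fixes A :: "('h::{real_inner,banach} \<times> 'h) set"
  assumes "self_adjoint A" shows "\<exists>E. spectral_measure A E"
proof -
  interpret self_adjoint_operator A by unfold_locales fact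
  show ?thesis using spectral_measure_spec by blast
qed

section \<open>Morse index and quadratic form\<close>

context
  fixes E :: "real set \<Rightarrow> 'h::{real_inner,banach} \<Rightarrow> 'h"
  assumes E: "projection_valued_measure E"
begin

lemma pvm_projection: "S \<in> sets borel \<Longrightarrow> orthogonal_projection (E S)"
  using E unfolding projection_valued_measure_def by blast

lemma pvm_sums:
  "range S \<subseteq> sets borel \<Longrightarrow> disjoint_family S \<Longrightarrow> (\<lambda>i::nat. E (S i) x) sums E (\<Union>i. S i) x"
  using E unfolding projection_valued_measure_def by blast

lemma pvm_UNIV: "E UNIV x = x"
  using E unfolding projection_valued_measure_def by simp

lemma pvm_empty: "E {} x = 0"
proof -
  have "(\<lambda>i::nat. E {} x) sums E (\<Union>i::nat. {}) x"
    by (rule pvm_sums) (auto simp: disjoint_family_on_def)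
  then have "(\<lambda>i::nat. E {} x) \<longlonglongrightarrow> 0" by (intro summable_LIMSEQ_zero) (simp add: sums_iff)
  then show ?thesis by (simp add: LIMSEQ_const_iff)
qed

lemma pvm_Un:
  assumes "S \<in> sets borel" "T \<in> sets borel" "S \<inter> T = {}"
  shows "E (S \<union> T) x = E S x + E T x"
proof -
  let ?f = "\<lambda>i::nat. if i = 0 then S else if i = 1 then T else {}"
  have "(\<lambda>i. E (?f i) x) sums E (\<Union>i. ?f i) x"
    using assms by (intro pvm_sums) (auto simp: disjoint_family_on_def)
  moreover have "(\<Union>i. ?f i) = S \<union> T" by (auto split: if_splits)
  moreover have "(\<lambda>i. E (?f i) x) sums (\<Sum>i\<in>{0,1}. E (?f i) x)"
    by (intro sums_finite) (auto simp: pvm_empty)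
  ultimately show ?thesis using sums_unique2 by fastforce
qed

lemma pvm_inner: "S \<in> sets borel \<Longrightarrow> E S x \<bullet> x = (norm (E S x))\<^sup>2"
  by (intro orthogonal_projection_inner pvm_projection)

lemma pvm_disjoint:
  assumes "S \<in> sets borel" "T \<in> sets borel" "S \<inter> T = {}"
  shows "E T (E S x) = 0"
proof -
  let ?z = "E S x"
  have "E (S \<union> T) ?z \<bullet> ?z \<le> ?z \<bullet> ?z"
    using pvm_inner[of "S \<union> T" ?z] orthogonal_projection_norm_le[OF pvm_projection, of "S \<union> T" ?z] assms
    by (simp add: power2_norm_eq_inner[symmetric] power_mono)
  moreover have "E S ?z = ?z" using orthogonal_projectionD(2)[OF pvm_projection[OF assms(1)]] .
  ultimately have "(norm (E T ?z))\<^sup>2 \<le> 0"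
    using pvm_Un[OF assms, of ?z] pvm_inner[OF assms(2), of ?z] by (simp add: inner_add_left)
  then show ?thesis by simp
qed

lemma pvm_subset:
  assumes "S \<in> sets borel" "T \<in> sets borel" "S \<subseteq> T"
  shows "E T (E S x) = E S x"
proof -
  have "E (S \<union> (T - S)) (E S x) = E S (E S x) + E (T - S) (E S x)"
    using assms by (intro pvm_Un) auto
  moreover have "E (T - S) (E S x) = 0" using assms by (intro pvm_disjoint) auto
  moreover have "S \<union> (T - S) = T" using assms by auto
  ultimately show ?thesis using orthogonal_projectionD(2)[OF pvm_projection[OF assms(1)]] by simp
qed

lemma sets_scalar_measure [simp]: "sets (scalar_measure E x) = sets borel"
  and space_scalar_measure [simp]: "space (scalar_measure E x) = UNIV"
  unfolding scalar_measure_def using sets.sigma_sets_eq[of "borel::real measure"]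
  by (simp_all add: space_measure_of sets_measure_of)

lemma emeasure_scalar_measure:
  assumes S: "S \<in> sets borel" shows "emeasure (scalar_measure E x) S = ennreal (E S x \<bullet> x)"
proof (rule emeasure_measure_of[OF scalar_measure_def])
  show "positive (sets (scalar_measure E x)) (\<lambda>S. ennreal (E S x \<bullet> x))"
    by (simp add: positive_def pvm_empty)
  show "countably_additive (sets (scalar_measure E x)) (\<lambda>S. ennreal (E S x \<bullet> x))"
    unfolding countably_additive_def
  proof (intro allI impI)
    fix A :: "nat \<Rightarrow> real set"
    assume A: "range A \<subseteq> sets (scalar_measure E x)" "disjoint_family A"
    then have "(\<lambda>i. E (A i) x \<bullet> x) sums (E (\<Union>i. A i) x \<bullet> x)"
      by (intro bounded_linear.sums[OF bounded_linear_inner_left] pvm_sums) auto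
    moreover have "0 \<le> E (A i) x \<bullet> x" for i using A pvm_inner[of "A i" x] by auto
    ultimately show "(\<Sum>i. ennreal (E (A i) x \<bullet> x)) = ennreal (E (\<Union>i. A i) x \<bullet> x)"
      by (intro suminf_ennreal_eq)
  qed
qed (use S in auto)

lemma finite_scalar_measure: "finite_measure (scalar_measure E x)"
  by (rule finite_measureI) (simp add: emeasure_scalar_measure)

lemma AE_scalar_measure:
  assumes S: "S \<in> sets borel" and x: "E (- S) x = 0"
  shows "AE s in scalar_measure E x. s \<in> S"
proof (rule AE_I)
  show "{s \<in> space (scalar_measure E x). s \<notin> S} \<subseteq> - S" by auto
  show "emeasure (scalar_measure E x) (- S) = 0"
    using S x by (simp add: emeasure_scalar_measure borel_comp)
qed (use S in \<open>simp add: borel_comp\<close>)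

end

lemma spectral_nonneg:
  fixes A :: "('h::{real_inner,banach} \<times> 'h) set"
  assumes E: "spectral_measure A E" and xy: "(x, y) \<in> A" and 0: "E {..<0} x = 0"
  shows "y \<bullet> x \<ge> 0"
proof -
  have P: "projection_valued_measure E" using E unfolding spectral_measure_def by blast
  have "y \<bullet> x = (\<integral>s. s \<partial>scalar_measure E x)"
    using E xy unfolding spectral_measure_def by fast
  also have "\<dots> \<ge> 0"
  proof (rule integral_nonneg_AE)
    have "- {0::real..} = {..<0}" by auto
    then show "AE s in scalar_measure E x. 0 \<le> s"
      using AE_scalar_measure[OF P, of "{0..}" x] 0 by simp
  qed
  finally show ?thesis .
qed

lemma spectral_negative:
  fixes A :: "('h::{real_inner,banach} \<times> 'h) set"
  assumes E: "spectral_measure A E" and x: "E {- real k..<0} x = x" "x \<noteq> 0"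
  obtains y where "(x, y) \<in> A" "y \<bullet> x < 0"
proof -
  have P: "projection_valued_measure E" using E unfolding spectral_measure_def by blast
  let ?K = "{- real k..<0}" and ?m = "scalar_measure E x"
  interpret finite_measure ?m by (rule finite_scalar_measure[OF P])
  have "E (- ?K) (E ?K x) = 0" by (rule pvm_disjoint[OF P]) (auto simp: borel_comp)
  then have AE: "AE s in ?m. s \<in> ?K" using x(1) by (intro AE_scalar_measure[OF P]) auto
  note [measurable_cong] = sets_scalar_measure[OF P]
  have i2: "integrable ?m (\<lambda>s. s\<^sup>2)"
  proof (rule integrable_const_bound)
    show "AE s in ?m. norm (s\<^sup>2) \<le> (real k)\<^sup>2"
      using AE by eventually_elim (auto intro!: abs_le_square_iff[THEN iffD1])
  qed simp
  have i1: "integrable ?m (\<lambda>s. - s)"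
  proof (rule integrable_const_bound)
    show "AE s in ?m. norm (- s) \<le> real k"
      using AE by eventually_elim auto
  qed simp
  have "x \<in> Domain A" using i2 E unfolding spectral_measure_def by simp
  then obtain y where y: "(x, y) \<in> A" by blast
  have yx: "y \<bullet> x = (\<integral>s. s \<partial>?m)" using E y unfolding spectral_measure_def by fast
  have "(\<integral>s. - s \<partial>?m) \<noteq> 0"
  proof
    assume "(\<integral>s. - s \<partial>?m) = 0"
    moreover have "AE s in ?m. 0 \<le> - s" using AE by eventually_elim auto
    ultimately have "AE s in ?m. - s = 0" using integral_nonneg_eq_0_iff_AE[OF i1] by simp
    with AE have "AE s in ?m. False" by eventually_elim auto
    then have "emeasure ?m (space ?m) = 0" using AE_iff_null[of ?m "\<lambda>_. False"] by auto
    then have "ennreal (x \<bullet> x) = 0"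
      using emeasure_scalar_measure[OF P, of UNIV x] by (simp add: pvm_UNIV[OF P] space_scalar_measure[OF P])
    then have "x \<bullet> x \<le> 0" by (simp only: ennreal_eq_0_iff)
    then have "x \<bullet> x = 0" using inner_ge_zero[of x] by linarith
    then show False using x(2) by simp
  qed
  moreover have "(\<integral>s. - s \<partial>?m) \<ge> 0"
    by (rule integral_nonneg_AE) (use AE in eventually_elim, auto)
  ultimately have "y \<bullet> x < 0" using yx by simp
  with y show thesis by (rule that)
qed

lemma pvm_negative_tendsto:
  fixes E :: "real set \<Rightarrow> 'h::{real_inner,banach} \<Rightarrow> 'h"
  assumes P: "projection_valued_measure E"
  shows "(\<lambda>k. E {- real k..<0} x) \<longlonglongrightarrow> E {..<0} x"
proof -
  let ?S = "\<lambda>i::nat. {- real (Suc i)..<- real i}"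
  have "(\<lambda>i. E (?S i) x) sums E (\<Union>i. ?S i) x"
  proof (rule pvm_sums[OF P])
    show "disjoint_family ?S"
      unfolding disjoint_family_on_def
    proof (intro ballI impI)
      fix m n :: nat assume "m \<noteq> n"
      then consider "Suc m \<le> n" | "Suc n \<le> m" by linarith
      then show "?S m \<inter> ?S n = {}" by cases auto
    qed
  qed auto
  moreover have "(\<Union>i. ?S i) = {..<0}"
  proof (intro equalityI subsetI)
    fix s :: real assume s: "s \<in> {..<0}"
    define n where "n = nat (\<lceil>- s\<rceil> - 1)"
    have "\<lceil>- s\<rceil> \<ge> 1" using s by simp
    then have "real n = real_of_int (\<lceil>- s\<rceil> - 1)" unfolding n_def by simp
    then have "s \<in> ?S n" using ceiling_correct[of "- s"] by (auto simp: le_minus_iff minus_le_iff)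
    then show "s \<in> (\<Union>i. ?S i)" by blast
  qed auto
  moreover have "(\<Sum>i<n. E (?S i) x) = E {- real n..<0} x" for n
  proof (induction n)
    case (Suc n)
    have "{- real (Suc n)..<0} = {- real n..<0} \<union> ?S n" by auto
    moreover have "{- real n..<0} \<inter> ?S n = {}" by auto
    ultimately show ?case using Suc pvm_Un[OF P, of "{- real n..<0}" "?S n" x] by simp
  qed (simp add: pvm_empty[OF P])
  ultimately show ?thesis unfolding sums_def by simp
qed

text \<open>
  Gaussian elimination: an equation with a nonzero coefficient at \<open>b0\<close> is used to eliminate \<open>b0\<close>
  from the remaining ones.
\<close>

lemma exists_homogeneous_solution:
  fixes M :: "'j \<Rightarrow> 'b \<Rightarrow> real"
  assumes "finite J" "finite B" "card J < card B"
  shows "\<exists>c. (\<exists>b\<in>B. c b \<noteq> 0) \<and> (\<forall>j\<in>J. (\<Sum>b\<in>B. c b * M j b) = 0)"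
  using assms
proof (induction J arbitrary: B M rule: finite_induct)
  case empty
  then have "B \<noteq> {}" by auto
  then show ?case by (intro exI[of _ "\<lambda>_. 1"]) auto
next
  case (insert j J)
  show ?case
  proof (cases "\<forall>b\<in>B. M j b = 0")
    case True
    obtain c where "\<exists>b\<in>B. c b \<noteq> 0" "\<forall>j\<in>J. (\<Sum>b\<in>B. c b * M j b) = 0"
      using insert.IH[of B M] insert.prems insert.hyps by force
    then show ?thesis using True by (intro exI[of _ c]) simp
  next
    case False
    then obtain b0 where b0: "b0 \<in> B" "M j b0 \<noteq> 0" by blast
    let ?B = "B - {b0}"
    define M' where "M' i b = M i b - M j b / M j b0 * M i b0" for i b
    have "card J < card ?B" using insert b0 by simp
    then obtain c where c: "\<exists>b\<in>?B. c b \<noteq> 0" "\<forall>i\<in>J. (\<Sum>b\<in>?B. c b * M' i b) = 0"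
      using insert.IH[of ?B M'] insert.prems by auto
    define d where "d b = (if b = b0 then - (\<Sum>b\<in>?B. c b * M j b) / M j b0 else c b)" for b
    have "(\<Sum>b\<in>B. d b * M i b) = (\<Sum>b\<in>?B. c b * M' i b)" for i
    proof -
      have "(\<Sum>b\<in>B. d b * M i b) = d b0 * M i b0 + (\<Sum>b\<in>?B. d b * M i b)"
        using insert.prems b0 by (intro sum.remove) auto
      also have "(\<Sum>b\<in>?B. d b * M i b) = (\<Sum>b\<in>?B. c b * M i b)"
        by (intro sum.cong) (auto simp: d_def)
      also have "d b0 * M i b0 = - (\<Sum>b\<in>?B. c b * (M j b / M j b0 * M i b0))"
        by (simp add: d_def sum_distrib_right sum_divide_distrib mult.assoc)
      finally show ?thesis by (simp add: M'_def right_diff_distrib sum_subtractf)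
    qed
    moreover have "M' j b = 0" for b using b0 by (simp add: M'_def)
    ultimately have "\<forall>i\<in>insert j J. (\<Sum>b\<in>B. d b * M i b) = 0" using c(2) by auto
    moreover have "\<exists>b\<in>B. d b \<noteq> 0" using c(1) by (auto simp: d_def)
    ultimately show ?thesis by blast
  qed
qed

text \<open>
  Nonzero vectors in the range of \<open>E {-k..<0}\<close> lie in the domain of \<open>A\<close> and have negative form
  value, so at most \<open>card J\<close> of them are independent. The lower cut-off \<open>-k\<close> is there because the
  range of \<open>E {..<0}\<close> need not lie in the domain of \<open>A\<close>; it is removed at the end by a limit.
\<close>

theorem morse_index_finite:
  fixes A :: "('h::{real_inner,banach} \<times> 'h) set" and \<l> :: "'j \<Rightarrow> 'h \<Rightarrow> real"
  assumes sa: "self_adjoint A" and J: "finite J"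
    and add: "\<And>j x y. j \<in> J \<Longrightarrow> x \<in> Domain A \<Longrightarrow> y \<in> Domain A \<Longrightarrow> \<l> j (x + y) = \<l> j x + \<l> j y"
    and scale: "\<And>j x c. j \<in> J \<Longrightarrow> x \<in> Domain A \<Longrightarrow> \<l> j (c *\<^sub>R x) = c * \<l> j x"
    and nonneg: "\<And>x y. (x, y) \<in> A \<Longrightarrow> (\<And>j. j \<in> J \<Longrightarrow> \<l> j x = 0) \<Longrightarrow> y \<bullet> x \<ge> 0"
  shows "morse_index A < \<infinity>"
proof -
  define E where "E = (SOME E. spectral_measure A E)"
  have E: "spectral_measure A E"
    unfolding E_def using exists_spectral_measure[OF sa] by (rule someI_ex)
  have P: "projection_valued_measure E" using E unfolding spectral_measure_def by blast
  have sub_A: "subspace A" using sa unfolding self_adjoint_def operator_def by blast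
  have D0: "0 \<in> Domain A" using subspace_0[OF sub_A] by (auto simp: zero_prod_def)
  have Dadd: "x + y \<in> Domain A" if "x \<in> Domain A" "y \<in> Domain A" for x y
    using that subspace_add[OF sub_A] by (force simp: Domain_iff)
  have Dscale: "c *\<^sub>R x \<in> Domain A" if "x \<in> Domain A" for x c
    using that subspace_scale[OF sub_A, of _ c] by (force simp: Domain_iff)
  let ?K = "\<lambda>k::nat. {- real k..<0}"
  let ?U = "\<Union>k. range (E (?K k))"
  have range_iff: "x \<in> range (E S) \<longleftrightarrow> E S x = x" if "S \<in> sets borel" for S x
    using orthogonal_projectionD(2)[OF pvm_projection[OF P that]] by (metis rangeE rangeI)
  have lin: "linear (E S)" if "S \<in> sets borel" for S
    using orthogonal_projectionD(1)[OF pvm_projection[OF P that]] .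
  have range_mono: "range (E (?K k)) \<subseteq> range (E (?K l))" if "k \<le> l" for k l
    using pvm_subset[OF P, of "?K k" "?K l"] that by (auto simp: range_iff)
  have card_le: "card B \<le> card J" if B: "finite B" "independent B" "B \<subseteq> range (E (?K k))" for B k
  proof (rule ccontr)
    assume "\<not> card B \<le> card J"
    then obtain c where c: "\<exists>b\<in>B. c b \<noteq> 0" "\<And>j. j \<in> J \<Longrightarrow> (\<Sum>b\<in>B. c b * \<l> j b) = 0"
      using exists_homogeneous_solution[OF J B(1), of \<l>] by auto
    define x where "x = (\<Sum>b\<in>B. c b *\<^sub>R b)"
    have BD: "b \<in> Domain A" if "b \<in> B" for b
    proof (cases "b = 0")
      case False
      have "E (?K k) b = b" using that B(3) range_iff[of "?K k" b] by auto
      then obtain y where "(b, y) \<in> A" using spectral_negative[OF E _ False] by blast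
      then show ?thesis by blast
    qed (use D0 in simp)
    have lx: "(\<Sum>b\<in>B'. c b *\<^sub>R b) \<in> Domain A \<and> (\<forall>j\<in>J. \<l> j (\<Sum>b\<in>B'. c b *\<^sub>R b) = (\<Sum>b\<in>B'. c b * \<l> j b))"
      if "B' \<subseteq> B" for B'
      using finite_subset[OF that B(1)] that
    proof (induction B' rule: finite_induct)
      case empty
      then show ?case using D0 scale[OF _ D0, of _ 0] by simp
    next
      case (insert b B')
      then show ?case using BD by (simp add: add scale Dadd Dscale)
    qed
    have "x \<noteq> 0" using c(1) B(1,2) unfolding x_def by (auto simp: independent_explicit_finite_subsets)
    moreover have "E (?K k) x = x"
    proof -
      have "x \<in> range (E (?K k))"
        unfolding x_def using B(3) lin[of "?K k"]
        by (intro subspace_sum subspace_scale linear_subspace_image) auto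
      then show ?thesis using range_iff by simp
    qed
    ultimately obtain y where "(x, y) \<in> A" "y \<bullet> x < 0"
      using spectral_negative[OF E] by blast
    moreover have "\<l> j x = 0" if "j \<in> J" for j using lx[of B] c(2) that by (simp add: x_def)
    ultimately show False using nonneg by fastforce
  qed
  have in_one: "\<exists>k. B \<subseteq> range (E (?K k))" if "finite B" "B \<subseteq> ?U" for B
    using that
  proof (induction B rule: finite_induct)
    case (insert b B)
    then obtain k l where "B \<subseteq> range (E (?K k))" "b \<in> range (E (?K l))" by blast
    then have "insert b B \<subseteq> range (E (?K (max k l)))"
      using range_mono[of k "max k l"] range_mono[of l "max k l"] by (meson insert_subset max.cobounded1 max.cobounded2 subset_trans subsetD)
    then show ?case by blast
  qed simp
  have card_le_U: "card B \<le> card J" if "finite B \<and> independent B \<and> B \<subseteq> ?U" for B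
    using in_one[of B] card_le that by blast
  define Q where "Q B \<longleftrightarrow> finite B \<and> independent B \<and> B \<subseteq> ?U" for B
  have "Q {}" by (simp add: Q_def real_vector.independent_empty)
  moreover have "\<forall>B. Q B \<longrightarrow> card B \<le> card J" using card_le_U unfolding Q_def by blast
  ultimately have "\<exists>B. Q B \<and> (\<forall>B'. Q B' \<longrightarrow> card B' \<le> card B)"
    by (intro ex_has_greatest_nat[where b="Suc (card J)" and k="{}"]) auto
  then obtain B0 where "Q B0" and max: "\<And>B. Q B \<Longrightarrow> card B \<le> card B0" by blast
  then have B0: "finite B0" "independent B0" "B0 \<subseteq> ?U" unfolding Q_def by blast+
  have Uspan: "?U \<subseteq> span B0"
  proof
    fix x assume x: "x \<in> ?U"
    show "x \<in> span B0"
    proof (rule ccontr)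
      assume n: "x \<notin> span B0"
      then have "independent (insert x B0)" using B0 by (simp add: independent_insert)
      then have "card (insert x B0) \<le> card B0" using B0 x by (intro max) (simp add: Q_def)
      moreover have "x \<notin> B0" using n span_base by blast
      ultimately show False using B0 by simp
    qed
  qed
  obtain k0 where k0: "B0 \<subseteq> range (E (?K k0))" using in_one[OF B0(1,3)] by blast
  have span_sub: "span B0 \<subseteq> range (E (?K k0))"
    using k0 lin[of "?K k0"] by (intro span_minimal linear_subspace_image) auto
  \<comment> \<open>a maximal independent set \<open>B0\<close> of the increasing union \<open>?U\<close> already sits in one range, which is closed\<close>
  have Vspan: "range (E {..<0}) \<subseteq> span B0"
  proof
    fix z assume z: "z \<in> range (E {..<0})"
    have bl: "bounded_linear (E (?K k0))"
      by (intro orthogonal_projection_bounded_linear pvm_projection[OF P]) simp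
    have "E (?K k0) (E (?K k) z) = E (?K k) z" for k
      using Uspan span_sub range_iff[of "?K k0" "E (?K k) z"] by auto
    moreover have "(\<lambda>k. E (?K k) z) \<longlonglongrightarrow> z"
      using pvm_negative_tendsto[OF P, of z] z range_iff[of "{..<0}" z] by simp
    moreover from this have "(\<lambda>k. E (?K k0) (E (?K k) z)) \<longlonglongrightarrow> E (?K k0) z"
      by (rule bounded_linear.tendsto[OF bl])
    ultimately have "E (?K k0) z = z" using LIMSEQ_unique by simp
    then have "z \<in> ?U" by (metis UN_I UNIV_I rangeI)
    then show "z \<in> span B0" using Uspan by blast
  qed
  have "morse_index A \<le> enat (card B0)"
    unfolding morse_index_def negative_spectral_subspace_def edim_def E_def[symmetric]
  proof (rule SUP_least)
    fix B assume "B \<in> {B. B \<subseteq> range (E {..<0}) \<and> finite B \<and> independent B}"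
    then show "enat (card B) \<le> enat (card B0)"
      using independent_span_bound[of B0 B] B0 Vspan by auto
  qed
  also have "enat (card B0) < \<infinity>" by simp
  finally show ?thesis .
qed

text \<open>
  A combination of the \<open>x i\<close> that is annihilated by \<open>E {..<0}\<close> has nonnegative form value, whereas
  the form is negative definite on the span of the \<open>x i\<close>. So \<open>E {..<0}\<close> is injective on this span.
\<close>

theorem morse_index_infinite:
  fixes A :: "('h::{real_inner,banach} \<times> 'h) set" and x y :: "nat \<Rightarrow> 'h"
  assumes sa: "self_adjoint A" and xy: "\<And>i. (x i, y i) \<in> A"
    and orth: "\<And>i j. i \<noteq> j \<Longrightarrow> y i \<bullet> x j = 0" and neg: "\<And>i. y i \<bullet> x i < 0"
  shows "morse_index A = \<infinity>"
proof -
  define E where "E = (SOME E. spectral_measure A E)"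
  have E: "spectral_measure A E"
    unfolding E_def using exists_spectral_measure[OF sa] by (rule someI_ex)
  have P: "projection_valued_measure E" using E unfolding spectral_measure_def by blast
  have sub_A: "subspace A" using sa unfolding self_adjoint_def operator_def by blast
  let ?f = "\<lambda>i. E {..<0} (x i)"
  have lin: "linear (E {..<0})"
    by (intro orthogonal_projectionD(1) pvm_projection[OF P]) simp
  have key: "c i = 0" if "(\<Sum>i<n. c i *\<^sub>R ?f i) = 0" "i < n" for c :: "nat \<Rightarrow> real" and n i
  proof (rule ccontr)
    assume ci: "c i \<noteq> 0"
    let ?x = "\<Sum>i<n. c i *\<^sub>R x i" and ?y = "\<Sum>i<n. c i *\<^sub>R y i"
    have "E {..<0} ?x = 0"
      using that(1) by (simp add: linear_sum[OF lin] linear_scale[OF lin])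
    moreover have "(\<Sum>i<n. c i *\<^sub>R (x i, y i)) \<in> A"
      using xy by (intro subspace_sum subspace_scale sub_A)
    then have "(?x, ?y) \<in> A" by (simp add: sum_prod)
    ultimately have "?y \<bullet> ?x \<ge> 0" by (intro spectral_nonneg[OF E])
    also have "?y \<bullet> ?x = (\<Sum>i<n. \<Sum>j<n. c i * c j * (y i \<bullet> x j))"
      unfolding inner_sum_left by (simp add: inner_sum_right sum_distrib_left mult_ac)
    also have "\<dots> = (\<Sum>i<n. \<Sum>j<n. if j = i then (c i)\<^sup>2 * (y i \<bullet> x i) else 0)"
      by (intro sum.cong) (auto simp: orth power2_eq_square)
    also have "\<dots> = (\<Sum>i<n. (c i)\<^sup>2 * (y i \<bullet> x i))" by simp
    also have "\<dots> = (c i)\<^sup>2 * (y i \<bullet> x i) + (\<Sum>i\<in>{..<n}-{i}. (c i)\<^sup>2 * (y i \<bullet> x i))"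
      using that(2) by (intro sum.remove) auto
    also have "\<dots> < 0"
    proof (rule add_neg_nonpos)
      show "(c i)\<^sup>2 * (y i \<bullet> x i) < 0" using ci neg by (simp add: mult_pos_neg)
      show "(\<Sum>i\<in>{..<n}-{i}. (c i)\<^sup>2 * (y i \<bullet> x i)) \<le> 0"
        using neg by (intro sum_nonpos mult_nonneg_nonpos) (auto intro: less_imp_le)
    qed
    finally show False by simp
  qed
  have inj: "inj ?f"
  proof (rule injI, rule ccontr)
    fix i j assume eq: "?f i = ?f j" and ne: "i \<noteq> j"
    let ?c = "\<lambda>k. (if k = i then 1 else 0) - (if k = j then 1 else (0::real))"
    obtain n where ij: "i < n" "j < n" using less_Suc_eq_le max.cobounded1 max.cobounded2 by metis
    have "(\<Sum>k<n. ?c k *\<^sub>R ?f k) = (\<Sum>k<n. (if k = i then ?f k else 0)) - (\<Sum>k<n. if k = j then ?f k else 0)"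
      unfolding sum_subtractf[symmetric] by (intro sum.cong) (auto simp: scaleR_diff_left)
    also have "\<dots> = 0" using ij by (simp add: eq)
    finally have "?c i = 0" by (rule key) (rule ij)
    then show False using ne by simp
  qed
  have indep: "independent (?f ` {..<n})" for n
  proof (rule independent_if_scalars_zero)
    fix d v assume s: "(\<Sum>v\<in>?f ` {..<n}. d v *\<^sub>R v) = 0" and v: "v \<in> ?f ` {..<n}"
    have "(\<Sum>i<n. d (?f i) *\<^sub>R ?f i) = 0"
      using s inj by (subst (asm) sum.reindex) (auto intro: inj_on_subset simp: o_def)
    then show "d v = 0" using key v by auto
  qed simp
  have le: "enat n \<le> morse_index A" for n
  proof -
    have "enat (card (?f ` {..<n})) \<le> morse_index A"
      unfolding morse_index_def negative_spectral_subspace_def edim_def E_def[symmetric]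
      using indep by (intro SUP_upper) auto
    moreover have "card (?f ` {..<n}) = n" using inj by (simp add: card_image inj_on_subset)
    ultimately show ?thesis by simp
  qed
  show ?thesis
  proof (cases "morse_index A")
    case (enat m)
    then show ?thesis using le[of "Suc m"] by simp
  qed simp
qed

section \<open>Completeness of the space of square-integrable functions\<close>

lemma square_integrable_rep: "square_integrable (rep_L2 u)"
  using Quotient3_rep_reflp[OF Quotient3_L2, of u] by (simp add: ae_equal_def)

lemma L2_class_rep [simp]: "L2_class (rep_L2 u) = u"
  by (rule Quotient3_abs_rep[OF Quotient3_L2])

lemma ae_equal_refl: "square_integrable f \<Longrightarrow> ae_equal f f"
  by (simp add: ae_equal_def)

lemma L2_class_eq_iff:
  "square_integrable f \<Longrightarrow> square_integrable g \<Longrightarrow>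
    L2_class f = L2_class g \<longleftrightarrow> (AE t in halfline. f t = g t)"
  using Quotient3_rel[OF Quotient3_L2, of f g] by (auto simp: ae_equal_def)

lemma rep_L2_class: "square_integrable f \<Longrightarrow> AE t in halfline. rep_L2 (L2_class f) t = f t"
  using L2_class_eq_iff[OF square_integrable_rep, of f "L2_class f"] by simp

lemma L2_class_add: "square_integrable f \<Longrightarrow> square_integrable g \<Longrightarrow>
    L2_class f + L2_class g = L2_class (\<lambda>t. f t + g t)"
  by (intro plus_L2.abs_eq ae_equal_refl)

lemma L2_class_scaleR: "square_integrable f \<Longrightarrow> c *\<^sub>R L2_class f = L2_class (\<lambda>t. c *\<^sub>R f t)"
  by (intro scaleR_L2.abs_eq ae_equal_refl)

lemma L2_class_diff: "square_integrable f \<Longrightarrow> square_integrable g \<Longrightarrow>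
    L2_class f - L2_class g = L2_class (\<lambda>t. f t - g t)"
proof -
  assume f: "square_integrable f" and g: "square_integrable g"
  have "L2_class f - L2_class g = L2_class f + (-1) *\<^sub>R L2_class g" by simp
  also have "\<dots> = L2_class (\<lambda>t. f t + (-1) *\<^sub>R g t)"
    using L2_class_add[OF f square_integrable_scaleR[OF g]] L2_class_scaleR[OF g] by metis
  finally show ?thesis by simp
qed

lemma square_integrable_diff: "square_integrable f \<Longrightarrow> square_integrable g \<Longrightarrow>
    square_integrable (\<lambda>t. f t - g t)"
  using square_integrable_add[of f "\<lambda>t. - g t"] square_integrable_uminus[of g] by simp

lemma L2_class_inner: "square_integrable f \<Longrightarrow> square_integrable g \<Longrightarrow>
    L2_class f \<bullet> L2_class g = (\<integral>t. f t \<bullet> g t \<partial>halfline)"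
  by (intro inner_L2.abs_eq ae_equal_refl)

lemma norm_L2_class: "square_integrable f \<Longrightarrow> (norm (L2_class f))\<^sup>2 = (\<integral>t. (norm (f t))\<^sup>2 \<partial>halfline)"
  by (simp add: power2_norm_eq_inner L2_class_inner)

lemma nn_integral_square:
  "square_integrable f \<Longrightarrow> (\<integral>\<^sup>+t. ennreal ((norm (f t))\<^sup>2) \<partial>halfline) = ennreal ((norm (L2_class f))\<^sup>2)"
  unfolding norm_L2_class by (intro nn_integral_eq_integral) (auto simp: square_integrable_def)

lemma square_integrableI:
  assumes "f \<in> borel_measurable halfline" "(\<integral>\<^sup>+t. ennreal ((norm (f t))\<^sup>2) \<partial>halfline) < \<infinity>"
  shows "square_integrable f"
  unfolding square_integrable_def
  using assms by (auto intro!: integrableI_bounded)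

lemma summable_of_weighted_squares:
  fixes d :: "nat \<Rightarrow> 'v::banach"
  assumes "summable (\<lambda>k. 2 ^ k * (norm (d k))\<^sup>2)"
  shows "summable d"
proof -
  obtain c where c: "\<And>k. norm (2 ^ k * (norm (d k))\<^sup>2) \<le> c"
    using summable_imp_bounded[OF assms] unfolding bounded_iff by auto
  have "norm (d k) \<le> sqrt c * (sqrt (1/2)) ^ k" for k
  proof (rule power2_le_imp_le)
    have c0: "c \<ge> 0" using c[of 0] norm_ge_zero order_trans by blast
    have "(sqrt (1/2) ^ k)\<^sup>2 = ((sqrt (1/2))\<^sup>2) ^ k" by (simp only: power_mult[symmetric] mult.commute)
    also have "\<dots> = (1/2) ^ k" by simp
    finally have "(sqrt c * (sqrt (1/2)) ^ k)\<^sup>2 = c * (1/2) ^ k"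
      using c0 by (simp add: power_mult_distrib)
    moreover have "2 ^ k * (norm (d k))\<^sup>2 \<le> c" using c[of k] by simp
    then have "(norm (d k))\<^sup>2 \<le> c * (1/2) ^ k" by (simp add: power_one_over field_simps)
    ultimately show "(norm (d k))\<^sup>2 \<le> (sqrt c * (sqrt (1/2)) ^ k)\<^sup>2" by simp
    show "0 \<le> sqrt c * sqrt (1/2) ^ k" using c0 by simp
  qed
  moreover have "summable (\<lambda>k. sqrt c * (sqrt (1/2)) ^ k)"
    by (intro summable_mult summable_geometric) (simp add: real_sqrt_divide)
  ultimately show ?thesis using summable_comparison_test' by blast
qed

text \<open>
  Along a rapidly converging subsequence \<open>f\<close> the series of \<open>2\<^sup>k \<parallel>f (k + 1) - f k\<parallel>\<^sup>2\<close> has a finite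
  integral, so it converges almost everywhere, and with it \<open>f\<close>. By the lemma of Fatou the pointwise
  limit is a limit in norm.
\<close>

lemma L2_Cauchy_convergent:
  fixes X :: "nat \<Rightarrow> 'v::euclidean_space L2"
  assumes "Cauchy X" shows "convergent X"
proof -
  have "\<exists>N. \<forall>m\<ge>N. \<forall>n\<ge>N. dist (X m) (X n) < (1/2) ^ k" for k
    using assms unfolding Cauchy_def by simp
  then obtain N where N: "\<And>k m n. m \<ge> N k \<Longrightarrow> n \<ge> N k \<Longrightarrow> dist (X m) (X n) < (1/2) ^ k"
    by metis
  define r where "r k = (\<Sum>i\<le>k. Suc (N i))" for k
  have mono: "strict_mono r" unfolding r_def by (intro strict_monoI_Suc) simp
  have rN: "r j \<ge> N k" if "j \<ge> k" for j k
  proof -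
    have "N k \<le> Suc (N k)" by simp
    also have "\<dots> \<le> r j" unfolding r_def using that by (intro member_le_sum) auto
    finally show ?thesis .
  qed
  define f where "f k = rep_L2 (X (r k))" for k
  have f: "square_integrable (f k)" "L2_class (f k) = X (r k)" for k
    by (simp_all add: f_def square_integrable_rep)
  have meas [measurable]: "f k \<in> borel_measurable halfline" for k
    using f(1) by (simp add: square_integrable_def)
  have close: "(\<integral>\<^sup>+t. ennreal ((norm (f j t - f k t))\<^sup>2) \<partial>halfline) \<le> ennreal ((1/4) ^ k)" if "j \<ge> k" for j k
  proof -
    have "(\<integral>\<^sup>+t. ennreal ((norm (f j t - f k t))\<^sup>2) \<partial>halfline) = ennreal ((norm (X (r j) - X (r k)))\<^sup>2)"
      using nn_integral_square[OF square_integrable_diff[OF f(1) f(1)], of j k]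
      by (simp add: L2_class_diff[OF f(1) f(1), symmetric] f(2))
    also have "\<dots> \<le> ennreal (((1/2) ^ k)\<^sup>2)"
      using N[OF rN[OF that] rN[of k k]] by (intro ennreal_leI power_mono) (auto simp: dist_norm)
    also have "((1/2::real) ^ k)\<^sup>2 = ((1/2)\<^sup>2) ^ k" by (simp only: power_mult[symmetric] mult.commute)
    finally show ?thesis by (simp add: power2_eq_square)
  qed
  let ?w = "\<lambda>k t. 2 ^ k * (norm (f (Suc k) t - f k t))\<^sup>2"
  have "(\<integral>\<^sup>+t. (\<Sum>k. ennreal (?w k t)) \<partial>halfline) = (\<Sum>k. \<integral>\<^sup>+t. ennreal (?w k t) \<partial>halfline)"
    by (intro nn_integral_suminf) measurable
  also have "\<dots> \<le> (\<Sum>k. ennreal ((1/2) ^ k))"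
  proof (rule suminf_le)
    fix k
    have "(\<integral>\<^sup>+t. ennreal (?w k t) \<partial>halfline) = ennreal (2 ^ k) * (\<integral>\<^sup>+t. ennreal ((norm (f (Suc k) t - f k t))\<^sup>2) \<partial>halfline)"
      by (subst nn_integral_cmult[symmetric]) (auto simp: ennreal_mult)
    also have "\<dots> \<le> ennreal (2 ^ k) * ennreal ((1/4) ^ k)" by (intro mult_left_mono close) auto
    also have "\<dots> = ennreal ((1/2) ^ k)"
      by (simp add: ennreal_mult[symmetric] power_mult_distrib[symmetric] del: ennreal_power)
    finally show "(\<integral>\<^sup>+t. ennreal (?w k t) \<partial>halfline) \<le> ennreal ((1/2) ^ k)" .
  qed auto
  also have "(\<Sum>k. ennreal ((1/2) ^ k)) = ennreal 2"
    using geometric_sums[of "1/2::real"] by (intro suminf_ennreal_eq) auto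
  finally have "(\<integral>\<^sup>+t. (\<Sum>k. ennreal (?w k t)) \<partial>halfline) \<noteq> \<infinity>" by (auto simp: top_unique)
  then have "AE t in halfline. (\<Sum>k. ennreal (?w k t)) \<noteq> \<infinity>"
    by (intro nn_integral_PInf_AE) measurable
  then have conv: "AE t in halfline. convergent (\<lambda>k. f k t)"
  proof eventually_elim
    fix t assume "(\<Sum>k. ennreal (?w k t)) \<noteq> \<infinity>"
    then have "summable (\<lambda>k. ?w k t)" by (intro summable_suminf_not_top) auto
    then have "summable (\<lambda>k. f (Suc k) t - f k t)" by (rule summable_of_weighted_squares)
    then have "convergent (\<lambda>n. f n t - f 0 t)"
      by (simp add: summable_iff_convergent sum_lessThan_telescope[of "\<lambda>k. f k t"])
    from convergent_add[OF this convergent_const[of "f 0 t"]] show "convergent (\<lambda>k. f k t)" by simp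
  qed
  define g where "g t = lim (\<lambda>k. f k t)" for t
  have g [measurable]: "g \<in> borel_measurable halfline" unfolding g_def by measurable
  have lim: "(\<integral>\<^sup>+t. ennreal ((norm (g t - f k t))\<^sup>2) \<partial>halfline) \<le> ennreal ((1/4) ^ k)" for k
  proof -
    have "(\<integral>\<^sup>+t. ennreal ((norm (g t - f k t))\<^sup>2) \<partial>halfline) =
      (\<integral>\<^sup>+t. liminf (\<lambda>j. ennreal ((norm (f j t - f k t))\<^sup>2)) \<partial>halfline)"
    proof (rule nn_integral_cong_AE, use conv in eventually_elim)
      fix t assume "convergent (\<lambda>k. f k t)"
      then have "(\<lambda>j. f j t) \<longlonglongrightarrow> g t" unfolding g_def by (simp add: convergent_LIMSEQ_iff)
      then have "(\<lambda>j. ennreal ((norm (f j t - f k t))\<^sup>2)) \<longlonglongrightarrow> ennreal ((norm (g t - f k t))\<^sup>2)"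
        by (intro tendsto_ennrealI tendsto_intros)
      then show "ennreal ((norm (g t - f k t))\<^sup>2) = liminf (\<lambda>j. ennreal ((norm (f j t - f k t))\<^sup>2))"
        by (intro lim_imp_Liminf[symmetric]) auto
    qed
    also have "\<dots> \<le> liminf (\<lambda>j. \<integral>\<^sup>+t. ennreal ((norm (f j t - f k t))\<^sup>2) \<partial>halfline)"
      by (intro nn_integral_liminf) measurable
    also have "\<dots> \<le> liminf (\<lambda>j. ennreal ((1/4) ^ k))"
      by (intro Liminf_mono eventually_mono[OF eventually_ge_at_top[of k]] close)
    finally show ?thesis by (simp add: Liminf_const)
  qed
  have d: "square_integrable (\<lambda>t. g t - f k t)" for k
    using lim[of k] by (intro square_integrableI) (auto intro: order_le_less_trans)
  then have sg: "square_integrable g" using square_integrable_add[OF d[of 0] f(1)[of 0]] by simp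
  have "(\<lambda>k. X (r k)) \<longlonglongrightarrow> L2_class g"
  proof (rule Lim_null[THEN iffD2, OF tendsto_norm_zero_cancel])
    have b: "norm (X (r k) - L2_class g) \<le> (1/2) ^ k" for k
    proof (rule power2_le_imp_le)
      have "ennreal ((norm (L2_class g - X (r k)))\<^sup>2) \<le> ennreal ((1/4) ^ k)"
        using lim[of k] nn_integral_square[OF d, of k] L2_class_diff[OF sg f(1), of k] by (simp add: f(2))
      then have "(norm (L2_class g - X (r k)))\<^sup>2 \<le> (1/4) ^ k" by (simp add: ennreal_le_iff del: ennreal_power)
      also have "\<dots> = ((1/2) ^ k)\<^sup>2" by (simp add: power2_eq_square power_mult_distrib[symmetric])
      finally show "(norm (X (r k) - L2_class g))\<^sup>2 \<le> ((1/2) ^ k)\<^sup>2" by (simp add: norm_minus_commute)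
    qed simp
    show "(\<lambda>k. norm (X (r k) - L2_class g)) \<longlonglongrightarrow> 0"
    proof (rule tendsto_sandwich[OF _ _ tendsto_const])
      show "\<forall>\<^sub>F k in sequentially. norm (X (r k) - L2_class g) \<le> (1/2) ^ k" using b by simp
      show "(\<lambda>k. (1/2) ^ k :: real) \<longlonglongrightarrow> 0" by (intro LIMSEQ_power_zero) simp
    qed simp
  qed
  then have "X \<longlonglongrightarrow> L2_class g"
    using Cauchy_converges_subseq[OF assms mono] by (simp add: o_def)
  then show ?thesis by (auto simp: convergent_def)
qed

instance L2 :: (euclidean_space) banach
  by standard (rule L2_Cauchy_convergent)

section \<open>Test functions\<close>

text \<open>
  Iterating a choice of derivatives inside \<open>S\<close> produces all derivatives at once. Closure properties
  of smooth functions are derived by exhibiting such a set \<open>S\<close>.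
\<close>

lemma smooth_coinduct:
  assumes "f \<in> S" and S: "\<And>g. g \<in> S \<Longrightarrow> \<exists>g'\<in>S. \<forall>t. (g has_vector_derivative g' t) (at t)"
  shows "smooth f"
proof -
  obtain h where h: "\<And>g. g \<in> S \<Longrightarrow> h g \<in> S" "\<And>g t. g \<in> S \<Longrightarrow> (g has_vector_derivative h g t) (at t)"
    using S by metis
  have "(h ^^ k) f \<in> S" for k by (induction k) (auto intro: h assms(1))
  then show ?thesis
    unfolding smooth_def by (intro exI[of _ "\<lambda>k. (h ^^ k) f"]) (auto intro: h)
qed

lemma smooth_derivative:
  assumes "smooth f" obtains f' where "smooth f'" "\<And>t. (f has_vector_derivative f' t) (at t)"
proof -
  obtain D where D: "D 0 = f" "\<And>k t. (D k has_vector_derivative D (Suc k) t) (at t)"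
    using assms unfolding smooth_def by blast
  have "smooth (D 1)"
    unfolding smooth_def using D by (intro exI[of _ "\<lambda>k. D (Suc k)"]) auto
  moreover have "(f has_vector_derivative D 1 t) (at t)" for t using D(2)[of 0 t] D(1) by simp
  ultimately show thesis by (rule that)
qed

lemma smooth_primitive:
  assumes "smooth f'" "\<And>t. (f has_vector_derivative f' t) (at t)" shows "smooth f"
proof (rule smooth_coinduct[of _ "insert f {g. smooth g}"])
  fix g assume "g \<in> insert f {g. smooth g}"
  then show "\<exists>g'\<in>insert f {g. smooth g}. \<forall>t. (g has_vector_derivative g' t) (at t)"
    using assms smooth_derivative[of g] by blast
qed simp

lemma smooth_imp_continuous: "smooth f \<Longrightarrow> continuous_on S f"
  by (erule smooth_derivative)
    (metis continuous_at_imp_continuous_on has_vector_derivative_continuous)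

lemma smooth_bounded_linear:
  assumes "bounded_linear L" "smooth f" shows "smooth (\<lambda>t. L (f t))"
proof (rule smooth_coinduct[of _ "{\<lambda>t. L (g t) | g. smooth g}"])
  fix h assume "h \<in> {\<lambda>t. L (g t) | g. smooth g}"
  then obtain g where g: "h = (\<lambda>t. L (g t))" "smooth g" by blast
  obtain g' where "smooth g'" "\<And>t. (g has_vector_derivative g' t) (at t)"
    using smooth_derivative[OF g(2)] by blast
  then show "\<exists>h'\<in>{\<lambda>t. L (g t) | g. smooth g}. \<forall>t. (h has_vector_derivative h' t) (at t)"
    unfolding g(1) by (intro bexI[of _ "\<lambda>t. L (g' t)"]) (auto intro: bounded_linear.has_vector_derivative[OF assms(1)])
qed (use assms in auto)

lemma smooth_add:
  assumes "smooth f" "smooth g" shows "smooth (\<lambda>t. f t + g t)"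
proof (rule smooth_coinduct[of _ "{\<lambda>t. f t + g t | f g. smooth f \<and> smooth g}"])
  fix h :: "real \<Rightarrow> 'a" assume "h \<in> {\<lambda>t. f t + g t | f g. smooth f \<and> smooth g}"
  then obtain f g where h: "h = (\<lambda>t. f t + g t)" "smooth f" "smooth g" by blast
  obtain f' g' where "smooth f'" "\<And>t. (f has_vector_derivative f' t) (at t)"
    "smooth g'" "\<And>t. (g has_vector_derivative g' t) (at t)"
    using smooth_derivative[OF h(2)] smooth_derivative[OF h(3)] by metis
  then show "\<exists>h'\<in>{\<lambda>t. f t + g t | f g. smooth f \<and> smooth g}. \<forall>t. (h has_vector_derivative h' t) (at t)"
    unfolding h(1) by (intro bexI[of _ "\<lambda>t. f' t + g' t"]) (auto intro: has_vector_derivative_add)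
qed (use assms in blast)

lemma smooth_mult:
  fixes f g :: "real \<Rightarrow> real"
  assumes "smooth f" "smooth g" shows "smooth (\<lambda>t. f t * g t)"
proof -
  \<comment> \<open>finite sums of products are closed under differentiation, products alone are not\<close>
  define S where "S = {\<lambda>t. \<Sum>i<n. F i t * G i t | n F G. (\<forall>i::nat. smooth (F i) \<and> smooth (G i :: real \<Rightarrow> real))}"
  show ?thesis
  proof (rule smooth_coinduct)
    show "(\<lambda>t. f t * g t) \<in> S"
      unfolding S_def using assms
      by (intro CollectI exI[of _ "1::nat"] exI[of _ "\<lambda>_. f"] exI[of _ "\<lambda>_. g"]) auto
    fix h assume "h \<in> S"
    then obtain n F G where h: "h = (\<lambda>t. \<Sum>i<n. F i t * G i t)"
      and FG: "\<And>i::nat. smooth (F i)" "\<And>i. smooth (G i)" unfolding S_def by blast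
    have "\<exists>F'. \<forall>i. smooth (F' i) \<and> (\<forall>t. (F i has_vector_derivative F' i t) (at t))"
      by (intro choice allI) (meson smooth_derivative FG(1))
    then obtain F' where F': "\<And>i. smooth (F' i)" "\<And>i t. (F i has_vector_derivative F' i t) (at t)" by blast
    have "\<exists>G'. \<forall>i. smooth (G' i) \<and> (\<forall>t. (G i has_vector_derivative G' i t) (at t))"
      by (intro choice allI) (meson smooth_derivative FG(2))
    then obtain G' where G': "\<And>i. smooth (G' i)" "\<And>i t. (G i has_vector_derivative G' i t) (at t)" by blast
    define P where "P i = (if i < n then F' i else F (i - n))" for i
    define Q where "Q i = (if i < n then G i else G' (i - n))" for i
    let ?h' = "\<lambda>t. \<Sum>i<n + n. P i t * Q i t"
    have sum: "?h' t = (\<Sum>i<n. F' i t * G i t) + (\<Sum>i<n. F i t * G' i t)" for t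
    proof -
      have "?h' t = (\<Sum>i<n. P i t * Q i t) + (\<Sum>i<n. P (n + i) t * Q (n + i) t)"
        using sum.atLeastLessThan_concat[of 0 n "n + n" "\<lambda>i. P i t * Q i t"]
          sum.shift_bounds_nat_ivl[of "\<lambda>i. P i t * Q i t" 0 n n]
        by (simp add: lessThan_atLeast0 add.commute)
      then show ?thesis by (simp add: P_def Q_def)
    qed
    have "(h has_vector_derivative ?h' t) (at t)" for t
    proof -
      have "(h has_vector_derivative (\<Sum>i<n. F i t * G' i t + F' i t * G i t)) (at t)"
        unfolding h by (intro has_vector_derivative_sum has_vector_derivative_mult F' G')
      then show ?thesis unfolding sum by (simp add: sum.distrib add.commute)
    qed
    moreover have "?h' \<in> S"
      unfolding S_def using FG F' G' by (intro CollectI exI[of _ "n + n"] exI[of _ P] exI[of _ Q]) (auto simp: P_def Q_def)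
    ultimately show "\<exists>h'\<in>S. \<forall>t. (h has_vector_derivative h' t) (at t)"
      by (intro bexI[of _ ?h'] allI)
  qed
qed

lemma smooth_affine:
  fixes f :: "real \<Rightarrow> 'a::real_normed_vector"
  assumes "smooth f" shows "smooth (\<lambda>t. f (a * t + b))"
proof (rule smooth_coinduct[of _ "{\<lambda>t. g (a * t + b) | g. smooth g}"])
  fix h :: "real \<Rightarrow> 'a" assume "h \<in> {\<lambda>t. g (a * t + b) | g. smooth g}"
  then obtain g where g: "h = (\<lambda>t. g (a * t + b))" "smooth g" by blast
  obtain g' where g': "smooth g'" "\<And>t. (g has_vector_derivative g' t) (at t)"
    using smooth_derivative[OF g(2)] by blast
  have "(h has_vector_derivative a *\<^sub>R g' (a * t + b)) (at t)" for t
  proof -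
    have "((\<lambda>t. a * t + b) has_vector_derivative a) (at t)"
      by (auto intro!: derivative_eq_intros)
    from vector_diff_chain_at[OF this g'(2)] show ?thesis by (simp add: g(1) o_def)
  qed
  moreover have "smooth (\<lambda>t. a *\<^sub>R g' t)" by (rule smooth_bounded_linear[OF bounded_linear_scaleR_right g'(1)])
  ultimately show "\<exists>h'\<in>{\<lambda>t. g (a * t + b) | g. smooth g}. \<forall>t. (h has_vector_derivative h' t) (at t)"
    by (intro bexI[of _ "\<lambda>t. a *\<^sub>R g' (a * t + b)"]) auto
qed (use assms in blast)

lemma poly_exp_tendsto_0:
  fixes c :: real assumes "c > 0"
  shows "((\<lambda>y. poly p y * exp (- (c * y))) \<longlongrightarrow> 0) at_top"
  using assms
proof (induction p arbitrary: c)
  case (pCons a p)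
  have "((\<lambda>y. a * exp (- (c * y))) \<longlongrightarrow> 0) at_top" "((\<lambda>y. y * exp (- (c / 2 * y))) \<longlongrightarrow> 0) at_top"
    using pCons.prems by real_asymp+
  moreover have "((\<lambda>y. poly p y * exp (- (c / 2 * y))) \<longlongrightarrow> 0) at_top"
    using pCons.prems by (intro pCons.IH) auto
  ultimately have "((\<lambda>y. a * exp (- (c * y)) + (y * exp (- (c / 2 * y))) * (poly p y * exp (- (c / 2 * y)))) \<longlongrightarrow> 0 + 0 * 0) at_top"
    by (intro tendsto_intros)
  moreover have "a * exp (- (c * y)) + (y * exp (- (c / 2 * y))) * (poly p y * exp (- (c / 2 * y))) =
    poly (pCons a p) y * exp (- (c * y))" for y
  proof -
    have "exp (- (c / 2 * y)) * exp (- (c / 2 * y)) = exp (- (c * y))" by (simp add: exp_add[symmetric])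
    then show ?thesis by (simp add: algebra_simps)
  qed
  ultimately show ?case by simp
qed simp

definition flat_exp :: "real \<Rightarrow> real \<Rightarrow> real" where
  "flat_exp c x = (if x > 0 then exp (- (c / x)) else 0)"

lemma flat_exp_bounds: "c > 0 \<Longrightarrow> 0 \<le> flat_exp c x" "c > 0 \<Longrightarrow> flat_exp c x \<le> 1"
  by (auto simp: flat_exp_def)

text \<open>
  The functions \<open>p (1 / x) exp (- c / x)\<close>, continued by \<open>0\<close> to \<open>x \<le> 0\<close>, with \<open>p\<close> a polynomial, are
  closed under differentiation: the difference quotient at \<open>0\<close> is of the same kind, and the
  exponential beats every polynomial in \<open>1 / x\<close>.
\<close>

lemma smooth_flat_exp: assumes c: "c > 0" shows "smooth (flat_exp c)"
proof -
  define h where "h p x = (if x > 0 then poly p (1 / x) * exp (- (c / x)) else 0)" for p :: "real poly" and x :: real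
  have deriv: "(h p has_vector_derivative h (monom 1 2 * (smult c p - pderiv p)) x) (at x)" (is "(_ has_vector_derivative h ?q x) _") for p x
  proof -
    consider "x > 0" | "x < 0" | "x = 0" by linarith
    then show ?thesis
    proof cases
      case 1
      have "((\<lambda>x. poly p (1 / x) * exp (- (c / x))) has_real_derivative h ?q x) (at x)"
        using 1 by (auto intro!: derivative_eq_intros DERIV_chain'[OF _ poly_DERIV]
          simp: h_def poly_monom field_simps power2_eq_square)
      then have "(h p has_real_derivative h ?q x) (at x)"
      proof (rule has_field_derivative_transform_within_open)
        show "open {0::real<..}" by simp
      qed (use 1 in \<open>auto simp: h_def\<close>)
      then show ?thesis by (simp add: has_real_derivative_iff_has_vector_derivative)
    next
      case 2
      have "((\<lambda>x. 0) has_real_derivative 0) (at x)" by simp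
      then have "(h p has_real_derivative 0) (at x)"
      proof (rule has_field_derivative_transform_within_open)
        show "open {..<(0::real)}" by simp
      qed (use 2 in \<open>auto simp: h_def\<close>)
      then show ?thesis using 2 by (simp add: has_real_derivative_iff_has_vector_derivative h_def)
    next
      case 3
      have "((\<lambda>y. (h p (0 + y) - h p 0) / y) \<longlongrightarrow> 0) (at 0)"
      proof (rule filterlim_split_at)
        have "\<forall>\<^sub>F y in at_left (0::real). (h p (0 + y) - h p 0) / y = 0"
          by (auto simp: h_def eventually_at_filter)
        then show "((\<lambda>y. (h p (0 + y) - h p 0) / y) \<longlongrightarrow> 0) (at_left 0)" by (rule tendsto_eventually)
        have "((\<lambda>y. poly (pCons 0 p) (inverse y) * exp (- (c * inverse y))) \<longlongrightarrow> 0) (at_right 0)"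
          by (rule filterlim_compose[OF poly_exp_tendsto_0[OF c] filterlim_inverse_at_top_right])
        moreover have "\<forall>\<^sub>F y in at_right (0::real). poly (pCons 0 p) (inverse y) * exp (- (c * inverse y)) = (h p (0 + y) - h p 0) / y"
          by (auto simp: h_def eventually_at_filter field_simps)
        ultimately show "((\<lambda>y. (h p (0 + y) - h p 0) / y) \<longlongrightarrow> 0) (at_right 0)"
          by (rule Lim_transform_eventually)
      qed
      then have "(h p has_real_derivative 0) (at 0)" by (simp add: DERIV_def)
      then show ?thesis using 3 by (simp add: has_real_derivative_iff_has_vector_derivative h_def)
    qed
  qed
  show ?thesis
  proof (rule smooth_coinduct[of _ "range h"])
    have "flat_exp c = h 1" by (auto simp: fun_eq_iff flat_exp_def h_def)
    then show "flat_exp c \<in> range h" by simp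
  qed (use deriv in blast)
qed

definition bump :: "real \<Rightarrow> real \<Rightarrow> real \<Rightarrow> real \<Rightarrow> real" where
  "bump c a b t = flat_exp c (t - a) * flat_exp c (b - t)"

lemma smooth_bump: assumes "c > 0" shows "smooth (bump c a b)"
proof -
  have "smooth (\<lambda>t. flat_exp c (1 * t + (- a)) * flat_exp c ((-1) * t + b))"
    by (intro smooth_mult smooth_affine smooth_flat_exp assms)
  moreover have "bump c a b = (\<lambda>t. flat_exp c (1 * t + (- a)) * flat_exp c ((-1) * t + b))"
    by (auto simp: bump_def fun_eq_iff)
  ultimately show ?thesis by simp
qed

lemma bump_outside: "t \<notin> {a<..<b} \<Longrightarrow> bump c a b t = 0"
  by (auto simp: bump_def flat_exp_def)

lemma bump_pos: "a < t \<Longrightarrow> t < b \<Longrightarrow> bump c a b t > 0"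
  by (auto simp: bump_def flat_exp_def)

lemma bump_bounds: "c > 0 \<Longrightarrow> 0 \<le> bump c a b t \<and> bump c a b t \<le> 1"
  unfolding bump_def by (intro conjI mult_nonneg_nonneg mult_le_one flat_exp_bounds)

text \<open>
  Letting the parameter tend to \<open>0\<close> flattens the bump to a plateau, so that test functions exhaust
  the indicator of an open interval.
\<close>

lemma bump_tendsto: "(\<lambda>n. bump (1 / real (Suc n)) a b t) \<longlonglongrightarrow> indicator {a<..<b} t"
proof -
  have "(\<lambda>n. flat_exp (1 / real (Suc n)) x) \<longlonglongrightarrow> (if x > 0 then 1 else 0)" for x
  proof (cases "x > 0")
    case True
    have "(\<lambda>n. exp (- (1 / real (Suc n) / x))) \<longlonglongrightarrow> exp (- (0 / x))"
      using True by (intro tendsto_intros LIMSEQ_Suc[OF lim_1_over_n]) auto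
    then show ?thesis using True by (simp add: flat_exp_def)
  qed (simp add: flat_exp_def)
  from tendsto_mult[OF this[of "t - a"] this[of "b - t"]]
  show ?thesis by (auto simp: bump_def indicator_def)
qed

lemma test_functionI:
  assumes "smooth \<phi>" "1 < a" "\<And>t. t \<notin> {a..b} \<Longrightarrow> \<phi> t = 0"
  shows "test_function \<phi>"
  unfolding test_function_def using assms by (intro conjI exI[of _ "{a..b}"]) auto

lemma test_functionE:
  assumes "test_function \<phi>"
  obtains a b where "1 < a" "a < b" "\<And>t. t \<notin> {a..b} \<Longrightarrow> \<phi> t = 0"
proof -
  obtain K where K: "compact K" "K \<subseteq> {1<..}" "\<And>t. t \<notin> K \<Longrightarrow> \<phi> t = 0"
    using assms unfolding test_function_def by blast
  show thesis
  proof (cases "K = {}")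
    case True
    then show ?thesis using K(3) by (intro that[of 2 3]) auto
  next
    case False
    obtain a where a: "a \<in> K" "\<And>t. t \<in> K \<Longrightarrow> a \<le> t" using compact_attains_inf[OF K(1) False] by blast
    obtain b where b: "b \<in> K" "\<And>t. t \<in> K \<Longrightarrow> t \<le> b" using compact_attains_sup[OF K(1) False] by blast
    have "t \<notin> K" if "t \<notin> {a..b + 1}" for t
      using that a(2)[of t] b(2)[of t] by auto
    then show ?thesis
      using a b K by (intro that[of a "b + 1"]) (auto intro!: K(3), fastforce+)
  qed
qed

lemma test_function_smooth: "test_function \<phi> \<Longrightarrow> smooth \<phi>"
  by (simp add: test_function_def)

lemma has_vector_derivative_0_outside:
  assumes "\<And>t. t \<notin> {a..b} \<Longrightarrow> \<phi> t = 0" "(\<phi> has_vector_derivative d) (at t)" "t \<notin> {a..b}"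
  shows "d = 0"
proof -
  have "((\<lambda>t. 0) has_vector_derivative 0) (at t)" by simp
  then have "(\<phi> has_vector_derivative 0) (at t)"
  proof (rule has_vector_derivative_transform_within_open)
    show "open (- {a..b})" by auto
  qed (use assms in auto)
  with assms(2) show "d = 0" by (rule vector_derivative_unique_at)
qed

lemma test_function_derivative:
  assumes "test_function \<phi>"
  obtains \<phi>' where "test_function \<phi>'" "\<And>t. (\<phi> has_vector_derivative \<phi>' t) (at t)"
proof -
  obtain \<phi>' where d: "smooth \<phi>'" "\<And>t. (\<phi> has_vector_derivative \<phi>' t) (at t)"
    using smooth_derivative[OF test_function_smooth[OF assms]] by blast
  obtain a b where ab: "1 < a" "a < b" "\<And>t. t \<notin> {a..b} \<Longrightarrow> \<phi> t = 0"
    using test_functionE[OF assms] by blast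
  have "test_function \<phi>'"
    using has_vector_derivative_0_outside[OF ab(3) d(2)] by (intro test_functionI[OF d(1) ab(1), of b])
  with d(2) show thesis using that by blast
qed

lemma test_function_add: "test_function \<phi> \<Longrightarrow> test_function \<psi> \<Longrightarrow> test_function (\<lambda>t. \<phi> t + \<psi> t)"
proof -
  assume p: "test_function \<phi>" "test_function \<psi>"
  obtain a b where ab: "1 < a" "a < b" "\<And>t. t \<notin> {a..b} \<Longrightarrow> \<phi> t = 0" using test_functionE[OF p(1)] by blast
  obtain c d where cd: "1 < c" "c < d" "\<And>t. t \<notin> {c..d} \<Longrightarrow> \<psi> t = 0" using test_functionE[OF p(2)] by blast
  show ?thesis
  proof (rule test_functionI[of _ "min a c" "max b d"])
    fix t assume "t \<notin> {min a c..max b d}"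
    then have "t \<notin> {a..b}" "t \<notin> {c..d}" by auto
    then show "\<phi> t + \<psi> t = 0" using ab(3) cd(3) by simp
  qed (use p ab cd in \<open>auto intro: smooth_add test_function_smooth\<close>)
qed

lemma test_function_bounded_linear:
  assumes "bounded_linear L" "test_function \<phi>" shows "test_function (\<lambda>t. L (\<phi> t))"
proof -
  obtain a b where ab: "1 < a" "a < b" "\<And>t. t \<notin> {a..b} \<Longrightarrow> \<phi> t = 0" using test_functionE[OF assms(2)] by blast
  show ?thesis
    by (rule test_functionI[of _ a b])
      (use assms ab linear_0[OF bounded_linear.linear[OF assms(1)]] in \<open>auto intro: smooth_bounded_linear test_function_smooth\<close>)
qed

lemma test_function_bump: "c > 0 \<Longrightarrow> 1 < a \<Longrightarrow> test_function (bump c a b)"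
  by (rule test_functionI[of _ a b]) (auto intro: smooth_bump bump_outside)

lemma halfline_integral:
  fixes f :: "real \<Rightarrow> 'v::euclidean_space"
  shows "(\<integral>t. f t \<partial>halfline) = (LINT t:{1<..}|lborel. f t)"
    and "integrable halfline f \<longleftrightarrow> set_integrable lborel {1<..} f"
  unfolding halfline_def set_lebesgue_integral_def set_integrable_def
  by (simp_all add: integral_restrict_space integrable_restrict_space)

lemma halfline_integral_compact:
  fixes f :: "real \<Rightarrow> 'v::euclidean_space"
  assumes "continuous_on {a..b} f" "1 < a" "\<And>t. t \<notin> {a..b} \<Longrightarrow> f t = 0"
  shows "integrable halfline f" "(\<integral>t. f t \<partial>halfline) = integral {a..b} f"
proof -
  have eq: "indicator {1<..} t *\<^sub>R f t = indicator {a..b} t *\<^sub>R f t" for t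
    using assms(2) assms(3)[of t] by (auto simp: indicator_def)
  have i: "set_integrable lborel {a..b} f" by (rule borel_integrable_atLeastAtMost') fact
  then show "integrable halfline f"
    unfolding halfline_integral set_integrable_def eq .
  show "(\<integral>t. f t \<partial>halfline) = integral {a..b} f"
    using set_borel_integral_eq_integral(2)[OF i] unfolding halfline_integral set_lebesgue_integral_def eq by simp
qed

lemma test_function_integrable: "test_function (\<psi> :: real \<Rightarrow> 'v::euclidean_space) \<Longrightarrow> integrable halfline \<psi>"
  by (rule test_functionE, assumption)
    (rule halfline_integral_compact(1)[OF smooth_imp_continuous[OF test_function_smooth]], auto)

lemma integral_derivative_test_function:
  fixes \<phi> :: "real \<Rightarrow> 'v::euclidean_space"
  assumes "test_function \<phi>" "\<And>t. (\<phi> has_vector_derivative \<phi>' t) (at t)" "continuous_on UNIV \<phi>'"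
  shows "(\<integral>t. \<phi>' t \<partial>halfline) = 0"
proof -
  obtain a b where ab: "1 < a" "a < b" "\<And>t. t \<notin> {a..b} \<Longrightarrow> \<phi> t = 0" using test_functionE[OF assms(1)] by blast
  define c where "c = (1 + a) / 2"
  have c: "1 < c" "c < a" using ab by (auto simp: c_def)
  have "(\<integral>t. \<phi>' t \<partial>halfline) = integral {c..b + 1} \<phi>'"
  proof (rule halfline_integral_compact(2))
    show "continuous_on {c..b + 1} \<phi>'" using assms(3) continuous_on_subset by blast
    show "\<phi>' t = 0" if "t \<notin> {c..b + 1}" for t
      using has_vector_derivative_0_outside[OF ab(3) assms(2)] that c by auto
  qed (rule c)
  also have "(\<phi>' has_integral (\<phi> (b + 1) - \<phi> c)) {c..b + 1}"
    using ab c assms(2) by (intro fundamental_theorem_of_calculus) (auto intro: has_vector_derivative_at_within)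
  then have "integral {c..b + 1} \<phi>' = \<phi> (b + 1) - \<phi> c" by (rule integral_unique)
  also have "\<dots> = 0" using ab(3)[of "b + 1"] ab(3)[of c] c by simp
  finally show ?thesis .
qed

lemma test_function_primitive:
  fixes \<psi> :: "real \<Rightarrow> real"
  assumes \<psi>: "test_function \<psi>" and 0: "(\<integral>t. \<psi> t \<partial>halfline) = 0"
  obtains \<phi> where "test_function \<phi>" "\<And>t. (\<phi> has_vector_derivative \<psi> t) (at t)"
proof -
  obtain a b where ab: "1 < a" "a < b" "\<And>t. t \<notin> {a..b} \<Longrightarrow> \<psi> t = 0" using test_functionE[OF \<psi>] by blast
  have cont: "continuous_on S \<psi>" for S by (intro smooth_imp_continuous test_function_smooth \<psi>)
  define \<phi> where "\<phi> t = integral {a - 1..t} \<psi>" for t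
  have left: "\<phi> t = 0" if "t < a" for t
    unfolding \<phi>_def using that ab(3) by (intro integral_unique has_integral_is_0) auto
  have d: "(\<phi> has_vector_derivative \<psi> t) (at t)" for t
  proof (cases "t < a")
    case True
    have "((\<lambda>t. 0) has_vector_derivative (0::real)) (at t)" by simp
    then have "(\<phi> has_vector_derivative 0) (at t)"
      by (rule has_vector_derivative_transform_within_open[of _ _ _ "{..<a}"]) (use True left in auto)
    then show ?thesis using ab(3)[of t] True by simp
  next
    case False
    have "(\<phi> has_vector_derivative \<psi> t) (at t within {a - 1..t + 1})"
      unfolding \<phi>_def using False by (intro integral_has_vector_derivative cont) auto
    moreover have "at t within {a - 1..t + 1} = at t"
      using False by (intro at_within_interior) auto
    ultimately show ?thesis by simp
  qed
  have right: "\<phi> t = 0" if "t > b" for t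
  proof -
    have "\<phi> t = integral {a - 1..a} \<psi> + integral {a..t} \<psi>"
      unfolding \<phi>_def using that ab
      by (intro Henstock_Kurzweil_Integration.integral_combine[symmetric] integrable_continuous_real cont) auto
    also have "integral {a..t} \<psi> = integral {a..b} \<psi> + integral {b..t} \<psi>"
      using that ab by (intro Henstock_Kurzweil_Integration.integral_combine[symmetric] integrable_continuous_real cont) auto
    also have "integral {a..b} \<psi> = 0"
      using halfline_integral_compact(2)[OF cont ab(1) ab(3)] 0 by simp
    also have "integral {a - 1..a} \<psi> = 0"
      by (intro integral_unique has_integral_spike_finite[of "{a}", OF _ _ has_integral_0]) (use ab in auto)
    also have "integral {b..t} \<psi> = 0"
      by (intro integral_unique has_integral_spike_finite[of "{b}", OF _ _ has_integral_0]) (use ab in auto)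
    finally show ?thesis by simp
  qed
  have "test_function \<phi>"
    by (rule test_functionI[of _ a b])
       (use ab left right in \<open>auto intro: smooth_primitive[OF test_function_smooth[OF \<psi>] d]\<close>)
  with d show thesis using that by blast
qed

text \<open>
  The lemma of du Bois-Reymond: subtracting from \<open>\<psi>\<close> the multiple of a fixed bump with the same
  integral leaves the derivative of a test function. It is phrased for functionals, as second
  derivatives require it for \<open>\<phi> \<mapsto> \<integral> w \<phi>'\<close>, which is not the pairing with a function.
\<close>

lemma functional_vanishing_on_derivatives:
  fixes L :: "(real \<Rightarrow> real) \<Rightarrow> real"
  assumes add: "\<And>\<phi> \<psi>. test_function \<phi> \<Longrightarrow> test_function \<psi> \<Longrightarrow> L (\<lambda>t. \<phi> t + \<psi> t) = L \<phi> + L \<psi>"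
    and scale: "\<And>\<phi> c. test_function \<phi> \<Longrightarrow> L (\<lambda>t. c * \<phi> t) = c * L \<phi>"
    and deriv: "\<And>\<phi> \<phi>'. test_function \<phi> \<Longrightarrow> test_function \<phi>' \<Longrightarrow>
      (\<And>t. (\<phi> has_vector_derivative \<phi>' t) (at t)) \<Longrightarrow> L \<phi>' = 0"
  obtains c where "\<And>\<psi>. test_function \<psi> \<Longrightarrow> L \<psi> = c * (\<integral>t. \<psi> t \<partial>halfline)"
proof -
  let ?\<rho> = "bump 1 2 3"
  let ?I = "\<integral>t. ?\<rho> t \<partial>halfline"
  have \<rho>: "test_function ?\<rho>" by (rule test_function_bump) auto
  have I: "?I > 0"
  proof -
    have cont: "continuous_on {2..3} ?\<rho>" by (intro smooth_imp_continuous smooth_bump) auto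
    have eq: "?I = integral {2..3} ?\<rho>"
      using cont bump_outside[of _ 2 3] by (intro halfline_integral_compact) auto
    have "?I \<ge> 0" using bump_bounds[of 1] by (intro Bochner_Integration.integral_nonneg) auto
    moreover have "?I \<noteq> 0"
    proof
      assume "?I = 0"
      then have "?\<rho> (5/2) = 0"
        using eq integral_eq_0_iff[OF cont] bump_bounds[of 1] by auto
      then show False using bump_pos[of 2 "5/2" 3 1] by simp
    qed
    ultimately show ?thesis by simp
  qed
  show thesis
  proof (rule that[of "L ?\<rho> / ?I"])
    fix \<psi> :: "real \<Rightarrow> real" assume \<psi>: "test_function \<psi>"
    let ?k = "- ((\<integral>t. \<psi> t \<partial>halfline) / ?I)"
    have k: "test_function (\<lambda>t. ?k * ?\<rho> t)"
      by (rule test_function_bounded_linear[OF bounded_linear_mult_right \<rho>])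
    let ?\<psi> = "\<lambda>t. \<psi> t + ?k * ?\<rho> t"
    have t: "test_function ?\<psi>" using \<psi> k by (rule test_function_add)
    have "(\<integral>t. ?\<psi> t \<partial>halfline) = (\<integral>t. \<psi> t \<partial>halfline) + ?k * ?I"
      using test_function_integrable[OF \<psi>] test_function_integrable[OF \<rho>] by simp
    then have "(\<integral>t. ?\<psi> t \<partial>halfline) = 0" using I by simp
    then obtain \<phi> where "test_function \<phi>" "\<And>t. (\<phi> has_vector_derivative ?\<psi> t) (at t)"
      using test_function_primitive[OF t] by blast
    then have "L ?\<psi> = 0" using deriv t by blast
    then show "L \<psi> = L ?\<rho> / ?I * (\<integral>t. \<psi> t \<partial>halfline)"
      using add[OF \<psi> k] scale[OF \<rho>, of ?k] by simp
  qed
qed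

text \<open>
  Open intervals generate the Borel sets, so the integral over every Borel set vanishes.
\<close>

lemma AE_eq_0_of_interval_integrals:
  fixes f :: "real \<Rightarrow> 'v::euclidean_space"
  assumes f: "integrable lborel f" and 0: "(\<integral>t. f t \<partial>lborel) = 0"
    and ivl: "\<And>a b. (LINT t:{a<..<b}|lborel. f t) = 0"
  shows "AE t in lborel. f t = 0"
proof (rule sigma_finite_measure.density_zero[OF sigma_finite_lborel f])
  note si = integrable_mult_indicator[OF _ f]
  fix S assume "S \<in> sets (lborel :: real measure)"
  then have S: "S \<in> sigma_sets UNIV (range (\<lambda>(a, b). {a<..<b::real}))"
    unfolding sets_lborel borel_eq_box box_real by simp
  have "Int_stable (range (\<lambda>(a, b). {a<..<b::real}))"
    unfolding Int_stable_def
  proof (intro ballI)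
    fix X Y :: "real set"
    assume "X \<in> range (\<lambda>(a, b). {a<..<b})" "Y \<in> range (\<lambda>(a, b). {a<..<b})"
    then obtain a b c d where "X = {a<..<b}" "Y = {c<..<d}" by auto
    then have "X \<inter> Y = (\<lambda>(a, b). {a<..<b}) (max a c, min b d)" by auto
    then show "X \<inter> Y \<in> range (\<lambda>(a, b). {a<..<b})" by (rule range_eqI)
  qed
  moreover have "range (\<lambda>(a, b). {a<..<b::real}) \<subseteq> Pow UNIV" by simp
  moreover note S
  ultimately show "(LINT t:S|lborel. f t) = 0"
  proof (induction rule: sigma_sets_induct_disjoint)
    case (basic A)
    then show ?case using ivl by auto
  next
    case empty
    show ?case by (simp add: set_lebesgue_integral_def)
  next
    case (compl A)
    then have A: "A \<in> sets lborel" unfolding sets_lborel borel_eq_box box_real by simp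
    have "(\<integral>t. f t \<partial>lborel) = (\<integral>t. indicator A t *\<^sub>R f t + indicator (UNIV - A) t *\<^sub>R f t \<partial>lborel)"
      by (intro Bochner_Integration.integral_cong) (auto simp: indicator_def)
    also have "\<dots> = (LINT t:A|lborel. f t) + (LINT t:UNIV - A|lborel. f t)"
      unfolding set_lebesgue_integral_def using A by (intro Bochner_Integration.integral_add si) auto
    finally show ?case using compl 0 by simp
  next
    case (union A)
    then have A: "\<And>i. A i \<in> sets lborel" unfolding sets_lborel borel_eq_box box_real by auto
    have "set_integrable lborel (\<Union>i. A i) f" unfolding set_integrable_def using A by (intro si) auto
    then have "(LINT t:(\<Union>i. A i)|lborel. f t) = (\<Sum>i. (LINT t:A i|lborel. f t))"
      using A union(1) by (intro lebesgue_integral_countable_add) (auto simp: disjoint_family_on_def)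
    then show ?case using union(3) by simp
  qed
qed

section \<open>Locally integrable functions and integration by parts\<close>

definition loc_integrable :: "(real \<Rightarrow> 'v::euclidean_space) \<Rightarrow> bool"
  where "loc_integrable f \<longleftrightarrow> (\<forall>b. set_integrable lborel {1..b} f)"

definition prim :: "(real \<Rightarrow> 'v::euclidean_space) \<Rightarrow> real \<Rightarrow> 'v"
  where "prim f t = (LINT s:{1..t}|lborel. f s)"

lemma loc_integrableD: "loc_integrable f \<Longrightarrow> 1 \<le> a \<Longrightarrow> set_integrable lborel {a..b} f"
  unfolding loc_integrable_def by (rule set_integrable_subset[of _ "{1..b}"]) auto

lemma loc_integrable_continuous:
  "(\<And>b. continuous_on {1..b} f) \<Longrightarrow> loc_integrable f"
  unfolding loc_integrable_def using borel_integrable_atLeastAtMost' by blast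

lemma prim_eq_integral: "loc_integrable f \<Longrightarrow> prim f t = integral {1..t} f"
  unfolding prim_def loc_integrable_def by (intro set_borel_integral_eq_integral(2)) blast

lemma continuous_on_prim: assumes "loc_integrable f" shows "continuous_on {1..b} (prim f)"
proof -
  have "f integrable_on {1..b}"
    using assms unfolding loc_integrable_def by (intro set_borel_integral_eq_integral(1)) blast
  from indefinite_integral_continuous_1[OF this] show ?thesis
    by (simp add: prim_eq_integral[OF assms] cong: continuous_on_cong)
qed

lemma loc_integrable_prim: "loc_integrable f \<Longrightarrow> loc_integrable (prim f)"
  by (rule loc_integrable_continuous) (rule continuous_on_prim)

lemma prim_has_vector_derivative:
  assumes "\<And>b. continuous_on {1..b} f" "1 \<le> t" "t \<le> b"
  shows "(prim f has_vector_derivative f t) (at t within {1..b})"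
  using integral_has_vector_derivative[OF assms(1), of t b] assms
  by (simp add: prim_eq_integral[OF loc_integrable_continuous[OF assms(1)], abs_def])

lemma set_integrable_bilinear:
  fixes H :: "'a::euclidean_space \<Rightarrow> 'b::euclidean_space \<Rightarrow> 'c::euclidean_space"
  assumes H: "bounded_bilinear H" and k: "continuous_on {a..b::real} k"
    and u: "set_integrable lborel {a..b} u"
  shows "set_integrable lborel {a..b} (\<lambda>t. H (k t) (u t))"
proof -
  obtain C where C: "C > 0" "\<And>x y. norm (H x y) \<le> norm x * norm y * C"
    using bounded_bilinear.pos_bounded[OF H] by metis
  have "bounded (k ` {a..b})" using k by (intro compact_imp_bounded compact_continuous_image) auto
  then obtain K where K: "\<forall>t\<in>{a..b}. norm (k t) \<le> K" unfolding bounded_iff by auto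
  have mk: "(\<lambda>t. indicator {a..b} t *\<^sub>R k t) \<in> borel_measurable lborel"
    using borel_measurable_continuous_on_indicator[OF _ k] by simp
  have iu: "integrable lborel (\<lambda>t. indicator {a..b} t *\<^sub>R u t)"
    using u unfolding set_integrable_def .
  have "continuous_on UNIV (\<lambda>x. H (fst x) (snd x))"
    by (intro bounded_bilinear.continuous_on[OF H] continuous_intros)
  from borel_measurable_continuous_Pair[OF mk borel_measurable_integrable[OF iu] this]
  have m: "(\<lambda>t. H (indicator {a..b} t *\<^sub>R k t) (indicator {a..b} t *\<^sub>R u t)) \<in> borel_measurable lborel" .
  have eq: "H (indicator {a..b} t *\<^sub>R k t) (indicator {a..b} t *\<^sub>R u t) = indicator {a..b} t *\<^sub>R H (k t) (u t)" for t
    by (auto simp: indicator_def bounded_bilinear.zero_left[OF H])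
  show ?thesis
    unfolding set_integrable_def
  proof (rule Bochner_Integration.integrable_bound)
    show "integrable lborel (\<lambda>t. (K * C) *\<^sub>R (indicator {a..b} t *\<^sub>R u t))"
      by (rule integrable_scaleR_right[OF iu])
    show "(\<lambda>t. indicator {a..b} t *\<^sub>R H (k t) (u t)) \<in> borel_measurable lborel" using m unfolding eq .
    show "AE t in lborel. norm (indicator {a..b} t *\<^sub>R H (k t) (u t)) \<le>
        norm ((K * C) *\<^sub>R (indicator {a..b} t *\<^sub>R u t))"
    proof (rule AE_I2)
      fix t
      show "norm (indicator {a..b} t *\<^sub>R H (k t) (u t)) \<le> norm ((K * C) *\<^sub>R (indicator {a..b} t *\<^sub>R u t))"
      proof (cases "t \<in> {a..b}")
        case True
        then have "norm (k t) \<le> \<bar>K\<bar>" using K by force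
        then have "norm (k t) * norm (u t) * C \<le> \<bar>K\<bar> * norm (u t) * C"
          using C(1) by (intro mult_right_mono) auto
        with C(2)[of "k t" "u t"] have "norm (H (k t) (u t)) \<le> \<bar>K\<bar> * norm (u t) * C" by linarith
        then show ?thesis using True C(1) by (simp add: abs_mult mult_ac)
      qed simp
    qed
  qed
qed

lemma set_integrable_inner_continuous:
  fixes g F :: "real \<Rightarrow> 'v::euclidean_space"
  assumes "loc_integrable g" "continuous_on {1..b} F"
  shows "set_integrable lborel {1..b} (\<lambda>r. g r \<bullet> F r)"
  using set_integrable_bilinear[OF bounded_bilinear_inner assms(2), of g] assms(1)
  by (simp add: loc_integrable_def inner_commute)

text \<open>
  Fubini on the triangle \<open>1 \<le> r \<le> t \<le> b\<close> for \<open>g r \<bullet> f t\<close>. A primitive of a locally integrable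
  function is differentiable only almost everywhere, so the fundamental theorem of calculus cannot
  be applied to the product \<open>prim g t \<bullet> F t\<close>.
\<close>

lemma prim_by_parts:
  fixes g F f :: "real \<Rightarrow> 'v::euclidean_space"
  assumes g: "loc_integrable g" and b: "1 \<le> b"
    and f: "continuous_on {1..b} f"
    and F: "\<And>t. 1 \<le> t \<Longrightarrow> t \<le> b \<Longrightarrow> (F has_vector_derivative f t) (at t within {1..b})"
  shows "(LINT r:{1..b}|lborel. g r \<bullet> F r) = prim g b \<bullet> F b - (LINT t:{1..b}|lborel. prim g t \<bullet> f t)"
proof -
  define g1 where "g1 r = indicator {1..b} r *\<^sub>R g r" for r
  define f1 where "f1 t = indicator {1..b} t *\<^sub>R f t" for t
  define H where "H r t = (if r \<le> t then g1 r \<bullet> f1 t else 0)" for r t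
  have ig: "integrable lborel g1"
    using g unfolding loc_integrable_def set_integrable_def g1_def by blast
  then have [measurable]: "g1 \<in> borel_measurable borel" by auto
  have if1: "integrable lborel f1"
    using borel_integrable_atLeastAtMost'[OF f] unfolding set_integrable_def f1_def .
  then have [measurable]: "f1 \<in> borel_measurable borel" by auto
  have Hle: "norm (H r t) \<le> norm (g1 r) * norm (f1 t)" for r t
    unfolding H_def using Cauchy_Schwarz_ineq2[of "g1 r" "f1 t"] by simp
  have iH: "integrable lborel (\<lambda>t. H r t)" for r
  proof (rule Bochner_Integration.integrable_bound)
    show "integrable lborel (\<lambda>t. norm (g1 r) * norm (f1 t))" using if1 by simp
    show "AE t in lborel. norm (H r t) \<le> norm (norm (g1 r) * norm (f1 t))" using Hle by simp
  qed (simp add: H_def[abs_def])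
  have "integrable (lborel \<Otimes>\<^sub>M lborel) (case_prod H)"
  proof (rule lborel_pair.Fubini_integrable)
    show "case_prod H \<in> borel_measurable (lborel \<Otimes>\<^sub>M lborel)" unfolding H_def by measurable
    show "AE r in lborel. integrable lborel (\<lambda>t. case_prod H (r, t))" using iH by simp
    show "integrable lborel (\<lambda>r. \<integral>t. norm (case_prod H (r, t)) \<partial>lborel)"
    proof (rule Bochner_Integration.integrable_bound)
      show "integrable lborel (\<lambda>r. norm (g1 r) * (\<integral>t. norm (f1 t) \<partial>lborel))" using ig by simp
      show "(\<lambda>r. \<integral>t. norm (case_prod H (r, t)) \<partial>lborel) \<in> borel_measurable lborel"
        unfolding H_def by measurable
      have "(\<integral>t. norm (H r t) \<partial>lborel) \<le> (\<integral>t. norm (g1 r) * norm (f1 t) \<partial>lborel)" for r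
        using Hle iH if1 by (intro integral_mono) auto
      then show "AE r in lborel. norm (\<integral>t. norm (case_prod H (r, t)) \<partial>lborel) \<le>
          norm (norm (g1 r) * (\<integral>t. norm (f1 t) \<partial>lborel))"
        by (intro AE_I2) (simp add: abs_of_nonneg)
    qed
  qed
  then have Fub: "(\<integral>t. (\<integral>r. H r t \<partial>lborel) \<partial>lborel) = (\<integral>r. (\<integral>t. H r t \<partial>lborel) \<partial>lborel)"
    by (rule lborel_pair.Fubini_integral)
  have 1: "(\<integral>r. H r t \<partial>lborel) = indicator {1..b} t *\<^sub>R (prim g t \<bullet> f t)" for t
  proof -
    have "(\<lambda>r. H r t) = (\<lambda>r. (indicator {1..t} r *\<^sub>R g r) \<bullet> f1 t)"
      by (auto simp: fun_eq_iff H_def g1_def f1_def indicator_def)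
    moreover have "integrable lborel (\<lambda>r. indicator {1..t} r *\<^sub>R g r)"
      using loc_integrableD[OF g order_refl, of t] unfolding set_integrable_def .
    ultimately have "(\<integral>r. H r t \<partial>lborel) = (\<integral>r. indicator {1..t} r *\<^sub>R g r \<partial>lborel) \<bullet> f1 t"
      by (simp only: integral_inner_left)
    then show ?thesis by (simp add: f1_def prim_def set_lebesgue_integral_def)
  qed
  have 2: "(\<integral>t. H r t \<partial>lborel) = indicator {1..b} r *\<^sub>R (g r \<bullet> F b - g r \<bullet> F r)" for r
  proof (cases "r \<in> {1..b}")
    case True
    have "(\<lambda>t. H r t) = (\<lambda>t. g1 r \<bullet> (indicator {r..b} t *\<^sub>R f t))"
      using True by (auto simp: fun_eq_iff H_def f1_def indicator_def)
    moreover have "set_integrable lborel {r..b} f"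
      by (rule set_integrable_subset[OF borel_integrable_atLeastAtMost'[OF f]]) (use True in auto)
    ultimately have "(\<integral>t. H r t \<partial>lborel) = g1 r \<bullet> (LINT t:{r..b}|lborel. f t)"
      unfolding set_integrable_def set_lebesgue_integral_def by (simp only: integral_inner_right)
    also have "(LINT t:{r..b}|lborel. f t) = integral {r..b} f"
      by (rule set_borel_integral_eq_integral(2)) fact
    also have "integral {r..b} f = F b - F r"
      using True by (intro integral_unique fundamental_theorem_of_calculus)
        (auto intro!: has_vector_derivative_within_subset[OF F])
    finally show ?thesis using True by (simp add: g1_def inner_diff_right)
  next
    case False
    then have "(\<lambda>t. H r t) = (\<lambda>_. 0)" by (auto simp: fun_eq_iff H_def g1_def)
    then show ?thesis using False by simp
  qed
  have cF: "continuous_on {1..b} F"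
    using F has_vector_derivative_continuous by (fastforce simp: continuous_on_eq_continuous_within)
  have iF: "set_integrable lborel {1..b} (\<lambda>r. g r \<bullet> F r)"
    by (rule set_integrable_inner_continuous[OF g cF])
  have iFb: "set_integrable lborel {1..b} (\<lambda>r. g r \<bullet> F b)"
    by (rule set_integrable_inner_continuous[OF g continuous_on_const])
  have "(LINT t:{1..b}|lborel. prim g t \<bullet> f t) = (LINT r:{1..b}|lborel. g r \<bullet> F b - g r \<bullet> F r)"
    using Fub unfolding 1 2 set_lebesgue_integral_def .
  also have "\<dots> = (LINT r:{1..b}|lborel. g r \<bullet> F b) - (LINT r:{1..b}|lborel. g r \<bullet> F r)"
    by (rule set_integral_diff(2)[OF iFb iF])
  also have "(LINT r:{1..b}|lborel. g r \<bullet> F b) = prim g b \<bullet> F b"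
    using ig unfolding prim_def set_lebesgue_integral_def g1_def by (simp flip: inner_scaleR_left)
  finally show ?thesis by simp
qed

lemma AE_halfline_iff: "(AE t in halfline. P t) \<longleftrightarrow> (AE t in lborel. t > 1 \<longrightarrow> P t)"
  unfolding halfline_def by (subst AE_restrict_space_iff) auto

section \<open>Weak derivatives\<close>

lemma test_function_bounded:
  fixes \<psi> :: "real \<Rightarrow> real"
  assumes "test_function \<psi>"
  obtains b K where "1 < b" "\<And>t. \<bar>\<psi> t\<bar> \<le> K * indicator {1..b} t" "K \<ge> 0" "\<And>t. t \<ge> b \<Longrightarrow> \<psi> t = 0"
proof -
  obtain a b where ab: "1 < a" "a < b" "\<And>t. t \<notin> {a..b} \<Longrightarrow> \<psi> t = 0" using test_functionE[OF assms] by blast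
  have "bounded (\<psi> ` {a..b})"
    by (intro compact_imp_bounded compact_continuous_image smooth_imp_continuous test_function_smooth assms) auto
  then obtain K where K: "\<forall>t\<in>{a..b}. \<bar>\<psi> t\<bar> \<le> K" unfolding bounded_iff by auto
  have "\<bar>\<psi> t\<bar> \<le> \<bar>K\<bar> * indicator {1..b+1} t" for t
  proof (cases "t \<in> {a..b}")
    case True
    then have "\<bar>\<psi> t\<bar> \<le> K" using K by blast
    then show ?thesis using True ab by (simp add: indicator_def)
  qed (use ab(3) in \<open>auto simp: indicator_def\<close>)
  then show thesis using ab that[of "b + 1" "\<bar>K\<bar>"] by auto
qed

lemma pairing:
  fixes h \<psi> :: "real \<Rightarrow> real"
  assumes h: "loc_integrable h" and \<psi>: "test_function \<psi>"
  shows pairing_integrable: "integrable halfline (\<lambda>t. h t * \<psi> t)"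
    and pairing_Icc: "\<exists>B. \<forall>b\<ge>B. (\<integral>t. h t * \<psi> t \<partial>halfline) = (LINT t:{1..b}|lborel. h t * \<psi> t)"
proof -
  obtain b K where b: "1 < b" "\<And>t. \<bar>\<psi> t\<bar> \<le> K * indicator {1..b} t" "K \<ge> 0" "\<And>t. t \<ge> b \<Longrightarrow> \<psi> t = 0"
    using test_function_bounded[OF \<psi>] by blast
  have z: "\<psi> t = 0" if "t \<le> 1" for t
    using \<psi> that unfolding test_function_def by (metis greaterThan_iff linorder_not_less subsetD)
  have m: "\<psi> \<in> borel_measurable borel"
    by (intro borel_measurable_continuous_onI smooth_imp_continuous test_function_smooth \<psi>)
  have mh: "(\<lambda>t. indicator {1..b} t *\<^sub>R h t) \<in> borel_measurable lborel"
    using h unfolding loc_integrable_def set_integrable_def by blast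
  have eq: "indicator {1<..} t *\<^sub>R (h t * \<psi> t) = indicator {1..c} t *\<^sub>R (h t * \<psi> t)" if "c \<ge> b" for c t
    using z[of t] b(4)[of t] that by (cases "t \<le> 1"; cases "t \<ge> b") (auto simp: indicator_def)
  have "integrable lborel (\<lambda>t. indicator {1<..} t *\<^sub>R (h t * \<psi> t))"
  proof (rule Bochner_Integration.integrable_bound)
    show "integrable lborel (\<lambda>t. K * (indicator {1..b} t *\<^sub>R h t))"
      using h unfolding loc_integrable_def set_integrable_def by auto
    have "(\<lambda>t. (indicator {1..b} t *\<^sub>R h t) * \<psi> t) \<in> borel_measurable lborel" using m mh by measurable
    then show "(\<lambda>t. indicator {1<..} t *\<^sub>R (h t * \<psi> t)) \<in> borel_measurable lborel"
      unfolding eq[OF order_refl] by (simp add: mult.assoc)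
    show "AE t in lborel. norm (indicator {1<..} t *\<^sub>R (h t * \<psi> t)) \<le> norm (K * (indicator {1..b} t *\<^sub>R h t))"
    proof (rule AE_I2)
      fix t
      have "\<bar>h t\<bar> * \<bar>\<psi> t\<bar> \<le> \<bar>h t\<bar> * (K * indicator {1..b} t)" by (intro mult_left_mono b) auto
      then show "norm (indicator {1<..} t *\<^sub>R (h t * \<psi> t)) \<le> norm (K * (indicator {1..b} t *\<^sub>R h t))"
        unfolding eq[OF order_refl] using b(3) by (auto simp: indicator_def abs_mult mult.commute)
    qed
  qed
  then show "integrable halfline (\<lambda>t. h t * \<psi> t)" unfolding halfline_integral set_integrable_def .
  show "\<exists>B. \<forall>b\<ge>B. (\<integral>t. h t * \<psi> t \<partial>halfline) = (LINT t:{1..b}|lborel. h t * \<psi> t)"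
    unfolding halfline_integral set_lebesgue_integral_def
    by (intro exI[of _ b] allI impI Bochner_Integration.integral_cong refl) (rule eq)
qed

lemma loc_integrable_add: "loc_integrable f \<Longrightarrow> loc_integrable g \<Longrightarrow> loc_integrable (\<lambda>t. f t + g t)"
  unfolding loc_integrable_def by (auto intro: set_integral_add)

lemma loc_integrable_diff: "loc_integrable f \<Longrightarrow> loc_integrable g \<Longrightarrow> loc_integrable (\<lambda>t. f t - g t)"
  unfolding loc_integrable_def by (auto intro: set_integral_diff)

lemma loc_integrable_inner: "loc_integrable f \<Longrightarrow> loc_integrable (\<lambda>t. f t \<bullet> e)"
  unfolding loc_integrable_def set_integrable_def by (simp flip: inner_scaleR_left)

lemma AE_eq_0_of_pairing:
  fixes h :: "real \<Rightarrow> real"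
  assumes h: "loc_integrable h"
    and 0: "\<And>\<psi>. test_function \<psi> \<Longrightarrow> (\<integral>t. h t * \<psi> t \<partial>halfline) = 0"
  shows "AE t in halfline. h t = 0"
proof -
  have ivl: "(LINT t:{a<..<b}|lborel. h t) = 0" if a: "1 < a" for a b
  proof -
    let ?\<psi> = "\<lambda>n. bump (1 / real (Suc n)) a b"
    have si: "set_integrable lborel {a<..<b} h"
      using loc_integrableD[OF h, of a b] a by (auto intro: set_integrable_subset)
    have \<psi>: "test_function (?\<psi> n)" for n using a by (intro test_function_bump) auto
    have "(\<lambda>n. \<integral>t. indicator {1<..} t *\<^sub>R (h t * ?\<psi> n t) \<partial>lborel) \<longlonglongrightarrow> (\<integral>t. indicator {a<..<b} t *\<^sub>R h t \<partial>lborel)"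
    proof (rule integral_dominated_convergence[where w="\<lambda>t. norm (indicator {a<..<b} t *\<^sub>R h t)"])
      show "(\<lambda>t. indicator {a<..<b} t *\<^sub>R h t) \<in> borel_measurable lborel"
        using si unfolding set_integrable_def by blast
      show "(\<lambda>t. indicator {1<..} t *\<^sub>R (h t * ?\<psi> n t)) \<in> borel_measurable lborel" for n
        using pairing_integrable[OF h \<psi>, of n] unfolding halfline_integral set_integrable_def by blast
      show "integrable lborel (\<lambda>t. norm (indicator {a<..<b} t *\<^sub>R h t))"
        using si unfolding set_integrable_def by (rule integrable_norm)
      show "AE t in lborel. (\<lambda>n. indicator {1<..} t *\<^sub>R (h t * ?\<psi> n t)) \<longlonglongrightarrow> indicator {a<..<b} t *\<^sub>R h t"
      proof (rule AE_I2)
        fix t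
        have "(\<lambda>n. indicator {1<..} t *\<^sub>R (h t * ?\<psi> n t)) \<longlonglongrightarrow> indicator {1<..} t *\<^sub>R (h t * indicator {a<..<b} t)"
          by (intro tendsto_intros bump_tendsto)
        moreover have "indicator {1<..} t *\<^sub>R (h t * indicator {a<..<b} t) = indicator {a<..<b} t *\<^sub>R h t"
          using a by (auto simp: indicator_def)
        ultimately show "(\<lambda>n. indicator {1<..} t *\<^sub>R (h t * ?\<psi> n t)) \<longlonglongrightarrow> indicator {a<..<b} t *\<^sub>R h t" by metis
      qed
      show "AE t in lborel. norm (indicator {1<..} t *\<^sub>R (h t * ?\<psi> n t)) \<le> norm (indicator {a<..<b} t *\<^sub>R h t)" for n
      proof (rule AE_I2)
        fix t
        have "\<bar>h t * ?\<psi> n t\<bar> \<le> \<bar>h t\<bar>"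
          using bump_bounds[of "1 / real (Suc n)" a b t] by (auto simp: abs_mult intro!: mult_left_le)
        then show "norm (indicator {1<..} t *\<^sub>R (h t * ?\<psi> n t)) \<le> norm (indicator {a<..<b} t *\<^sub>R h t)"
          using bump_outside[of t a b "1 / real (Suc n)"] a by (cases "t \<in> {a<..<b}") auto
      qed
    qed
    moreover have "(\<integral>t. indicator {1<..} t *\<^sub>R (h t * ?\<psi> n t) \<partial>lborel) = 0" for n
      using 0[OF \<psi>[of n]] unfolding halfline_integral set_lebesgue_integral_def .
    ultimately have "(\<lambda>n. 0) \<longlonglongrightarrow> (\<integral>t. indicator {a<..<b} t *\<^sub>R h t \<partial>lborel)" by (simp only:)
    then have "(\<integral>t. indicator {a<..<b} t *\<^sub>R h t \<partial>lborel) = 0" by (rule LIMSEQ_unique[OF _ tendsto_const])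
    then show ?thesis unfolding set_lebesgue_integral_def .
  qed
  have AEn: "AE t in lborel. indicator {1 + 1 / real (Suc n)<..<real n} t *\<^sub>R h t = 0" for n
  proof (rule AE_eq_0_of_interval_integrals)
    let ?c = "1 + 1 / real (Suc n)"
    have c: "?c > 1" by simp
    have "set_integrable lborel {?c<..<real n} h"
      using loc_integrableD[OF h, of ?c "real n"] c by (auto intro: set_integrable_subset)
    then show "integrable lborel (\<lambda>t. indicator {?c<..<real n} t *\<^sub>R h t)" unfolding set_integrable_def .
    show "(\<integral>t. indicator {?c<..<real n} t *\<^sub>R h t \<partial>lborel) = 0"
      using ivl[OF c] unfolding set_lebesgue_integral_def .
    fix a b :: real
    have "(LINT t:{a<..<b}|lborel. indicator {?c<..<real n} t *\<^sub>R h t) = (LINT t:{max a ?c<..<min b (real n)}|lborel. h t)"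
      unfolding set_lebesgue_integral_def by (intro Bochner_Integration.integral_cong) (auto simp: indicator_def)
    also have "\<dots> = 0" by (rule ivl) (use c in linarith)
    finally show "(LINT t:{a<..<b}|lborel. indicator {?c<..<real n} t *\<^sub>R h t) = 0" .
  qed
  have "AE t in lborel. \<forall>n. indicator {1 + 1 / real (Suc n)<..<real n} t *\<^sub>R h t = 0"
    unfolding AE_all_countable using AEn by (intro allI)
  then show ?thesis
    unfolding AE_halfline_iff
  proof eventually_elim
    fix t assume all: "\<forall>n. indicator {1 + 1 / real (Suc n)<..<real n} t *\<^sub>R h t = 0"
    show "t > 1 \<longrightarrow> h t = 0"
    proof
      assume t: "t > 1"
      obtain m where m: "t < real m" using reals_Archimedean2 by blast
      obtain k where k: "1 / real (Suc k) < t - 1" using nat_approx_posE[of "t - 1"] t by auto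
      let ?n = "max m k"
      have "1 / real (Suc ?n) \<le> 1 / real (Suc k)" by (simp add: field_simps)
      then have "t \<in> {1 + 1 / real (Suc ?n)<..<real ?n}" using m k by auto
      then show "h t = 0" using all[rule_format, of ?n] by (simp add: indicator_def)
    qed
  qed
qed

text \<open>
  The functional \<open>\<phi> \<mapsto> \<integral> w \<phi>'\<close> vanishes on derivatives, so it equals \<open>c \<integral> \<phi> = - c \<integral> t \<phi>'\<close> for some
  \<open>c\<close>. Therefore pairing with \<open>w + c t\<close> vanishes on derivatives in turn, and \<open>w + c t\<close> is constant.
\<close>

lemma AE_affine_of_pairing:
  fixes w :: "real \<Rightarrow> real"
  assumes w: "loc_integrable w"
    and 0: "\<And>\<phi> \<phi>' \<phi>''. test_function \<phi> \<Longrightarrow> test_function \<phi>' \<Longrightarrow> test_function \<phi>'' \<Longrightarrow>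
      (\<And>t. (\<phi> has_vector_derivative \<phi>' t) (at t)) \<Longrightarrow> (\<And>t. (\<phi>' has_vector_derivative \<phi>'' t) (at t)) \<Longrightarrow>
      (\<integral>t. w t * \<phi>'' t \<partial>halfline) = 0"
  obtains \<alpha> \<beta> where "AE t in halfline. w t = \<alpha> + \<beta> * t"
proof -
  define d where "d \<phi> = (\<lambda>t. vector_derivative \<phi> (at t))" for \<phi> :: "real \<Rightarrow> real"
  have d: "d \<phi> = \<phi>'" if "\<And>t. (\<phi> has_vector_derivative \<phi>' t) (at t)" for \<phi> \<phi>'
    unfolding d_def using that by (auto simp: fun_eq_iff intro: vector_derivative_at)
  have dt: "test_function (d \<phi>)" "(\<phi> has_vector_derivative d \<phi> t) (at t)" if "test_function \<phi>" for \<phi> t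
    using test_function_derivative[OF that] d by metis+
  obtain c where c: "\<And>\<psi>. test_function \<psi> \<Longrightarrow> (\<integral>t. w t * d \<psi> t \<partial>halfline) = c * (\<integral>t. \<psi> t \<partial>halfline)"
  proof (rule functional_vanishing_on_derivatives[of "\<lambda>\<phi>. \<integral>t. w t * d \<phi> t \<partial>halfline"])
    fix \<phi> \<psi> :: "real \<Rightarrow> real" assume p: "test_function \<phi>" "test_function \<psi>"
    have "d (\<lambda>t. \<phi> t + \<psi> t) = (\<lambda>t. d \<phi> t + d \<psi> t)"
      by (intro d has_vector_derivative_add dt p)
    then show "(\<integral>t. w t * d (\<lambda>t. \<phi> t + \<psi> t) t \<partial>halfline) = (\<integral>t. w t * d \<phi> t \<partial>halfline) + (\<integral>t. w t * d \<psi> t \<partial>halfline)"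
      using pairing_integrable[OF w dt(1)[OF p(1)]] pairing_integrable[OF w dt(1)[OF p(2)]]
      by (simp add: distrib_left)
  next
    fix \<phi> :: "real \<Rightarrow> real" and k :: real assume p: "test_function \<phi>"
    have "d (\<lambda>t. k * \<phi> t) = (\<lambda>t. k * d \<phi> t)"
      using dt(2)[OF p] by (intro d has_vector_derivative_mult_right)
    then show "(\<integral>t. w t * d (\<lambda>t. k * \<phi> t) t \<partial>halfline) = k * (\<integral>t. w t * d \<phi> t \<partial>halfline)"
      by (simp add: mult.left_commute)
  next
    fix \<phi> \<phi>' :: "real \<Rightarrow> real" assume p: "test_function \<phi>" "test_function \<phi>'" "\<And>t. (\<phi> has_vector_derivative \<phi>' t) (at t)"
    show "(\<integral>t. w t * d \<phi>' t \<partial>halfline) = 0" by (rule 0[OF p(1,2) dt(1)[OF p(2)] p(3) dt(2)[OF p(2)]])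
  qed blast
  have lt: "loc_integrable (\<lambda>t::real. k * t + l)" for k l
    by (intro loc_integrable_continuous continuous_intros)
  have wc: "loc_integrable (\<lambda>t. w t + c * t)" using loc_integrable_add[OF w lt[of c 0]] by simp
  obtain e where e: "\<And>\<psi>. test_function \<psi> \<Longrightarrow> (\<integral>t. (w t + c * t) * \<psi> t \<partial>halfline) = e * (\<integral>t. \<psi> t \<partial>halfline)"
  proof (rule functional_vanishing_on_derivatives[of "\<lambda>\<psi>. \<integral>t. (w t + c * t) * \<psi> t \<partial>halfline"])
    fix \<phi> \<psi> :: "real \<Rightarrow> real" assume p: "test_function \<phi>" "test_function \<psi>"
    show "(\<integral>t. (w t + c * t) * (\<phi> t + \<psi> t) \<partial>halfline) = (\<integral>t. (w t + c * t) * \<phi> t \<partial>halfline) + (\<integral>t. (w t + c * t) * \<psi> t \<partial>halfline)"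
      using Bochner_Integration.integral_add[OF pairing_integrable[OF wc p(1)] pairing_integrable[OF wc p(2)]]
      by (simp only: distrib_left)
  next
    fix \<phi> :: "real \<Rightarrow> real" and k :: real
    show "(\<integral>t. (w t + c * t) * (k * \<phi> t) \<partial>halfline) = k * (\<integral>t. (w t + c * t) * \<phi> t \<partial>halfline)"
      by (simp only: mult.left_commute integral_mult_right_zero)
  next
    fix \<phi> \<phi>' :: "real \<Rightarrow> real"
    assume p: "test_function \<phi>" "test_function \<phi>'" "\<And>t. (\<phi> has_vector_derivative \<phi>' t) (at t)"
    obtain a b where ab: "1 < a" "a < b" "\<And>t. t \<notin> {a..b} \<Longrightarrow> \<phi> t = 0" using test_functionE[OF p(1)] by blast
    have sm: "smooth (\<lambda>t::real. t)"
    proof (rule smooth_primitive)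
      have "(\<lambda>_::real. 1::real) \<in> {\<lambda>_. 1, \<lambda>_. 0}" by simp
      then show "smooth (\<lambda>_::real. 1::real)"
        by (rule smooth_coinduct) (auto intro!: bexI[of _ "\<lambda>_. 0"])
      show "((\<lambda>t::real. t) has_vector_derivative 1) (at t)" for t by (rule has_vector_derivative_id)
    qed
    have t: "test_function (\<lambda>t. t * \<phi> t)"
      by (rule test_functionI[of _ a b]) (use ab p in \<open>auto intro: smooth_mult sm test_function_smooth\<close>)
    have dd: "((\<lambda>t. t * \<phi> t) has_vector_derivative (t * \<phi>' t + 1 * \<phi> t)) (at t)" for t
      by (intro has_vector_derivative_mult has_vector_derivative_id p(3))
    have "(\<integral>t. t * \<phi>' t + 1 * \<phi> t \<partial>halfline) = 0"
      by (rule integral_derivative_test_function[OF t dd])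
        (intro continuous_intros smooth_imp_continuous test_function_smooth p)
    moreover have i: "integrable halfline (\<lambda>t. t * \<phi>' t)" "integrable halfline \<phi>"
      using pairing_integrable[OF lt[of 1 0] p(2)] test_function_integrable[OF p(1)] by simp_all
    ultimately have "(\<integral>t. t * \<phi>' t \<partial>halfline) = - (\<integral>t. \<phi> t \<partial>halfline)" by simp
    moreover have "(\<integral>t. (w t + c * t) * \<phi>' t \<partial>halfline) = (\<integral>t. w t * \<phi>' t \<partial>halfline) + c * (\<integral>t. t * \<phi>' t \<partial>halfline)"
      using i pairing_integrable[OF w p(2)] by (simp add: distrib_right mult.assoc)
    moreover have "(\<integral>t. w t * \<phi>' t \<partial>halfline) = c * (\<integral>t. \<phi> t \<partial>halfline)"
      using c[OF p(1)] d[OF p(3)] by simp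
    ultimately show "(\<integral>t. (w t + c * t) * \<phi>' t \<partial>halfline) = 0" by simp
  qed blast
  have we: "loc_integrable (\<lambda>t. (w t + c * t) - e)" using loc_integrable_diff[OF wc lt[of 0 e]] by simp
  have "AE t in halfline. (w t + c * t) - e = 0"
  proof (rule AE_eq_0_of_pairing[OF we])
    fix \<psi> :: "real \<Rightarrow> real" assume p: "test_function \<psi>"
    have "(\<integral>t. (w t + c * t - e) * \<psi> t \<partial>halfline) = (\<integral>t. (w t + c * t) * \<psi> t \<partial>halfline) - e * (\<integral>t. \<psi> t \<partial>halfline)"
      using pairing_integrable[OF wc p] test_function_integrable[OF p]
      by (simp only: left_diff_distrib Bochner_Integration.integral_diff integral_mult_right_zero integrable_mult_right)
    then show "(\<integral>t. (w t + c * t - e) * \<psi> t \<partial>halfline) = 0" using e[OF p] by simp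
  qed
  then have "AE t in halfline. w t = e + (- c) * t" by eventually_elim simp
  then show thesis by (rule that)
qed

lemma prim_prim_pairing:
  fixes g :: "real \<Rightarrow> real"
  assumes g: "loc_integrable g"
    and \<phi>: "test_function \<phi>" "test_function \<phi>'" "test_function \<phi>''"
      "\<And>t. (\<phi> has_vector_derivative \<phi>' t) (at t)" "\<And>t. (\<phi>' has_vector_derivative \<phi>'' t) (at t)"
  shows "(\<integral>t. prim (prim g) t * \<phi>'' t \<partial>halfline) = (\<integral>t. g t * \<phi> t \<partial>halfline)"
proof -
  note lp = loc_integrable_prim[OF g] loc_integrable_prim[OF loc_integrable_prim[OF g]]
  obtain B1 where B1: "\<forall>b\<ge>B1. (\<integral>t. prim (prim g) t * \<phi>'' t \<partial>halfline) = (LINT t:{1..b}|lborel. prim (prim g) t * \<phi>'' t)"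
    using pairing_Icc[OF lp(2) \<phi>(3)] by blast
  obtain B2 where B2: "\<forall>b\<ge>B2. (\<integral>t. g t * \<phi> t \<partial>halfline) = (LINT t:{1..b}|lborel. g t * \<phi> t)"
    using pairing_Icc[OF g \<phi>(1)] by blast
  obtain b1 where b1: "\<And>t. t \<ge> b1 \<Longrightarrow> \<phi> t = 0" using test_function_bounded[OF \<phi>(1)] by metis
  obtain b2 where b2: "\<And>t. t \<ge> b2 \<Longrightarrow> \<phi>' t = 0" using test_function_bounded[OF \<phi>(2)] by metis
  define b where "b = Max {1, B1, B2, b1, b2}"
  have b: "1 \<le> b" "B1 \<le> b" "B2 \<le> b" "b1 \<le> b" "b2 \<le> b" unfolding b_def by auto
  have c: "continuous_on S \<phi>'" "continuous_on S \<phi>''" for S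
    using \<phi> by (auto intro: smooth_imp_continuous test_function_smooth)
  have "(LINT r:{1..b}|lborel. g r * \<phi> r) = - (LINT t:{1..b}|lborel. prim g t * \<phi>' t)"
    using prim_by_parts[OF g b(1) c(1), of \<phi>] \<phi>(4) b1[OF b(4)] by (simp add: has_vector_derivative_at_within)
  moreover have "(LINT r:{1..b}|lborel. prim g r * \<phi>' r) = - (LINT t:{1..b}|lborel. prim (prim g) t * \<phi>'' t)"
    using prim_by_parts[OF lp(1) b(1) c(2), of \<phi>'] \<phi>(5) b2[OF b(5)] by (simp add: has_vector_derivative_at_within)
  ultimately show ?thesis using B1 B2 b by simp
qed

text \<open>
  The double primitive of \<open>g\<close> solves the same weak equation as \<open>u\<close>, so the components of the
  difference have vanishing weak second derivative.
\<close>

theorem weak_regularity: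
  fixes u g :: "real \<Rightarrow> 'v::euclidean_space"
  assumes u: "loc_integrable u" and g: "loc_integrable g"
    and weak: "\<And>\<phi> \<phi>' \<phi>'' e. e \<in> Basis \<Longrightarrow> test_function \<phi> \<Longrightarrow> test_function \<phi>' \<Longrightarrow> test_function \<phi>'' \<Longrightarrow>
      (\<And>t. (\<phi> has_vector_derivative \<phi>' t) (at t)) \<Longrightarrow> (\<And>t. (\<phi>' has_vector_derivative \<phi>'' t) (at t)) \<Longrightarrow>
      (\<integral>t. (u t \<bullet> e) * \<phi>'' t \<partial>halfline) = (\<integral>t. (g t \<bullet> e) * \<phi> t \<partial>halfline)"
  obtains \<alpha> \<beta> where "AE t in halfline. u t = \<alpha> + t *\<^sub>R \<beta> + prim (prim g) t"
proof -
  have prim_inner: "prim f t \<bullet> e = prim (\<lambda>t. f t \<bullet> e) t" if "loc_integrable f" for f :: "real \<Rightarrow> 'v" and t e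
    using that unfolding prim_def loc_integrable_def set_integrable_def set_lebesgue_integral_def
    by (simp flip: inner_scaleR_left)
  have pp: "prim (prim g) t \<bullet> e = prim (prim (\<lambda>t. g t \<bullet> e)) t" for t e
    using prim_inner[OF loc_integrable_prim[OF g]] prim_inner[OF g] by simp
  have "\<exists>\<alpha> \<beta>. AE t in halfline. u t \<bullet> e - prim (prim (\<lambda>t. g t \<bullet> e)) t = \<alpha> + \<beta> * t" if e: "e \<in> Basis" for e
  proof -
    note lg = loc_integrable_inner[OF g, of e] 
    note lpp = loc_integrable_prim[OF loc_integrable_prim[OF lg]]
    have w: "loc_integrable (\<lambda>t. u t \<bullet> e - prim (prim (\<lambda>t. g t \<bullet> e)) t)"
      by (intro loc_integrable_diff loc_integrable_inner u lpp)
    show ?thesis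
    proof (rule AE_affine_of_pairing[OF w])
      fix \<phi> \<phi>' \<phi>'' :: "real \<Rightarrow> real"
      assume p: "test_function \<phi>" "test_function \<phi>'" "test_function \<phi>''"
        "\<And>t. (\<phi> has_vector_derivative \<phi>' t) (at t)" "\<And>t. (\<phi>' has_vector_derivative \<phi>'' t) (at t)"
      show "(\<integral>t. (u t \<bullet> e - prim (prim (\<lambda>t. g t \<bullet> e)) t) * \<phi>'' t \<partial>halfline) = 0"
        using Bochner_Integration.integral_diff[OF pairing_integrable[OF loc_integrable_inner[OF u, of e] p(3)] pairing_integrable[OF lpp p(3)]]
          weak[OF e p] prim_prim_pairing[OF lg p]
        by (simp add: left_diff_distrib)
    qed blast
  qed
  then obtain \<alpha> \<beta> where ab: "\<And>e. e \<in> Basis \<Longrightarrow> AE t in halfline. u t \<bullet> e - prim (prim (\<lambda>t. g t \<bullet> e)) t = \<alpha> e + \<beta> e * t"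
    by metis
  have "AE t in halfline. \<forall>e\<in>Basis. u t \<bullet> e - prim (prim (\<lambda>t. g t \<bullet> e)) t = \<alpha> e + \<beta> e * t"
    using ab by (intro AE_finite_allI) auto
  then have "AE t in halfline. u t = (\<Sum>e\<in>Basis. \<alpha> e *\<^sub>R e) + t *\<^sub>R (\<Sum>e\<in>Basis. \<beta> e *\<^sub>R e) + prim (prim g) t"
  proof eventually_elim
    fix t assume a: "\<forall>e\<in>Basis. u t \<bullet> e - prim (prim (\<lambda>t. g t \<bullet> e)) t = \<alpha> e + \<beta> e * t"
    show "u t = (\<Sum>e\<in>Basis. \<alpha> e *\<^sub>R e) + t *\<^sub>R (\<Sum>e\<in>Basis. \<beta> e *\<^sub>R e) + prim (prim g) t"
    proof (rule euclidean_eqI)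
      fix e :: 'v assume e: "e \<in> Basis"
      have "(\<Sum>e\<in>Basis. k e *\<^sub>R e) \<bullet> e = k e" for k using e by simp
      then show "u t \<bullet> e = ((\<Sum>e\<in>Basis. \<alpha> e *\<^sub>R e) + t *\<^sub>R (\<Sum>e\<in>Basis. \<beta> e *\<^sub>R e) + prim (prim g) t) \<bullet> e"
        using a e by (simp add: inner_add_left pp algebra_simps)
    qed
  qed
  then show thesis by (rule that)
qed

section \<open>Rayleigh quotients of symmetric matrices\<close>

lemma bounded_bilinear_matrix_vector:
  "bounded_bilinear ((*v) :: real^'n^'m \<Rightarrow> real^'n \<Rightarrow> real^'m)"
  unfolding bilinear_conv_bounded_bilinear[symmetric] bilinear_def
  by (auto intro!: linearI simp: matrix_vector_mult_add_rdistrib matrix_vector_right_distrib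
      scaleR_matrix_vector_assoc matrix_vector_mult_scaleR)

lemmas continuous_on_matrix_vector [continuous_intros] =
  bounded_bilinear.continuous_on[OF bounded_bilinear_matrix_vector]

lemma symmetric_matrix_inner:
  fixes M :: "real^'n^'n" assumes "transpose M = M"
  shows "(M *v x) \<bullet> y = x \<bullet> (M *v y)"
  using dot_lmul_matrix[of x M y] transpose_matrix_vector[of M x] assms by simp

lemma nonneg_quadratic_imp_linear_term_le_0:
  fixes a c :: real
  assumes "\<And>s. 0 \<le> 2 * s * a + s\<^sup>2 * c" shows "a \<le> 0"
proof (rule ccontr)
  assume "\<not> a \<le> 0"
  define k where "k = \<bar>c\<bar> + 1"
  have k: "k > 0" "c \<le> k" unfolding k_def by auto
  have "0 \<le> 2 * (- a / k) * a + (- a / k)\<^sup>2 * c" by (rule assms)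
  also have "\<dots> \<le> 2 * (- a / k) * a + (- a / k)\<^sup>2 * k"
    using k by (intro add_left_mono mult_left_mono) auto
  also have "\<dots> = - (a\<^sup>2 / k)" using k by (simp add: power2_eq_square)
  also have "\<dots> < 0" using k \<open>\<not> a \<le> 0\<close> by simp
  finally show False by simp
qed

text \<open>
  The quadratic form attains its minimum over the unit sphere, and the first variation at a minimizer
  is the eigenvalue equation.
\<close>

lemma exists_least_Rayleigh_eigenvalue:
  fixes M :: "real^'n^'n" assumes sym: "transpose M = M"
  shows "\<exists>m\<in>eigenvalues M. \<forall>x. m * (x \<bullet> x) \<le> x \<bullet> (M *v x)"
proof -
  let ?q = "\<lambda>x. x \<bullet> (M *v x)"
  have "sphere 0 1 \<noteq> ({} :: (real^'n) set)" by simp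
  moreover have "continuous_on (sphere 0 1) ?q" by (intro continuous_intros)
  ultimately obtain x0 where x0: "x0 \<in> sphere 0 1" "\<And>y. y \<in> sphere 0 1 \<Longrightarrow> ?q x0 \<le> ?q y"
    using continuous_attains_inf[OF compact_sphere, of 0 1 ?q] by blast
  define m where "m = ?q x0"
  have n0: "x0 \<bullet> x0 = 1" using x0(1) by (simp add: dot_square_norm)
  have ray: "m * (x \<bullet> x) \<le> ?q x" for x
  proof (cases "x = 0")
    case False
    have "m \<le> ?q ((1 / norm x) *\<^sub>R x)" unfolding m_def using False by (intro x0(2)) simp
    also have "\<dots> = ?q x / (x \<bullet> x)"
      by (simp add: matrix_vector_mult_scaleR dot_square_norm power2_eq_square)
    finally show ?thesis using False by (simp add: pos_le_divide_eq)
  qed simp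
  define y where "y = M *v x0 - m *\<^sub>R x0"
  have var: "0 \<le> 2 * s * (y \<bullet> y) + s\<^sup>2 * (?q y - m * (y \<bullet> y))" for s
  proof -
    have "(M *v x0) \<bullet> y = x0 \<bullet> (M *v y)" by (rule symmetric_matrix_inner[OF sym])
    then have "?q (x0 + s *\<^sub>R y) - m * ((x0 + s *\<^sub>R y) \<bullet> (x0 + s *\<^sub>R y)) =
      (?q x0 - m * (x0 \<bullet> x0)) + 2 * s * ((M *v x0 - m *\<^sub>R x0) \<bullet> y) + s\<^sup>2 * (?q y - m * (y \<bullet> y))"
      by (simp add: matrix_vector_right_distrib matrix_vector_mult_scaleR inner_add inner_diff inner_commute
          power2_eq_square algebra_simps)
    then show ?thesis using ray[of "x0 + s *\<^sub>R y"] n0 by (simp add: m_def y_def)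
  qed
  have "y \<bullet> y = 0"
    using nonneg_quadratic_imp_linear_term_le_0[OF var] inner_ge_zero[of y] by (intro antisym)
  then have "M *v x0 = m *\<^sub>R x0" by (simp add: y_def)
  moreover have "x0 \<noteq> 0" using n0 by auto
  ultimately have "m \<in> eigenvalues M" unfolding eigenvalues_def by blast
  then show ?thesis using ray by blast
qed

text \<open>
  Eigenvectors for distinct eigenvalues are orthogonal, hence independent. Finiteness is what makes
  \<open>Min\<close> and \<open>Max\<close> of the set of eigenvalues meaningful.
\<close>

lemma finite_eigenvalues:
  fixes M :: "real^'n^'n" assumes sym: "transpose M = M"
  shows "finite (eigenvalues M)"
proof -
  have "\<forall>\<mu>\<in>eigenvalues M. \<exists>v. v \<noteq> 0 \<and> M *v v = \<mu> *\<^sub>R v" unfolding eigenvalues_def by blast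
  from bchoice[OF this] obtain v
    where v: "\<And>\<mu>. \<mu> \<in> eigenvalues M \<Longrightarrow> v \<mu> \<noteq> 0 \<and> M *v v \<mu> = \<mu> *\<^sub>R v \<mu>" by blast
  have orth: "v \<mu> \<bullet> v \<nu> = 0" if "\<mu> \<in> eigenvalues M" "\<nu> \<in> eigenvalues M" "\<mu> \<noteq> \<nu>" for \<mu> \<nu>
  proof -
    have "\<mu> * (v \<mu> \<bullet> v \<nu>) = \<nu> * (v \<mu> \<bullet> v \<nu>)"
      using symmetric_matrix_inner[OF sym, of "v \<mu>" "v \<nu>"] v that by simp
    then show ?thesis using that(3) by simp
  qed
  have inj: "inj_on v (eigenvalues M)"
    using orth v by (metis inj_onI inner_eq_zero_iff)
  have "pairwise orthogonal (v ` eigenvalues M)"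
    unfolding pairwise_def orthogonal_def using orth by auto
  then have "independent (v ` eigenvalues M)"
    using v by (intro pairwise_orthogonal_independent) auto
  then have "finite (v ` eigenvalues M)" by (rule independent_imp_finite)
  then show ?thesis using inj finite_imageD by blast
qed

lemma smallest_eigenvalue_le:
  fixes M :: "real^'n^'n" assumes sym: "transpose M = M"
  shows "smallest_eigenvalue M * (x \<bullet> x) \<le> x \<bullet> (M *v x)"
proof -
  obtain m where m: "m \<in> eigenvalues M" "m * (x \<bullet> x) \<le> x \<bullet> (M *v x)"
    using exists_least_Rayleigh_eigenvalue[OF sym] by blast
  have "smallest_eigenvalue M \<le> m"
    unfolding smallest_eigenvalue_def using finite_eigenvalues[OF sym] m(1) by (rule Min_le)
  then have "smallest_eigenvalue M * (x \<bullet> x) \<le> m * (x \<bullet> x)" by (intro mult_right_mono) auto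
  with m(2) show ?thesis by linarith
qed

lemma largest_eigenvalue_ge:
  fixes M :: "real^'n^'n" assumes sym: "transpose M = M"
  shows "x \<bullet> (M *v x) \<le> largest_eigenvalue M * (x \<bullet> x)"
proof -
  have neg: "- M *v v = - (M *v v)" for v :: "real^'n"
    using matrix_vector_mult_add_rdistrib[of M "- M" v] by (simp add: eq_neg_iff_add_eq_0 add.commute)
  have "transpose (- M) = - M"
    using sym by (simp add: transpose_def vec_eq_iff)
  then obtain m where m: "m \<in> eigenvalues (- M)" "m * (x \<bullet> x) \<le> x \<bullet> (- M *v x)"
    using exists_least_Rayleigh_eigenvalue by blast
  obtain v where "v \<noteq> 0" "- M *v v = m *\<^sub>R v" using m(1) unfolding eigenvalues_def by blast
  then have "v \<noteq> 0" "M *v v = (- m) *\<^sub>R v" unfolding neg by (auto simp: minus_equation_iff[of "M *v v"])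
  then have "- m \<in> eigenvalues M" unfolding eigenvalues_def by blast
  then have "- m \<le> largest_eigenvalue M"
    unfolding largest_eigenvalue_def using finite_eigenvalues[OF sym] by (intro Max_ge)
  then have "- m * (x \<bullet> x) \<le> largest_eigenvalue M * (x \<bullet> x)" by (intro mult_right_mono) auto
  with m(2) show ?thesis by (simp add: neg)
qed

section \<open>Riccati comparison\<close>

text \<open>
  Expand \<open>\<parallel>V - p U\<parallel>\<^sup>2 \<ge> 0\<close> and observe that \<open>2 p U \<bullet> V + p' \<parallel>U\<parallel>\<^sup>2\<close> is the derivative of \<open>p \<parallel>U\<parallel>\<^sup>2\<close>. For
  \<open>p = 1 / (2 t)\<close>, a solution of \<open>p' + p\<^sup>2 = - 1 / (4 t\<^sup>2)\<close>, this is the inequality of Hardy.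
\<close>

lemma Riccati_comparison:
  fixes U V :: "real \<Rightarrow> 'v::euclidean_space" and p p' q :: "real \<Rightarrow> real"
  assumes ab: "a \<le> b"
    and U: "\<And>t. a \<le> t \<Longrightarrow> t \<le> b \<Longrightarrow> (U has_vector_derivative V t) (at t within {a..b})"
    and V: "continuous_on {a..b} V"
    and p: "\<And>t. a \<le> t \<Longrightarrow> t \<le> b \<Longrightarrow> (p has_real_derivative p' t) (at t within {a..b})"
    and q: "continuous_on {a..b} q"
    and le: "\<And>t. a \<le> t \<Longrightarrow> t \<le> b \<Longrightarrow> (p' t + (p t)\<^sup>2) * (norm (U t))\<^sup>2 \<le> q t"
  shows "p b * (norm (U b))\<^sup>2 - p a * (norm (U a))\<^sup>2 \<le> integral {a..b} (\<lambda>t. (norm (V t))\<^sup>2 + q t)"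
proof -
  let ?f = "\<lambda>t. p t * (U t \<bullet> U t)"
  let ?f' = "\<lambda>t. p t * (2 * (U t \<bullet> V t)) + p' t * (U t \<bullet> U t)"
  have d: "(?f has_vector_derivative ?f' t) (at t within {a..b})" if "t \<in> {a..b}" for t
  proof -
    have "((\<lambda>t. U t \<bullet> U t) has_vector_derivative U t \<bullet> V t + V t \<bullet> U t) (at t within {a..b})"
      using that by (intro bounded_bilinear.has_vector_derivative[OF bounded_bilinear_inner] U) auto
    then show ?thesis
      using p[of t] that unfolding has_real_derivative_iff_has_vector_derivative
      by (intro has_vector_derivative_eq_rhs[OF has_vector_derivative_mult]) (auto simp: inner_commute)
  qed
  have i: "(?f' has_integral ?f b - ?f a) {a..b}"
    using ab d by (intro fundamental_theorem_of_calculus) auto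
  have cU: "continuous_on {a..b} U"
    using U has_vector_derivative_continuous by (fastforce simp: continuous_on_eq_continuous_within)
  have "integral {a..b} ?f' \<le> integral {a..b} (\<lambda>t. (norm (V t))\<^sup>2 + q t)"
  proof (rule integral_le)
    show "?f' integrable_on {a..b}" using i by (rule has_integral_integrable)
    show "(\<lambda>t. (norm (V t))\<^sup>2 + q t) integrable_on {a..b}"
      using V q by (intro integrable_continuous_real continuous_intros)
    fix t assume t: "t \<in> {a..b}"
    have "0 \<le> (V t - p t *\<^sub>R U t) \<bullet> (V t - p t *\<^sub>R U t)" by simp
    also have "\<dots> = V t \<bullet> V t - p t * (2 * (U t \<bullet> V t)) + (p t)\<^sup>2 * (U t \<bullet> U t)"
      by (simp add: inner_diff inner_commute power2_eq_square algebra_simps)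
    finally show "?f' t \<le> (norm (V t))\<^sup>2 + q t"
      using le[of t] t by (simp add: power2_norm_eq_inner algebra_simps)
  qed
  then show ?thesis using integral_unique[OF i] by (simp add: power2_norm_eq_inner)
qed

text \<open>
  On a piece with left end point \<open>s\<close> and length \<open>d\<close> compare with \<open>p t = - 2 K (t - s)\<close>. It satisfies
  \<open>p' + p\<^sup>2 \<le> - K\<close> because \<open>4 K d\<^sup>2 \<le> 1\<close>, and the boundary terms vanish since \<open>p\<close> is zero on the left
  and \<open>U\<close> is zero on the right.
\<close>

lemma form_nonneg_short_intervals:
  fixes U V :: "real \<Rightarrow> 'v::euclidean_space" and q :: "real \<Rightarrow> real"
  assumes K: "K > 0" and d: "d \<ge> 0" "4 * K * d\<^sup>2 \<le> 1"
    and U: "\<And>t. a \<le> t \<Longrightarrow> t \<le> a + m * d \<Longrightarrow> (U has_vector_derivative V t) (at t within {a..a + real m * d})"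
    and V: "continuous_on {a..a + real m * d} V"
    and q: "continuous_on {a..a + real m * d} q"
    and le: "\<And>t. a \<le> t \<Longrightarrow> t \<le> a + m * d \<Longrightarrow> - K * (norm (U t))\<^sup>2 \<le> q t"
    and zero: "\<And>i. i \<le> m \<Longrightarrow> U (a + real i * d) = 0"
  shows "0 \<le> integral {a..a + real m * d} (\<lambda>t. (norm (V t))\<^sup>2 + q t)"
proof -
  let ?e = "\<lambda>t. (norm (V t))\<^sup>2 + q t"
  have "0 \<le> integral {a..a + real i * d} ?e" if "i \<le> m" for i
    using that
  proof (induction i)
    case (Suc i)
    let ?s = "a + real i * d" and ?t = "a + real (Suc i) * d"
    have "real (Suc i) * d \<le> real m * d" using Suc.prems d(1) by (intro mult_right_mono) auto
    then have st: "a \<le> ?s" "?s \<le> ?t" "?t \<le> a + real m * d" "?t - ?s = d"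
      using d(1) by (auto simp: algebra_simps)
    then have sub: "{?s..?t} \<subseteq> {a..a + real m * d}" by auto
    have "- 2 * K * (?t - ?s) * (norm (U ?t))\<^sup>2 - - 2 * K * (?s - ?s) * (norm (U ?s))\<^sup>2 \<le> integral {?s..?t} ?e"
    proof (rule Riccati_comparison[where p="\<lambda>t. - 2 * K * (t - ?s)" and p'="\<lambda>_. - 2 * K"])
      fix t assume t: "?s \<le> t" "t \<le> ?t"
      show "(U has_vector_derivative V t) (at t within {?s..?t})"
        by (intro has_vector_derivative_within_subset[OF U sub]) (use t st in linarith)+
      show "((\<lambda>t. - 2 * K * (t - ?s)) has_real_derivative - 2 * K) (at t within {?s..?t})"
        by (auto intro!: derivative_eq_intros)
      have "\<bar>t - ?s\<bar> \<le> d" using t st by auto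
      then have "(t - ?s)\<^sup>2 \<le> d\<^sup>2" by (metis abs_ge_zero power2_abs power_mono)
      then have "4 * K * K * (t - ?s)\<^sup>2 \<le> K * (4 * K * d\<^sup>2)" using K by (simp add: algebra_simps mult_left_mono)
      also have "\<dots> \<le> K * 1" using d(2) K by (intro mult_left_mono) auto
      finally have "- 2 * K + (- 2 * K * (t - ?s))\<^sup>2 \<le> - K"
        by (simp add: power2_eq_square algebra_simps)
      then have "(- 2 * K + (- 2 * K * (t - ?s))\<^sup>2) * (norm (U t))\<^sup>2 \<le> - K * (norm (U t))\<^sup>2"
        by (intro mult_right_mono) auto
      also have "\<dots> \<le> q t" by (rule le) (use t st in linarith)+
      finally show "(- 2 * K + (- 2 * K * (t - ?s))\<^sup>2) * (norm (U t))\<^sup>2 \<le> q t" .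
    qed (rule st(2) continuous_on_subset[OF V sub] continuous_on_subset[OF q sub])+
    then have "0 \<le> integral {?s..?t} ?e" using zero[OF Suc.prems] by simp
    moreover have "integral {a..?s} ?e + integral {?s..?t} ?e = integral {a..?t} ?e"
      using st V q by (intro Henstock_Kurzweil_Integration.integral_combine integrable_continuous_real continuous_intros)
        (auto intro: continuous_on_subset)
    ultimately show ?case using Suc by simp
  qed simp
  then show ?thesis by blast
qed

section \<open>Regularity in the domain of an extension\<close>

lemma square_integrable_loc_integrable:
  fixes u :: "real \<Rightarrow> 'v::euclidean_space"
  assumes "square_integrable u"
  shows "loc_integrable (\<lambda>t. indicator {1<..} t *\<^sub>R u t)"
  unfolding loc_integrable_def
proof
  fix b :: real
  have m: "(\<lambda>t. indicator {1<..} t *\<^sub>R u t) \<in> borel_measurable lborel"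
    using assms unfolding square_integrable_def halfline_def
    by (simp add: borel_measurable_restrict_space_iff)
  have i: "integrable lborel (\<lambda>t. indicator {1<..} t *\<^sub>R (norm (u t))\<^sup>2)"
    using assms unfolding square_integrable_def halfline_integral set_integrable_def by blast
  show "set_integrable lborel {1..b} (\<lambda>t. indicator {1<..} t *\<^sub>R u t)"
    unfolding set_integrable_def
  proof (rule Bochner_Integration.integrable_bound)
    show "integrable lborel (\<lambda>t. indicator {1..b} t + indicator {1<..} t *\<^sub>R (norm (u t))\<^sup>2)"
      by (intro Bochner_Integration.integrable_add i integrable_real_indicator)
        (auto simp: emeasure_lborel_Icc_eq)
    show "(\<lambda>t. indicator {1..b} t *\<^sub>R indicator {1<..} t *\<^sub>R u t) \<in> borel_measurable lborel"
      using m by measurable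
    show "AE t in lborel. norm (indicator {1..b} t *\<^sub>R indicator {1<..} t *\<^sub>R u t)
        \<le> norm (indicator {1..b} t + indicator {1<..} t *\<^sub>R (norm (u t))\<^sup>2)"
    proof (rule AE_I2)
      fix t
      have "0 \<le> (norm (u t) - 1/2)\<^sup>2" by simp
      then have "norm (u t) \<le> 1 + (norm (u t))\<^sup>2" by (simp add: power2_eq_square algebra_simps)
      then show "norm (indicator {1..b} t *\<^sub>R indicator {1<..} t *\<^sub>R u t)
        \<le> norm (indicator {1..b} t + indicator {1<..} t *\<^sub>R (norm (u t))\<^sup>2)"
        by (auto simp: indicator_def)
    qed
  qed
qed

lemma square_integrable_compact:
  fixes f :: "real \<Rightarrow> 'v::euclidean_space"
  assumes "continuous_on {a..b} f" "1 < a" "\<And>t. t \<notin> {a..b} \<Longrightarrow> f t = 0"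
  shows "square_integrable f"
proof -
  have "integrable halfline f" by (rule halfline_integral_compact(1)[OF assms])
  moreover have "integrable halfline (\<lambda>t. (norm (f t))\<^sup>2)"
  proof (rule halfline_integral_compact(1))
    show "continuous_on {a..b} (\<lambda>t. (norm (f t))\<^sup>2)" by (intro continuous_intros assms)
  qed (use assms in auto)
  ultimately show ?thesis
    unfolding square_integrable_def by (intro conjI borel_measurable_integrable)
qed

lemma loc_integrable_bilinear:
  fixes H :: "'a::euclidean_space \<Rightarrow> 'b::euclidean_space \<Rightarrow> 'c::euclidean_space"
  assumes "bounded_bilinear H" "continuous_on {1..} k" "loc_integrable u"
  shows "loc_integrable (\<lambda>t. H (k t) (u t))"
  unfolding loc_integrable_def
proof
  fix b :: real
  show "set_integrable lborel {1..b} (\<lambda>t. H (k t) (u t))"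
    using assms(3) unfolding loc_integrable_def
    by (intro set_integrable_bilinear[OF assms(1)] continuous_on_subset[OF assms(2)]) auto
qed

lemma vector_derivative_twice:
  assumes "\<And>t. (\<phi> has_vector_derivative \<phi>' t) (at t)" "\<And>t. (\<phi>' has_vector_derivative \<phi>'' t) (at t)"
  shows "vector_derivative (\<lambda>s. vector_derivative \<phi> (at s)) (at t) = \<phi>'' t"
proof -
  have "(\<lambda>s. vector_derivative \<phi> (at s)) = \<phi>'"
    using assms(1) by (auto simp: fun_eq_iff intro: vector_derivative_at)
  then show ?thesis using assms(2) by (simp add: vector_derivative_at)
qed

lemma l_expr_scalar:
  fixes R :: "real \<Rightarrow> real^'n^'n" and \<psi> \<psi>' \<psi>'' :: "real \<Rightarrow> real"
  assumes "\<And>t. (\<psi> has_vector_derivative \<psi>' t) (at t)" "\<And>t. (\<psi>' has_vector_derivative \<psi>'' t) (at t)"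
  shows "l_expr R (\<lambda>t. \<psi> t *\<^sub>R e) t = - (\<psi>'' t *\<^sub>R e) + (\<psi> t / t\<^sup>2) *\<^sub>R (R t *v e)"
proof -
  have "((\<lambda>t. \<psi> t *\<^sub>R e) has_vector_derivative \<psi>' t *\<^sub>R e) (at t)"
    "((\<lambda>t. \<psi>' t *\<^sub>R e) has_vector_derivative \<psi>'' t *\<^sub>R e) (at t)" for t
    using bounded_linear.has_vector_derivative[OF bounded_linear_scaleR_left assms(1)]
      bounded_linear.has_vector_derivative[OF bounded_linear_scaleR_left assms(2)] by auto
  from vector_derivative_twice[OF this] show ?thesis
    by (simp add: l_expr_def matrix_vector_mult_scaleR)
qed

lemma l_expr_scalar_square_integrable:
  fixes R :: "real \<Rightarrow> real^'n^'n" and \<psi> \<psi>' \<psi>'' :: "real \<Rightarrow> real"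
  assumes R: "continuous_on {1..} R" and \<psi>: "test_function \<psi>" "test_function \<psi>''"
    and d: "\<And>t. (\<psi> has_vector_derivative \<psi>' t) (at t)" "\<And>t. (\<psi>' has_vector_derivative \<psi>'' t) (at t)"
  shows "square_integrable (l_expr R (\<lambda>t. \<psi> t *\<^sub>R e))"
proof -
  obtain a b where ab: "1 < a" "a < b" "\<And>t. t \<notin> {a..b} \<Longrightarrow> \<psi> t = 0" using test_functionE[OF \<psi>(1)] by blast
  obtain c d where cd: "1 < c" "c < d" "\<And>t. t \<notin> {c..d} \<Longrightarrow> \<psi>'' t = 0" using test_functionE[OF \<psi>(2)] by blast
  have eq: "l_expr R (\<lambda>t. \<psi> t *\<^sub>R e) = (\<lambda>t. - (\<psi>'' t *\<^sub>R e) + (\<psi> t / t\<^sup>2) *\<^sub>R (R t *v e))"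
    by (rule ext) (rule l_expr_scalar[OF assms(4,5)])
  show ?thesis
    unfolding eq
  proof (rule square_integrable_compact[of "min a c" "max b d"])
    have sub: "{min a c..max b d} \<subseteq> {1..}" using ab cd by auto
    show "continuous_on {min a c..max b d} (\<lambda>t. - (\<psi>'' t *\<^sub>R e) + (\<psi> t / t\<^sup>2) *\<^sub>R (R t *v e))"
      using ab cd
      by (intro continuous_intros smooth_imp_continuous test_function_smooth \<psi> continuous_on_subset[OF R sub]) auto
    show "1 < min a c" using ab cd by simp
    fix t assume "t \<notin> {min a c..max b d}"
    then have "t \<notin> {a..b}" "t \<notin> {c..d}" by auto
    then show "- (\<psi>'' t *\<^sub>R e) + (\<psi> t / t\<^sup>2) *\<^sub>R (R t *v e) = 0" using ab(3) cd(3) by simp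
  qed
qed

lemma test_function_square_integrable:
  fixes \<phi> :: "real \<Rightarrow> 'v::euclidean_space"
  assumes "test_function \<phi>" shows "square_integrable \<phi>"
proof -
  obtain a b where ab: "1 < a" "a < b" "\<And>t. t \<notin> {a..b} \<Longrightarrow> \<phi> t = 0" using test_functionE[OF assms] by blast
  show ?thesis
    by (rule square_integrable_compact[OF smooth_imp_continuous[OF test_function_smooth[OF assms]] ab(1,3)])
qed

lemma test_function_in_minimal_operator:
  "test_function \<phi> \<Longrightarrow> (L2_class \<phi>, L2_class (l_expr R \<phi>)) \<in> minimal_operator R"
  unfolding minimal_operator_def by (intro subsetD[OF closure_subset]) blast

locale extension =
  fixes R :: "real \<Rightarrow> real^'n^'n" and A :: "((real^'n) L2 \<times> (real^'n) L2) set"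
  assumes continuous_R: "continuous_on {1..} R"
    and symmetric_R: "\<And>t. t \<ge> 1 \<Longrightarrow> transpose (R t) = R t"
    and self_adjoint_A: "self_adjoint A"
    and extends: "minimal_operator R \<subseteq> A"
begin

lemma R_inner: "t \<ge> 1 \<Longrightarrow> (R t *v x) \<bullet> y = x \<bullet> (R t *v y)"
  by (intro symmetric_matrix_inner symmetric_R)

text \<open>
  For \<open>z = A u\<close> this is the second derivative of \<open>u\<close> according to the differential equation. The
  functions \<open>u\<close> and \<open>z\<close> are cut off at \<open>1\<close>, as representatives in \<open>L2\<close> are arbitrary to the left of it.
\<close>

definition rhs :: "(real \<Rightarrow> real^'n) \<Rightarrow> (real \<Rightarrow> real^'n) \<Rightarrow> real \<Rightarrow> real^'n"
  where "rhs u z t = (1 / t\<^sup>2) *\<^sub>R (R t *v (indicator {1<..} t *\<^sub>R u t)) - indicator {1<..} t *\<^sub>R z t"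

lemma loc_integrable_rhs:
  assumes "square_integrable u" "square_integrable z"
  shows "loc_integrable (rhs u z)"
  unfolding rhs_def[abs_def]
  by (intro loc_integrable_diff loc_integrable_bilinear[OF bounded_bilinear_scaleR]
      loc_integrable_bilinear[OF bounded_bilinear_matrix_vector]
      square_integrable_loc_integrable assms continuous_R continuous_intros) auto

text \<open>
  The extension is contained in the adjoint of the minimal operator; test this with \<open>\<psi> t *\<^sub>R e\<close> and use
  the symmetry of \<open>R t\<close>.
\<close>

lemma weak_equation:
  assumes A: "(L2_class u, L2_class z) \<in> A" and u: "square_integrable u" and z: "square_integrable z"
    and \<psi>: "test_function \<psi>" "test_function \<psi>''"
    and d: "\<And>t. (\<psi> has_vector_derivative \<psi>' t) (at t)" "\<And>t. (\<psi>' has_vector_derivative \<psi>'' t) (at t)"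
  shows "(\<integral>t. (indicator {1<..} t *\<^sub>R u t \<bullet> e) * \<psi>'' t \<partial>halfline) = (\<integral>t. (rhs u z t \<bullet> e) * \<psi> t \<partial>halfline)"
proof -
  let ?\<phi> = "\<lambda>t. \<psi> t *\<^sub>R e"
  have \<phi>: "test_function ?\<phi>" by (rule test_function_bounded_linear[OF bounded_linear_scaleR_left \<psi>(1)])
  have l: "square_integrable (l_expr R ?\<phi>)" by (rule l_expr_scalar_square_integrable[OF continuous_R \<psi> d])
  have "(L2_class ?\<phi>, L2_class (l_expr R ?\<phi>)) \<in> A" using test_function_in_minimal_operator[OF \<phi>] extends by blast
  moreover have "(L2_class u, L2_class z) \<in> adjoint_graph A" using A self_adjoint_A unfolding self_adjoint_def by simp
  ultimately have "L2_class (l_expr R ?\<phi>) \<bullet> L2_class u = L2_class ?\<phi> \<bullet> L2_class z"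
    unfolding adjoint_graph_def by blast
  then have eq: "(\<integral>t. l_expr R ?\<phi> t \<bullet> u t \<partial>halfline) = (\<integral>t. ?\<phi> t \<bullet> z t \<partial>halfline)"
    by (simp add: L2_class_inner l u z test_function_square_integrable[OF \<phi>])
  have "0 = (\<integral>t. ?\<phi> t \<bullet> z t \<partial>halfline) - (\<integral>t. l_expr R ?\<phi> t \<bullet> u t \<partial>halfline)" using eq by simp
  also have "\<dots> = (\<integral>t. ?\<phi> t \<bullet> z t - l_expr R ?\<phi> t \<bullet> u t \<partial>halfline)"
    by (intro Bochner_Integration.integral_diff[symmetric] square_integrable_inner l u z test_function_square_integrable \<phi>)
  also have "\<dots> = (\<integral>t. (indicator {1<..} t *\<^sub>R u t \<bullet> e) * \<psi>'' t - (rhs u z t \<bullet> e) * \<psi> t \<partial>halfline)"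
  proof (rule Bochner_Integration.integral_cong[OF refl])
    fix t assume "t \<in> space halfline"
    then have t: "t > 1" by (simp add: halfline_def space_restrict_space)
    then show "?\<phi> t \<bullet> z t - l_expr R ?\<phi> t \<bullet> u t = (indicator {1<..} t *\<^sub>R u t \<bullet> e) * \<psi>'' t - (rhs u z t \<bullet> e) * \<psi> t"
      using R_inner[of t e "u t"]
      by (simp add: l_expr_scalar[OF d] rhs_def inner_add_left inner_diff_left inner_commute algebra_simps)
  qed
  also have "\<dots> = (\<integral>t. (indicator {1<..} t *\<^sub>R u t \<bullet> e) * \<psi>'' t \<partial>halfline) - (\<integral>t. (rhs u z t \<bullet> e) * \<psi> t \<partial>halfline)"
    by (intro Bochner_Integration.integral_diff pairing_integrable loc_integrable_inner loc_integrable_rhs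
        square_integrable_loc_integrable u z \<psi>)
  finally show ?thesis by simp
qed

lemma regular_representative:
  assumes A: "(L2_class u, L2_class z) \<in> A" and u: "square_integrable u" and z: "square_integrable z"
  shows "\<exists>U \<beta>. (AE t in halfline. u t = U t) \<and>
    (\<forall>b t. 1 \<le> t \<longrightarrow> t \<le> b \<longrightarrow> (U has_vector_derivative \<beta> + prim (rhs u z) t) (at t within {1..b}))"
proof -
  note lr = loc_integrable_rhs[OF u z]
  obtain \<alpha> \<beta> where ae: "AE t in halfline. indicator {1<..} t *\<^sub>R u t = \<alpha> + t *\<^sub>R \<beta> + prim (prim (rhs u z)) t"
    by (rule weak_regularity[OF square_integrable_loc_integrable[OF u] lr]) (rule weak_equation[OF A u z], auto)
  let ?U = "\<lambda>t. \<alpha> + t *\<^sub>R \<beta> + prim (prim (rhs u z)) t"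
  show ?thesis
  proof (intro exI[of _ ?U] exI[of _ \<beta>] conjI allI impI)
    have "AE t in halfline. t \<in> {1<..}"
      by (intro AE_I2) (simp add: halfline_def space_restrict_space)
    with ae show "AE t in halfline. u t = ?U t" by eventually_elim simp
    fix b t :: real assume "1 \<le> t" "t \<le> b"
    then have "(prim (prim (rhs u z)) has_vector_derivative prim (rhs u z) t) (at t within {1..b})"
      by (intro prim_has_vector_derivative continuous_on_prim lr)
    then show "(?U has_vector_derivative \<beta> + prim (rhs u z) t) (at t within {1..b})"
      by (auto intro!: derivative_eq_intros)
  qed
qed

end

section \<open>Finite Morse index\<close>

lemma continuous_AE_unique:
  fixes D :: "real \<Rightarrow> 'v::euclidean_space"
  assumes c: "continuous_on {1..} D" and ae: "AE t in halfline. D t = 0" and t0: "t0 \<ge> 1"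
  shows "D t0 = 0"
proof (rule ccontr)
  assume nz: "D t0 \<noteq> 0"
  have "continuous (at t0 within {1..}) D" using c t0 by (simp add: continuous_on_eq_continuous_within)
  then have "\<forall>\<^sub>F t in at t0 within {1..}. D t \<noteq> 0"
    using nz unfolding continuous_within by (rule tendsto_imp_eventually_ne)
  then obtain e where e: "e > 0" "\<And>t. t \<in> {1..} \<Longrightarrow> t \<noteq> t0 \<Longrightarrow> dist t t0 < e \<Longrightarrow> D t \<noteq> 0"
    unfolding eventually_at by blast
  have "AE t in lborel. t > 1 \<longrightarrow> D t = 0"
    using ae unfolding AE_halfline_iff .
  then have "AE t in lborel. t \<notin> {t0<..<t0 + e}"
  proof eventually_elim
    fix t assume "t > 1 \<longrightarrow> D t = 0"
    then show "t \<notin> {t0<..<t0 + e}" using e(2)[of t] t0 by (auto simp: dist_real_def)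
  qed
  then have "{t0<..<t0 + e} \<in> null_sets lborel" by (subst AE_iff_null_sets) auto
  then have "emeasure lborel {t0<..<t0 + e} = 0" by auto
  then show False using e(1) by simp
qed

context extension
begin

definition potential :: "(real \<Rightarrow> real^'n) \<Rightarrow> real \<Rightarrow> real"
  where "potential U t = U t \<bullet> (R t *v U t) / t\<^sup>2"

lemma continuous_on_potential:
  assumes "continuous_on {1..b} U" shows "continuous_on {1..b} (potential U)"
  unfolding potential_def[abs_def]
  by (intro continuous_intros assms continuous_on_subset[OF continuous_R]) auto

text \<open>
  Integrate the equation against \<open>U\<close> by parts on \<open>[1, b]\<close>. The boundary term at \<open>1\<close> drops out because
  \<open>U 1 = 0\<close>.
\<close>

lemma energy_identity:
  assumes u: "square_integrable u" and z: "square_integrable z"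
    and ae: "AE t in halfline. u t = U t"
    and U: "\<And>b t. 1 \<le> t \<Longrightarrow> t \<le> b \<Longrightarrow> (U has_vector_derivative V t) (at t within {1..b})"
    and V: "V = (\<lambda>t. \<beta> + prim (rhs u z) t)" and U1: "U 1 = 0" and b: "1 \<le> b"
  shows "(LINT t:{1..b}|lborel. indicator {1<..} t *\<^sub>R z t \<bullet> U t) =
    integral {1..b} (\<lambda>t. (norm (V t))\<^sup>2 + potential U t) - V b \<bullet> U b"
proof -
  note lr = loc_integrable_rhs[OF u z]
  have cV: "continuous_on {1..b} V" unfolding V by (intro continuous_intros continuous_on_prim lr)
  have cU: "continuous_on {1..b} U"
    using U[of _ b] has_vector_derivative_continuous by (fastforce simp: continuous_on_eq_continuous_within)
  note ci = borel_integrable_atLeastAtMost'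
  have iP: "set_integrable lborel {1..b} (potential U)" by (intro ci continuous_on_potential cU)
  have iVV: "set_integrable lborel {1..b} (\<lambda>t. (norm (V t))\<^sup>2)" by (intro ci continuous_intros cV)
  have iBV: "set_integrable lborel {1..b} (\<lambda>t. \<beta> \<bullet> V t)" by (intro ci continuous_intros cV)
  have irU: "set_integrable lborel {1..b} (\<lambda>t. rhs u z t \<bullet> U t)" by (rule set_integrable_inner_continuous[OF lr cU])
  have izU: "set_integrable lborel {1..b} (\<lambda>t. indicator {1<..} t *\<^sub>R z t \<bullet> U t)"
    by (rule set_integrable_inner_continuous[OF square_integrable_loc_integrable[OF z] cU])
  have "AE t in lborel. t > 1 \<longrightarrow> u t = U t"
    using ae unfolding AE_halfline_iff .
  then have ae': "AE t in lborel. t \<in> {1..b} \<longrightarrow> rhs u z t \<bullet> U t + indicator {1<..} t *\<^sub>R z t \<bullet> U t = potential U t"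
    using AE_lborel_singleton[of 1]
  proof eventually_elim
    fix t assume "t > 1 \<longrightarrow> u t = U t" "t \<noteq> 1"
    then show "t \<in> {1..b} \<longrightarrow> rhs u z t \<bullet> U t + indicator {1<..} t *\<^sub>R z t \<bullet> U t = potential U t"
      by (auto simp: rhs_def potential_def inner_diff_left inner_diff_right inner_commute)
  qed
  have s1: "(LINT t:{1..b}|lborel. rhs u z t \<bullet> U t) + (LINT t:{1..b}|lborel. indicator {1<..} t *\<^sub>R z t \<bullet> U t)
    = (LINT t:{1..b}|lborel. potential U t)"
  proof -
    have "(LINT t:{1..b}|lborel. rhs u z t \<bullet> U t) + (LINT t:{1..b}|lborel. indicator {1<..} t *\<^sub>R z t \<bullet> U t)
      = (LINT t:{1..b}|lborel. rhs u z t \<bullet> U t + indicator {1<..} t *\<^sub>R z t \<bullet> U t)"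
      by (rule set_integral_add(2)[OF irU izU, symmetric])
    also have "\<dots> = (LINT t:{1..b}|lborel. potential U t)"
    proof -
      have m1: "(\<lambda>t. indicator {1..b} t *\<^sub>R (rhs u z t \<bullet> U t + indicator {1<..} t *\<^sub>R z t \<bullet> U t)) \<in> borel_measurable lborel"
        using set_integral_add(1)[OF irU izU] unfolding set_integrable_def by (rule borel_measurable_integrable)
      have m2: "(\<lambda>t. indicator {1..b} t *\<^sub>R potential U t) \<in> borel_measurable lborel"
        using iP unfolding set_integrable_def by (rule borel_measurable_integrable)
      show ?thesis unfolding set_lebesgue_integral_def
      proof (rule integral_cong_AE[OF m1 m2])
        show "AE t in lborel. indicator {1..b} t *\<^sub>R (rhs u z t \<bullet> U t + indicator {1<..} t *\<^sub>R z t \<bullet> U t) =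
          indicator {1..b} t *\<^sub>R potential U t"
          using ae' by eventually_elim (auto simp: indicator_def)
      qed
    qed
    finally show ?thesis .
  qed
  have s2: "(LINT t:{1..b}|lborel. rhs u z t \<bullet> U t) = prim (rhs u z) b \<bullet> U b - (LINT t:{1..b}|lborel. prim (rhs u z) t \<bullet> V t)"
    using U by (intro prim_by_parts[OF lr b cV])
  have "(LINT t:{1..b}|lborel. prim (rhs u z) t \<bullet> V t) = (LINT t:{1..b}|lborel. (norm (V t))\<^sup>2 - \<beta> \<bullet> V t)"
    by (simp add: V power2_norm_eq_inner inner_add_left)
  also have "\<dots> = (LINT t:{1..b}|lborel. (norm (V t))\<^sup>2) - (LINT t:{1..b}|lborel. \<beta> \<bullet> V t)"
    by (rule set_integral_diff(2)[OF iVV iBV])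
  also have "(LINT t:{1..b}|lborel. \<beta> \<bullet> V t) = integral {1..b} (\<lambda>t. \<beta> \<bullet> V t)"
    by (rule set_borel_integral_eq_integral(2)[OF iBV])
  also have "integral {1..b} (\<lambda>t. \<beta> \<bullet> V t) = \<beta> \<bullet> U b - \<beta> \<bullet> U 1"
  proof (rule integral_unique, rule fundamental_theorem_of_calculus[OF b])
    fix t assume "t \<in> {1..b}"
    then show "((\<lambda>t. \<beta> \<bullet> U t) has_vector_derivative \<beta> \<bullet> V t) (at t within {1..b})"
      by (intro bounded_linear.has_vector_derivative[OF bounded_linear_inner_right] U) auto
  qed
  finally have s3: "(LINT t:{1..b}|lborel. prim (rhs u z) t \<bullet> V t) = (LINT t:{1..b}|lborel. (norm (V t))\<^sup>2) - \<beta> \<bullet> U b"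
    by (simp add: U1)
  have s4: "integral {1..b} (\<lambda>t. (norm (V t))\<^sup>2 + potential U t) = (LINT t:{1..b}|lborel. (norm (V t))\<^sup>2) + (LINT t:{1..b}|lborel. potential U t)"
    using set_borel_integral_eq_integral(2)[OF set_integral_add(1)[OF iVV iP]] set_integral_add(2)[OF iVV iP] by simp
  have "V b \<bullet> U b = \<beta> \<bullet> U b + prim (rhs u z) b \<bullet> U b" by (simp add: V inner_add_left)
  then show ?thesis using s1 s2 s3 s4 by simp
qed

text \<open>
  The boundary term is half the derivative of \<open>\<parallel>U\<parallel>\<^sup>2\<close>. If it stayed above \<open>e > 0\<close>, then \<open>\<parallel>U\<parallel>\<^sup>2\<close> would
  grow at least linearly, against square-integrability.
\<close>

lemma boundary_term_not_bounded_below: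
  fixes U V :: "real \<Rightarrow> real^'n"
  assumes u: "square_integrable u" and ae: "AE t in halfline. u t = U t"
    and U: "\<And>b t. 1 \<le> t \<Longrightarrow> t \<le> b \<Longrightarrow> (U has_vector_derivative V t) (at t within {1..b})"
    and e: "e > 0" and B: "\<And>b. b \<ge> B \<Longrightarrow> e \<le> V b \<bullet> U b"
  shows False
proof -
  define B0 where "B0 = max B 2"
  have B0: "B \<le> B0" "1 < B0" unfolding B0_def by auto
  have grow: "2 * e * (b - B0) \<le> U b \<bullet> U b" if "B0 \<le> b" for b
  proof -
    have "U B0 \<bullet> U B0 - 2 * e * B0 \<le> U b \<bullet> U b - 2 * e * b"
    proof (rule DERIV_nonneg_imp_nondecreasing[OF that])
      fix t assume t: "B0 \<le> t" "t \<le> b"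
      have "at t within {1..t + 1} = at t" using t B0 by (intro at_within_interior) auto
      then have "(U has_vector_derivative V t) (at t)" using U[of t "t + 1"] t B0 by simp
      then have "((\<lambda>t. U t \<bullet> U t - 2 * e * t) has_vector_derivative (U t \<bullet> V t + V t \<bullet> U t) - 2 * e * 1) (at t)"
        by (intro has_vector_derivative_diff bounded_bilinear.has_vector_derivative[OF bounded_bilinear_inner]
          has_vector_derivative_mult_right has_vector_derivative_id)
      then show "\<exists>y. ((\<lambda>t. U t \<bullet> U t - 2 * e * t) has_real_derivative y) (at t) \<and> 0 \<le> y"
        using B[of t] t B0 unfolding has_real_derivative_iff_has_vector_derivative
        by (intro exI conjI) (assumption, simp add: inner_commute)
    qed
    then show ?thesis using inner_ge_zero[of "U B0"] unfolding right_diff_distrib by linarith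
  qed
  define B1 where "B1 = B0 + 1 / (2 * e)"
  have B1: "B0 \<le> B1" "B1 > 1"
  proof -
    show "B0 \<le> B1" using e unfolding B1_def by simp
    then show "B1 > 1" using B0 by linarith
  qed
  have ge1: "1 \<le> (norm (U b))\<^sup>2" if "b \<ge> B1" for b
  proof -
    have "1 = 2 * e * (B1 - B0)" using e by (simp add: B1_def)
    also have "\<dots> \<le> 2 * e * (b - B0)" using that e by (intro mult_left_mono) auto
    also have "\<dots> \<le> (norm (U b))\<^sup>2" using grow[of b] that B1 by (simp add: power2_norm_eq_inner)
    finally show ?thesis .
  qed
  have i: "integrable lborel (\<lambda>t. indicator {1<..} t *\<^sub>R (norm (u t))\<^sup>2)"
    using u unfolding square_integrable_def halfline_integral set_integrable_def by blast
  have "AE t in lborel. t > 1 \<longrightarrow> u t = U t"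
    using ae unfolding AE_halfline_iff .
  then have aen: "AE t in lborel. indicator {B1..B1 + real n} t \<le> indicator {1<..} t *\<^sub>R (norm (u t))\<^sup>2" for n
  proof eventually_elim
    fix t assume "t > 1 \<longrightarrow> u t = U t"
    then show "indicator {B1..B1 + real n} t \<le> indicator {1<..} t *\<^sub>R (norm (u t))\<^sup>2"
      using ge1[of t] B1 by (auto simp: indicator_def)
  qed
  have "real n \<le> (\<integral>t. indicator {1<..} t *\<^sub>R (norm (u t))\<^sup>2 \<partial>lborel)" for n
  proof -
    have "real n = (\<integral>t. indicator {B1..B1 + real n} t \<partial>lborel)" by simp
    also have "\<dots> \<le> (\<integral>t. indicator {1<..} t *\<^sub>R (norm (u t))\<^sup>2 \<partial>lborel)"
      by (intro integral_mono_AE i aen integrable_real_indicator) (auto simp: emeasure_lborel_Icc_eq)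
    finally show ?thesis .
  qed
  then show False using reals_Archimedean2 linorder_not_less by blast
qed

text \<open>
  If the form value at \<open>u\<close> were negative, then by the energy identity the boundary term at \<open>b\<close> would
  have to stay above a positive constant for all large \<open>b\<close>.
\<close>

lemma nonneg_of_form_nonneg:
  assumes A: "(L2_class u, L2_class z) \<in> A" and u: "square_integrable u" and z: "square_integrable z"
    and ae: "AE t in halfline. u t = U t"
    and U: "\<And>b t. 1 \<le> t \<Longrightarrow> t \<le> b \<Longrightarrow> (U has_vector_derivative V t) (at t within {1..b})"
    and V: "V = (\<lambda>t. \<beta> + prim (rhs u z) t)" and U1: "U 1 = 0"
    and T: "1 \<le> T" and form: "\<And>b. T \<le> b \<Longrightarrow> 0 \<le> integral {1..b} (\<lambda>t. (norm (V t))\<^sup>2 + potential U t)"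
  shows "0 \<le> L2_class z \<bullet> L2_class u"
proof (rule ccontr)
  assume neg: "\<not> 0 \<le> L2_class z \<bullet> L2_class u"
  define e where "e = - (L2_class z \<bullet> L2_class u) / 2"
  have e: "e > 0" "L2_class z \<bullet> L2_class u = - 2 * e" using neg by (auto simp: e_def)
  let ?f = "\<lambda>t. indicator {1<..} t *\<^sub>R (z t \<bullet> u t)"
  have i: "integrable lborel ?f"
    using square_integrable_inner[OF z u] unfolding halfline_integral set_integrable_def .
  have tot: "(\<integral>t. ?f t \<partial>lborel) = - 2 * e"
    using L2_class_inner[OF z u] e unfolding halfline_integral set_lebesgue_integral_def by simp
  have E: "(LINT t:{1..b}|lborel. ?f t) = (LINT t:{1..b}|lborel. indicator {1<..} t *\<^sub>R z t \<bullet> U t)" for b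
    unfolding set_lebesgue_integral_def
  proof (rule integral_cong_AE)
    show "(\<lambda>t. indicator {1..b} t *\<^sub>R ?f t) \<in> borel_measurable lborel"
      using borel_measurable_integrable[OF i] by measurable
    have cU: "continuous_on {1..b} U"
      using U[of _ b] has_vector_derivative_continuous by (fastforce simp: continuous_on_eq_continuous_within)
    show "(\<lambda>t. indicator {1..b} t *\<^sub>R (indicator {1<..} t *\<^sub>R z t \<bullet> U t)) \<in> borel_measurable lborel"
      using set_integrable_inner_continuous[OF square_integrable_loc_integrable[OF z] cU]
      unfolding set_integrable_def by (rule borel_measurable_integrable)
    have "AE t in lborel. t > 1 \<longrightarrow> u t = U t"
      using ae unfolding AE_halfline_iff .
    then show "AE t in lborel. indicator {1..b} t *\<^sub>R ?f t = indicator {1..b} t *\<^sub>R (indicator {1<..} t *\<^sub>R z t \<bullet> U t)"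
      by eventually_elim (auto simp: indicator_def)
  qed
  have "((\<lambda>b. \<integral>t. indicator {1..b} t *\<^sub>R ?f t \<partial>lborel) \<longlongrightarrow> (\<integral>t. ?f t \<partial>lborel)) at_top"
  proof (rule integral_dominated_convergence_at_top[where w="\<lambda>t. norm (?f t)"])
    show "AE t in lborel. ((\<lambda>b. indicator {1..b} t *\<^sub>R ?f t) \<longlongrightarrow> ?f t) at_top"
    proof (rule AE_I2, rule tendsto_eventually)
      fix t :: real
      show "\<forall>\<^sub>F b in at_top. indicator {1..b} t *\<^sub>R ?f t = ?f t"
        using eventually_ge_at_top[of t] by eventually_elim (auto simp: indicator_def)
    qed
    show "\<forall>\<^sub>F b in at_top. AE t in lborel. norm (indicator {1..b} t *\<^sub>R ?f t) \<le> norm (?f t)"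
      by (intro always_eventually allI AE_I2) (auto simp: indicator_def)
    show "(\<lambda>t. indicator {1..b} t *\<^sub>R ?f t) \<in> borel_measurable lborel" for b
      using borel_measurable_integrable[OF i] by measurable
  qed (use i in \<open>auto intro: borel_measurable_integrable\<close>)
  then have "\<forall>\<^sub>F b in at_top. (LINT t:{1..b}|lborel. ?f t) < - e"
    unfolding tot set_lebesgue_integral_def by (rule order_tendstoD(2)) (use e in auto)
  then obtain B where B: "\<And>b. b \<ge> B \<Longrightarrow> (LINT t:{1..b}|lborel. ?f t) < - e"
    unfolding eventually_at_top_linorder by blast
  show False
  proof (rule boundary_term_not_bounded_below[OF u ae U e(1)])
    fix b assume b: "b \<ge> max B T"
    then show "e \<le> V b \<bullet> U b"
      using B[of b] form[of b] T energy_identity[OF u z ae U V U1, of b] E[of b] by simp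
  qed
qed

text \<open>
  The nodes form a grid of \<open>[1, T]\<close>, so fine that \<open>form_nonneg_short_intervals\<close> applies to the lower
  bound \<open>- K\<close> of the potential on \<open>[1, T]\<close>. Both end points are nodes, and \<open>U T = 0\<close> starts the
  inequality of Hardy on \<open>[T, b]\<close>.
\<close>

lemma exists_nodes:
  assumes T: "1 \<le> T" and Hardy: "\<And>t v. T \<le> t \<Longrightarrow> - (1/4) * (norm v)\<^sup>2 \<le> v \<bullet> (R t *v v)"
  obtains P where "finite P" "P \<subseteq> {1..}" "1 \<in> P"
    "\<And>U V b. \<lbrakk>\<And>b t. 1 \<le> t \<Longrightarrow> t \<le> b \<Longrightarrow> (U has_vector_derivative V t) (at t within {1..b});
      \<And>b. continuous_on {1..b} V; \<And>p. p \<in> P \<Longrightarrow> U p = 0; T \<le> b\<rbrakk> \<Longrightarrow>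
      0 \<le> integral {1..b} (\<lambda>t. (norm (V t))\<^sup>2 + potential U t)"
proof -
  obtain C where C: "C > 0" "\<And>M (v::real^'n). norm ((M::real^'n^'n) *v v) \<le> norm M * norm v * C"
    using bounded_bilinear.pos_bounded[OF bounded_bilinear_matrix_vector] by metis
  have "bounded (R ` {1..T})"
    using continuous_on_subset[OF continuous_R, of "{1..T}"] by (intro compact_imp_bounded compact_continuous_image) auto
  then obtain K0 where K0: "\<forall>t\<in>{1..T}. norm (R t) \<le> K0" unfolding bounded_iff by auto
  define K where "K = \<bar>K0\<bar> * C + 1"
  have K: "K > 0" using C(1) unfolding K_def by (simp add: add_nonneg_pos)
  have low: "- K * (norm (U t))\<^sup>2 \<le> potential U t" if t: "1 \<le> t" "t \<le> T" for U and t :: real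
  proof -
    have "\<bar>U t \<bullet> (R t *v U t)\<bar> \<le> norm (U t) * norm (R t *v U t)" by (rule Cauchy_Schwarz_ineq2)
    also have "\<dots> \<le> norm (U t) * (norm (R t) * norm (U t) * C)" by (intro mult_left_mono C) auto
    also have "\<dots> = norm (R t) * C * (norm (U t))\<^sup>2" by (simp add: power2_eq_square)
    also have "\<dots> \<le> K * (norm (U t))\<^sup>2"
    proof (rule mult_right_mono)
      have "norm (R t) \<le> \<bar>K0\<bar>" using K0 t by force
      then have "norm (R t) * C \<le> \<bar>K0\<bar> * C" using C(1) by (intro mult_right_mono) auto
      then show "norm (R t) * C \<le> K" unfolding K_def by linarith
    qed simp
    finally have b: "\<bar>U t \<bullet> (R t *v U t)\<bar> \<le> K * (norm (U t))\<^sup>2" .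
    have "\<bar>potential U t\<bar> = \<bar>U t \<bullet> (R t *v U t)\<bar> / t\<^sup>2" unfolding potential_def by simp
    also have "\<dots> \<le> \<bar>U t \<bullet> (R t *v U t)\<bar> / 1" using t by (intro divide_left_mono) (auto simp: one_le_power)
    finally show ?thesis using b by linarith
  qed
  obtain m :: nat where m: "real m \<ge> 4 * K * (T - 1)\<^sup>2 + 1" using real_arch_simple by blast
  have m1: "real m \<ge> 1"
  proof -
    have "0 \<le> 4 * K * (T - 1)\<^sup>2" using K by simp
    then show ?thesis using m by linarith
  qed
  define d where "d = (T - 1) / real m"
  have d: "d \<ge> 0" "1 + real m * d = T" using T m1 by (auto simp: d_def)
  have small: "4 * K * d\<^sup>2 \<le> 1"
  proof -
    have "4 * K * d\<^sup>2 = 4 * K * (T - 1)\<^sup>2 / (real m)\<^sup>2" by (simp add: d_def power_divide)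
    also have "\<dots> \<le> real m / (real m)\<^sup>2" using m by (intro divide_right_mono) auto
    also have "\<dots> \<le> 1" using m1 by (simp add: power2_eq_square divide_le_eq)
    finally show ?thesis .
  qed
  show thesis
  proof (rule that[of "(\<lambda>i. 1 + real i * d) ` {..m}"])
    show "finite ((\<lambda>i. 1 + real i * d) ` {..m})" by simp
    show "(\<lambda>i. 1 + real i * d) ` {..m} \<subseteq> {1..}" using d(1) by auto
    show "1 \<in> (\<lambda>i. 1 + real i * d) ` {..m}" by (rule image_eqI[of _ _ 0]) auto
    fix U V :: "real \<Rightarrow> real^'n" and b
    assume U: "\<And>b t. 1 \<le> t \<Longrightarrow> t \<le> b \<Longrightarrow> (U has_vector_derivative V t) (at t within {1..b})"
      and V: "\<And>b. continuous_on {1..b} V" and z: "\<And>p. p \<in> (\<lambda>i. 1 + real i * d) ` {..m} \<Longrightarrow> U p = 0" and b: "T \<le> b"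
    let ?e = "\<lambda>t. (norm (V t))\<^sup>2 + potential U t"
    have cU: "continuous_on {1..b} U" for b
      using U[of _ b] has_vector_derivative_continuous by (fastforce simp: continuous_on_eq_continuous_within)
    note cP = continuous_on_potential[OF cU]
    have UT: "U T = 0" using z[of T] d(2) by (metis atMost_iff imageI order_refl)
    have "0 \<le> integral {1..1 + real m * d} ?e"
    proof (rule form_nonneg_short_intervals[OF K d(1) small])
      show "- K * (norm (U t))\<^sup>2 \<le> potential U t" if "1 \<le> t" "t \<le> 1 + real m * d" for t
        using that d(2) by (intro low) auto
      show "U (1 + real i * d) = 0" if "i \<le> m" for i using that by (intro z) auto
    qed (use U V cP in auto)
    then have 1: "0 \<le> integral {1..T} ?e" using d(2) by simp
    have sub: "{T..b} \<subseteq> {1..b}" using T by auto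
    have "1 / (2 * b) * (norm (U b))\<^sup>2 - 1 / (2 * T) * (norm (U T))\<^sup>2 \<le> integral {T..b} ?e"
    proof (rule Riccati_comparison[OF b])
      fix t assume t: "T \<le> t" "t \<le> b"
      show "(U has_vector_derivative V t) (at t within {T..b})"
        by (rule has_vector_derivative_within_subset[OF U sub]) (use t T in auto)
      show "((\<lambda>t. 1 / (2 * t)) has_real_derivative - (1 / (2 * t\<^sup>2))) (at t within {T..b})"
        using t T by (auto intro!: derivative_eq_intros simp: power2_eq_square)
      have "(- (1 / (2 * t\<^sup>2)) + (1 / (2 * t))\<^sup>2) * (norm (U t))\<^sup>2 = (- (1/4) * (norm (U t))\<^sup>2) / t\<^sup>2"
        using t T by (simp add: field_simps power2_eq_square)
      also have "\<dots> \<le> potential U t"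
        unfolding potential_def using Hardy[OF t(1), of "U t"] by (intro divide_right_mono) auto
      finally show "(- (1 / (2 * t\<^sup>2)) + (1 / (2 * t))\<^sup>2) * (norm (U t))\<^sup>2 \<le> potential U t" .
    qed (rule continuous_on_subset[OF V sub] continuous_on_subset[OF cP sub])+
    moreover have "0 \<le> 1 / (2 * b) * (norm (U b))\<^sup>2" using b T by simp
    ultimately have 2: "0 \<le> integral {T..b} ?e" using UT by simp
    have "integral {1..T} ?e + integral {T..b} ?e = integral {1..b} ?e"
      by (intro Henstock_Kurzweil_Integration.integral_combine integrable_continuous_real continuous_intros V cP T b)
    then show "0 \<le> integral {1..b} ?e" using 1 2 by simp
  qed
qed

text \<open>
  The continuous representative, which turns point evaluation into a linear functional on the domain
  of \<open>A\<close>.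
\<close>

definition continuous_rep :: "(real^'n) L2 \<Rightarrow> real \<Rightarrow> real^'n" where
  "continuous_rep x = (SOME U. continuous_on {1..} U \<and> (AE t in halfline. rep_L2 x t = U t))"

lemma continuous_on_atLeast:
  assumes "\<And>b t. 1 \<le> t \<Longrightarrow> t \<le> b \<Longrightarrow> (U has_vector_derivative V t) (at t within {1..b})"
  shows "continuous_on {1::real..} (U :: real \<Rightarrow> real^'n)"
proof -
  have "continuous (at t within {1..}) U" if "t \<ge> 1" for t
  proof -
    have "continuous (at t within {1..t + 1}) U"
      using assms[of t "t + 1"] that has_vector_derivative_continuous by auto
    moreover have "at t within {1..t + 1} = at t within {1..}"
      by (rule at_within_nhd[of _ "{..<t + 1}"]) auto
    ultimately show ?thesis by simp
  qed
  then show ?thesis by (simp add: continuous_on_eq_continuous_within)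
qed

lemma continuous_rep:
  assumes "x \<in> Domain A"
  shows "continuous_on {1..} (continuous_rep x)" "AE t in halfline. rep_L2 x t = continuous_rep x t"
proof -
  obtain y where "(x, y) \<in> A" using assms by blast
  then have A': "(L2_class (rep_L2 x), L2_class (rep_L2 y)) \<in> A" by simp
  obtain U \<beta> where "AE t in halfline. rep_L2 x t = U t"
    "\<And>b t. 1 \<le> t \<Longrightarrow> t \<le> b \<Longrightarrow> (U has_vector_derivative \<beta> + prim (rhs (rep_L2 x) (rep_L2 y)) t) (at t within {1..b})"
    using regular_representative[OF A' square_integrable_rep square_integrable_rep] by blast
  then have "continuous_on {1..} U \<and> (AE t in halfline. rep_L2 x t = U t)"
    by (intro conjI continuous_on_atLeast[of U "\<lambda>t. \<beta> + prim (rhs (rep_L2 x) (rep_L2 y)) t"])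
  then have "continuous_on {1..} (continuous_rep x) \<and> (AE t in halfline. rep_L2 x t = continuous_rep x t)"
    unfolding continuous_rep_def by (rule someI[of "\<lambda>U. continuous_on {1..} U \<and> (AE t in halfline. rep_L2 x t = U t)"])
  then show "continuous_on {1..} (continuous_rep x)" "AE t in halfline. rep_L2 x t = continuous_rep x t" by blast+
qed

lemma continuous_rep_unique:
  assumes "x \<in> Domain A" "continuous_on {1..} U" "AE t in halfline. rep_L2 x t = U t" "t \<ge> 1"
  shows "continuous_rep x t = U t"
proof -
  have "continuous_rep x t - U t = 0"
  proof (rule continuous_AE_unique[where D="\<lambda>t. continuous_rep x t - U t", OF _ _ assms(4)])
    show "continuous_on {1..} (\<lambda>t. continuous_rep x t - U t)" by (intro continuous_intros continuous_rep assms)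
    show "AE t in halfline. continuous_rep x t - U t = 0"
      using continuous_rep(2)[OF assms(1)] assms(3) by eventually_elim simp
  qed
  then show ?thesis by simp
qed

lemma continuous_rep_add:
  assumes x: "x \<in> Domain A" and y: "y \<in> Domain A" and t: "t \<ge> 1"
  shows "continuous_rep (x + y) t = continuous_rep x t + continuous_rep y t"
proof (rule continuous_rep_unique[OF _ _ _ t])
  show "x + y \<in> Domain A"
    using x y self_adjoint_A subspace_add[of A] unfolding self_adjoint_def operator_def by (force simp: Domain_iff)
  show "continuous_on {1..} (\<lambda>t. continuous_rep x t + continuous_rep y t)" by (intro continuous_intros continuous_rep x y)
  have "x + y = L2_class (\<lambda>t. rep_L2 x t + rep_L2 y t)"
    using L2_class_add[OF square_integrable_rep[of x] square_integrable_rep[of y]] by simp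
  then have "AE t in halfline. rep_L2 (x + y) t = rep_L2 x t + rep_L2 y t"
    using rep_L2_class[OF square_integrable_add[OF square_integrable_rep[of x] square_integrable_rep[of y]]] by simp
  with continuous_rep(2)[OF x] continuous_rep(2)[OF y] show "AE t in halfline. rep_L2 (x + y) t = continuous_rep x t + continuous_rep y t"
    by eventually_elim simp
qed

lemma continuous_rep_scaleR:
  assumes x: "x \<in> Domain A" and t: "t \<ge> 1"
  shows "continuous_rep (c *\<^sub>R x) t = c *\<^sub>R continuous_rep x t"
proof (rule continuous_rep_unique[OF _ _ _ t])
  show "c *\<^sub>R x \<in> Domain A"
    using x self_adjoint_A subspace_scale[of A] unfolding self_adjoint_def operator_def by (force simp: Domain_iff)
  show "continuous_on {1..} (\<lambda>t. c *\<^sub>R continuous_rep x t)" by (intro continuous_intros continuous_rep x)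
  have "c *\<^sub>R x = L2_class (\<lambda>t. c *\<^sub>R rep_L2 x t)"
    using L2_class_scaleR[OF square_integrable_rep[of x]] by simp
  then have "AE t in halfline. rep_L2 (c *\<^sub>R x) t = c *\<^sub>R rep_L2 x t"
    using rep_L2_class[OF square_integrable_scaleR[OF square_integrable_rep[of x]]] by simp
  with continuous_rep(2)[OF x] show "AE t in halfline. rep_L2 (c *\<^sub>R x) t = c *\<^sub>R continuous_rep x t"
    by eventually_elim simp
qed

theorem finite_morse_index:
  assumes T: "1 \<le> T" and Hardy: "\<And>t v. T \<le> t \<Longrightarrow> - (1/4) * (norm v)\<^sup>2 \<le> v \<bullet> (R t *v v)"
  shows "morse_index A < \<infinity>"
proof (rule exists_nodes[OF T Hardy])
  fix P :: "real set" assume P: "finite P" "P \<subseteq> {1..}" "1 \<in> P"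
    and form: "\<And>U V b. \<lbrakk>\<And>b t. 1 \<le> t \<Longrightarrow> t \<le> b \<Longrightarrow> (U has_vector_derivative V t) (at t within {1..b});
      \<And>b. continuous_on {1..b} V; \<And>p. p \<in> P \<Longrightarrow> U p = 0; T \<le> b\<rbrakk> \<Longrightarrow>
      0 \<le> integral {1..b} (\<lambda>t. (norm (V t))\<^sup>2 + potential U t)"
  let ?l = "\<lambda>(p, e) x. continuous_rep x p \<bullet> (e :: real^'n)"
  show ?thesis
  proof (rule morse_index_finite[OF self_adjoint_A, of "P \<times> Basis" ?l])
    show "finite (P \<times> (Basis :: (real^'n) set))" using P by simp
    fix j :: "real \<times> (real^'n)" and x y :: "(real^'n) L2"
    assume j: "j \<in> P \<times> Basis"
    then have j1: "fst j \<ge> 1" using P by auto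
    show "?l j (x + y) = ?l j x + ?l j y" if "x \<in> Domain A" "y \<in> Domain A"
      using continuous_rep_add[OF that j1] by (simp add: case_prod_beta inner_add_left)
    show "?l j (c *\<^sub>R x) = c * ?l j x" if "x \<in> Domain A" for c
      using continuous_rep_scaleR[OF that j1] by (simp add: case_prod_beta)
  next
    fix x y :: "(real^'n) L2"
    assume xy: "(x, y) \<in> A" and l0: "\<And>j. j \<in> P \<times> Basis \<Longrightarrow> ?l j x = 0"
    let ?u = "rep_L2 x" and ?z = "rep_L2 y"
    have A: "(L2_class ?u, L2_class ?z) \<in> A" using xy by simp
    obtain U \<beta> where ae: "AE t in halfline. ?u t = U t"
      and U: "\<And>b t. 1 \<le> t \<Longrightarrow> t \<le> b \<Longrightarrow> (U has_vector_derivative \<beta> + prim (rhs ?u ?z) t) (at t within {1..b})"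
      using regular_representative[OF A square_integrable_rep square_integrable_rep] by blast
    have cV: "continuous_on {1..b} (\<lambda>t. \<beta> + prim (rhs ?u ?z) t)" for b
      by (intro continuous_intros continuous_on_prim loc_integrable_rhs square_integrable_rep)
    have xD: "x \<in> Domain A" using xy by blast
    have cU: "continuous_on {1..} U" by (rule continuous_on_atLeast) (rule U)
    have UP: "U p = 0" if "p \<in> P" for p
    proof -
      have "p \<ge> 1" using that P by auto
      then have "continuous_rep x p = U p"
        by (rule continuous_rep_unique[OF xD cU ae])
      moreover have "continuous_rep x p = 0"
      proof (rule euclidean_eqI)
        fix e :: "real^'n" assume "e \<in> Basis"
        then show "continuous_rep x p \<bullet> e = 0 \<bullet> e" using l0[of "(p, e)"] that by simp
      qed
      ultimately show ?thesis by simp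
    qed
    have "0 \<le> L2_class ?z \<bullet> L2_class ?u"
    proof (rule nonneg_of_form_nonneg[OF A square_integrable_rep square_integrable_rep ae _ refl UP[OF P(3)] T])
      show "0 \<le> integral {1..b} (\<lambda>t. (norm (\<beta> + prim (rhs ?u ?z) t))\<^sup>2 + potential U t)" if "T \<le> b" for b
        by (rule form[OF U cV UP that])
    qed (rule U)
    then show "0 \<le> y \<bullet> x" by simp
  qed
qed

end

section \<open>Infinite Morse index\<close>

text \<open>
  Functions \<open>t powr a * g (ln t)\<close> are closed under differentiation, with \<open>a * g + g'\<close> and \<open>a - 1\<close> as
  new parameters. The gap \<open>\<delta>\<close> makes them vanish near \<open>t = 1\<close>, where the two cases meet.
\<close>

lemma smooth_Liouville:
  fixes g :: "real \<Rightarrow> real"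
  assumes g: "smooth g" and \<delta>: "\<delta> > 0" "\<And>s. s < \<delta> \<Longrightarrow> g s = 0"
  shows "smooth (\<lambda>t. if t > 1 then t powr a * g (ln t) else 0)"
proof -
  define h where "h a g t = (if t > 1 then t powr a * g (ln t) else 0)" for a :: real and g :: "real \<Rightarrow> real" and t :: real
  define S where "S = {h a g | a g. smooth g \<and> (\<forall>s<\<delta>. g s = 0)}"
  show ?thesis
  proof (rule smooth_coinduct[of _ S])
    show "(\<lambda>t. if t > 1 then t powr a * g (ln t) else 0) \<in> S"
      unfolding S_def using g \<delta> by (intro CollectI exI[of _ a] exI[of _ g]) (auto simp: h_def)
    fix k assume "k \<in> S"
    then obtain a g where k: "k = h a g" "smooth g" "\<And>s. s < \<delta> \<Longrightarrow> g s = 0" unfolding S_def by blast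
    obtain g' where g': "smooth g'" "\<And>t. (g has_vector_derivative g' t) (at t)"
      using smooth_derivative[OF k(2)] by blast
    let ?g = "\<lambda>s. a * g s + g' s"
    have "((\<lambda>s. 0) has_vector_derivative (0::real)) (at s)" for s :: real by simp
    then have g0: "(g has_vector_derivative 0) (at s)" if "s < \<delta>" for s
      by (rule has_vector_derivative_transform_within_open[of _ _ _ "{..<\<delta>}"]) (use that k(3) in auto)
    have g'0: "g' s = 0" if "s < \<delta>" for s
      by (rule vector_derivative_unique_at[OF g'(2) g0[OF that]])
    have "smooth ?g"
      by (intro smooth_add g'(1)) (rule smooth_bounded_linear[OF bounded_linear_mult_right k(2)])
    then have "h (a - 1) ?g \<in> S"
      unfolding S_def using k(3) g'0 by (intro CollectI exI[of _ "a - 1"] exI[of _ ?g]) simp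
    moreover have "(k has_vector_derivative h (a - 1) ?g t) (at t)" for t
    proof (cases "t > 1")
      case True
      have "((\<lambda>t. t powr a * g (ln t)) has_real_derivative h (a - 1) ?g t) (at t)"
        using True g'(2)[of "ln t"]
        by (auto intro!: derivative_eq_intros DERIV_chain'[where f=ln and g=g]
            simp: h_def has_real_derivative_iff_has_vector_derivative[symmetric] powr_diff field_simps)
      then have "(k has_real_derivative h (a - 1) ?g t) (at t)"
      proof (rule has_field_derivative_transform_within_open)
        show "open {1::real<..}" by simp
      qed (use True in \<open>auto simp: k(1) h_def\<close>)
      then show ?thesis by (simp add: has_real_derivative_iff_has_vector_derivative)
    next
      case False
      have "((\<lambda>s. 0) has_vector_derivative (0::real)) (at t)" by simp
      then have "(k has_vector_derivative 0) (at t)"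
      proof (rule has_vector_derivative_transform_within_open)
        show "open {..<exp \<delta>}" by simp
        have "1 < exp \<delta>" using \<delta>(1) by simp
        then show "t \<in> {..<exp \<delta>}" using False unfolding lessThan_iff by linarith
        fix x assume "x \<in> {..<exp \<delta>}"
        then have "x > 1 \<Longrightarrow> ln x < \<delta>"
          using ln_less_cancel_iff[of x "exp \<delta>"] by simp
        then show "0 = k x" using k(3) by (simp add: k(1) h_def)
      qed
      then show ?thesis using False by (simp add: h_def)
    qed
    ultimately show "\<exists>k'\<in>S. \<forall>t. (k has_vector_derivative k' t) (at t)" by blast
  qed
qed

text \<open>
  Stretching a bump to length \<open>L\<close> divides its kinetic energy by \<open>L\<^sup>2\<close> relative to its mass. The
  number \<open>k0\<close> is where its translates have to start in order to be supported beyond \<open>T\<close> after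
  the substitution \<open>t = exp (L x)\<close>.
\<close>

lemma exists_bump_of_negative_energy:
  fixes c T :: real
  assumes c: "c > 0"
  obtains L k0 :: real and \<eta> \<eta>' where "L > 0" "k0 > 0" "T \<le> exp (L * k0)"
    "smooth \<eta>" "\<And>x. (\<eta> has_vector_derivative \<eta>' x) (at x)" "\<And>x. x \<notin> {0<..<1} \<Longrightarrow> \<eta> x = (0::real)"
    "continuous_on UNIV \<eta>'"
    "integral {0..1} (\<lambda>x. (\<eta>' x)\<^sup>2 / L\<^sup>2 - c\<^sup>2 * (\<eta> x)\<^sup>2) < 0"
proof -
  let ?\<eta> = "bump 1 0 1"
  have s: "smooth ?\<eta>" by (rule smooth_bump) simp
  obtain \<eta>' where d: "smooth \<eta>'" "\<And>x. (?\<eta> has_vector_derivative \<eta>' x) (at x)"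
    using smooth_derivative[OF s] by blast
  have ic: "continuous_on X ?\<eta>" "continuous_on X \<eta>'" for X by (rule smooth_imp_continuous[OF s] smooth_imp_continuous[OF d(1)])+
  define I0 where "I0 = integral {0..1} (\<lambda>x. (?\<eta> x)\<^sup>2)"
  define I1 where "I1 = integral {0..1} (\<lambda>x. (\<eta>' x)\<^sup>2)"
  have i: "(\<lambda>x. (?\<eta> x)\<^sup>2) integrable_on {0..1}" "(\<lambda>x. (\<eta>' x)\<^sup>2) integrable_on {0..1}"
    by (intro integrable_continuous_real continuous_intros ic)+
  have "I0 \<noteq> 0"
  proof
    assume "I0 = 0"
    moreover have "continuous_on {0..1} (\<lambda>x. (?\<eta> x)\<^sup>2)" by (intro continuous_intros ic)
    ultimately have "\<forall>x\<in>{0..1}. (?\<eta> x)\<^sup>2 = 0"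
      unfolding I0_def by (subst (asm) integral_eq_0_iff) auto
    then show False using bump_pos[of 0 "1/2" 1 1] by force
  qed
  moreover have "I0 \<ge> 0" unfolding I0_def by (intro integral_nonneg i) auto
  ultimately have I0: "I0 > 0" by simp
  have I1: "I1 \<ge> 0" unfolding I1_def by (intro integral_nonneg i) auto
  define q where "q = I1 / (c\<^sup>2 * I0) + 1"
  have q: "q > 0" unfolding q_def using I0 I1 c by (intro add_nonneg_pos) auto
  define L where "L = sqrt q"
  have L: "L > 0" "L\<^sup>2 = q" using q by (auto simp: L_def)
  define k0 where "k0 = (\<bar>T\<bar> + 1) / L"
  show thesis
  proof (rule that[of L k0 ?\<eta> \<eta>'])
    show "k0 > 0" using L(1) by (simp add: k0_def)
    have "T \<le> 1 + (\<bar>T\<bar> + 1)" by simp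
    also have "\<dots> \<le> exp (\<bar>T\<bar> + 1)" by (rule exp_ge_add_one_self)
    finally show "T \<le> exp (L * k0)" using L(1) by (simp add: k0_def)
    have "integral {0..1} (\<lambda>x. (\<eta>' x)\<^sup>2 / L\<^sup>2 - c\<^sup>2 * (?\<eta> x)\<^sup>2) = I1 / L\<^sup>2 - c\<^sup>2 * I0"
      unfolding I0_def I1_def using L(1) by (subst integral_diff) (auto intro!: integrable_continuous_real continuous_intros ic)
    also have "\<dots> < 0"
    proof -
      have "I1 < c\<^sup>2 * I0 * q" unfolding q_def using I0 c by (simp add: field_simps)
      then show ?thesis using L(2) q by (simp add: field_simps)
    qed
    finally show "integral {0..1} (\<lambda>x. (\<eta>' x)\<^sup>2 / L\<^sup>2 - c\<^sup>2 * (?\<eta> x)\<^sup>2) < 0" .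
  qed (use L s d ic bump_outside in auto)
qed

text \<open>
  With \<open>\<psi> t = t powr (1/2) * f (ln t)\<close> the integrand \<open>\<psi>'\<^sup>2 - (1/4 + c\<^sup>2) \<psi>\<^sup>2 / t\<^sup>2\<close> becomes
  \<open>(f f' + f'\<^sup>2 - c\<^sup>2 f\<^sup>2) (ln t) / t\<close>: the weight \<open>t powr (1/2)\<close> absorbs exactly the critical constant
  \<open>1/4\<close>. For \<open>f s = \<eta> (s / L - k)\<close> its integral is \<open>L\<close> times that of
  \<open>\<eta>'\<^sup>2 / L\<^sup>2 - c\<^sup>2 \<eta>\<^sup>2\<close>, and the values \<open>k = k0 + j\<close> give disjoint supports.
\<close>

lemma negative_test_functions:
  fixes c T :: real
  assumes c: "c > 0"
  shows "\<exists>\<psi> \<psi>' \<psi>'' a b. \<forall>j::nat. test_function (\<psi> j) \<and> test_function (\<psi>' j) \<and> test_function (\<psi>'' j) \<and>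
    (\<forall>t. (\<psi> j has_vector_derivative \<psi>' j t) (at t)) \<and> (\<forall>t. (\<psi>' j has_vector_derivative \<psi>'' j t) (at t)) \<and>
    1 < a j \<and> T \<le> a j \<and> a j < b j \<and> b j \<le> a (Suc j) \<and> (\<forall>t. t \<notin> {a j<..<b j} \<longrightarrow> \<psi> j t = 0) \<and>
    integral {a j..b j} (\<lambda>t. (\<psi>' j t)\<^sup>2 - (1/4 + c\<^sup>2) * (\<psi> j t)\<^sup>2 / t\<^sup>2) < 0"
proof -
  obtain L k0 :: real and \<eta> \<eta>' where L: "L > 0" "k0 > 0" "T \<le> exp (L * k0)"
    and \<eta>: "smooth \<eta>" "\<And>x. (\<eta> has_vector_derivative \<eta>' x) (at x)" "\<And>x. x \<notin> {0<..<1} \<Longrightarrow> \<eta> x = 0"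
      "continuous_on UNIV \<eta>'"
    and neg: "integral {0..1} (\<lambda>x. (\<eta>' x)\<^sup>2 / L\<^sup>2 - c\<^sup>2 * (\<eta> x)\<^sup>2) < 0"
    using exists_bump_of_negative_energy[OF c] by blast
  define k where "k j = k0 + real j" for j
  define a where "a j = exp (L * k j)" for j
  define b where "b j = exp (L * (k j + 1))" for j
  define \<psi> where "\<psi> j t = (if t > 1 then t powr (1/2) * \<eta> (1 / L * ln t + - k j) else 0)" for j t
  have kpos: "k j > 0" for j using L(2) by (simp add: k_def)
  have ab: "1 < a j" "a j < b j" "b j \<le> a (Suc j)" "T \<le> a j" for j
  proof -
    show "1 < a j" "a j < b j" using L(1) kpos[of j] by (simp_all add: a_def b_def)
    show "b j \<le> a (Suc j)" by (simp add: a_def b_def k_def algebra_simps)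
    have "exp (L * k0) \<le> a j" using L by (simp add: a_def k_def)
    then show "T \<le> a j" using L(3) by linarith
  qed
  have zero: "\<psi> j t = 0" if "t \<notin> {a j<..<b j}" for j t
  proof (cases "t > 1")
    case True
    have "1 / L * ln t + - k j \<notin> {0<..<1}"
    proof
      assume x: "1 / L * ln t + - k j \<in> {0<..<1}"
      then have "L * k j < ln t" "ln t < L * (k j + 1)" using L(1) by (auto simp: field_simps)
      then have "exp (L * k j) < exp (ln t)" "exp (ln t) < exp (L * (k j + 1))" by simp_all
      then have "t \<in> {a j<..<b j}" using True by (simp add: a_def b_def)
      then show False using that by simp
    qed
    then show ?thesis unfolding \<psi>_def using \<eta>(3) by simp
  qed (simp add: \<psi>_def)
  have smooth: "smooth (\<psi> j)" for j
    unfolding \<psi>_def[abs_def]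
  proof (rule smooth_Liouville[of "\<lambda>s. \<eta> (1 / L * s + - k j)" "L * k j"])
    show "smooth (\<lambda>s. \<eta> (1 / L * s + - k j))" by (rule smooth_affine) (rule \<eta>)
    show "L * k j > 0" using L(1) kpos by simp
    show "\<eta> (1 / L * s + - k j) = 0" if "s < L * k j" for s
      using that L(1) by (intro \<eta>(3)) (auto simp: field_simps)
  qed
  have test: "test_function (\<psi> j)" for j
    by (rule test_functionI[OF smooth ab(1)[of j], where b="b j"]) (use zero in auto)
  have "\<exists>\<psi>'. \<forall>j. test_function (\<psi>' j) \<and> (\<forall>t. (\<psi> j has_vector_derivative \<psi>' j t) (at t))"
    by (intro choice allI) (meson test_function_derivative[OF test])
  then obtain \<psi>' where \<psi>': "\<And>j. test_function (\<psi>' j)" "\<And>j t. (\<psi> j has_vector_derivative \<psi>' j t) (at t)" by blast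
  have "\<exists>\<psi>''. \<forall>j. test_function (\<psi>'' j) \<and> (\<forall>t. (\<psi>' j has_vector_derivative \<psi>'' j t) (at t))"
    by (intro choice allI) (meson test_function_derivative[OF \<psi>'(1)])
  then obtain \<psi>'' where \<psi>'': "\<And>j. test_function (\<psi>'' j)" "\<And>j t. (\<psi>' j has_vector_derivative \<psi>'' j t) (at t)" by blast
  have int: "integral {a j..b j} (\<lambda>t. (\<psi>' j t)\<^sup>2 - (1/4 + c\<^sup>2) * (\<psi> j t)\<^sup>2 / t\<^sup>2) < 0" for j
  proof -
    let ?x = "\<lambda>t. 1 / L * ln t + - k j"
    let ?q = "\<lambda>x. (\<eta>' x)\<^sup>2 / L\<^sup>2 - c\<^sup>2 * (\<eta> x)\<^sup>2"
    define K where "K x = integral {0..x} ?q" for x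
    have cq: "continuous_on X ?q" for X
      using continuous_on_subset[OF \<eta>(4)] smooth_imp_continuous[OF \<eta>(1)] L(1) by (intro continuous_intros) auto
    have dK: "(K has_real_derivative ?q x) (at x within {0..1})" if "x \<in> {0..1}" for x
      unfolding K_def[abs_def] has_real_derivative_iff_has_vector_derivative
      by (rule integral_has_vector_derivative[OF cq that])
    \<comment> \<open>an explicit primitive of the integrand, which replaces the change of variables\<close>
    let ?P = "\<lambda>t. (\<eta> (?x t))\<^sup>2 / 2 + L * K (?x t)"
    have xI: "?x t \<in> {0..1}" "t > 1" if "t \<in> {a j..b j}" for t
    proof -
      show t: "t > 1" using that ab(1)[of j] by simp
      have "exp (L * k j) \<le> exp (ln t)" "exp (ln t) \<le> exp (L * (k j + 1))"
        using that t by (simp_all add: a_def b_def)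
      then have "L * k j \<le> ln t" "ln t \<le> L * (k j + 1)" unfolding exp_le_cancel_iff .
      then show "?x t \<in> {0..1}" using L(1) by (auto simp: field_simps)
    qed
    have dpsi: "\<psi>' j t = t powr (- 1/2) * (\<eta> (?x t) / 2 + \<eta>' (?x t) / L)" if t: "t > 1" for t
    proof -
      have "(\<eta> has_real_derivative \<eta>' (?x t)) (at (?x t))"
        using \<eta>(2) by (simp add: has_real_derivative_iff_has_vector_derivative)
      then have deta: "((\<lambda>t. \<eta> (?x t)) has_real_derivative \<eta>' (?x t) * (1 / L * (1 / t))) (at t)"
        by (rule DERIV_chain2) (use t L(1) in \<open>auto intro!: derivative_eq_intros\<close>)
      have dpow: "((\<lambda>t. t powr (1/2)) has_real_derivative (1/2) * t powr (1/2 - 1)) (at t)"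
        using t by (intro has_real_derivative_powr) auto
      have "((\<lambda>t. t powr (1/2) * \<eta> (?x t)) has_real_derivative
          ((1/2) * t powr (1/2 - 1)) * \<eta> (?x t) + (\<eta>' (?x t) * (1 / L * (1 / t))) * t powr (1/2)) (at t)"
        by (rule DERIV_mult[OF dpow deta])
      moreover have "((1/2) * t powr (1/2 - 1)) * \<eta> (?x t) + (\<eta>' (?x t) * (1 / L * (1 / t))) * t powr (1/2)
        = t powr (- 1/2) * (\<eta> (?x t) / 2 + \<eta>' (?x t) / L)"
      proof -
        have "t powr (1/2) = t powr (- 1/2 + 1)" by simp
        also have "\<dots> = t powr (- 1/2) * t" using t by (subst powr_add) simp
        finally show ?thesis using t L(1) by (simp add: field_simps)
      qed
      ultimately have "((\<lambda>t. t powr (1/2) * \<eta> (?x t)) has_real_derivative t powr (- 1/2) * (\<eta> (?x t) / 2 + \<eta>' (?x t) / L)) (at t)"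
        by metis
      then have "(\<psi> j has_real_derivative t powr (- 1/2) * (\<eta> (?x t) / 2 + \<eta>' (?x t) / L)) (at t)"
      proof (rule has_field_derivative_transform_within_open)
        show "open {1::real<..}" by simp
      qed (use t in \<open>auto simp: \<psi>_def\<close>)
      then show ?thesis
        unfolding has_real_derivative_iff_has_vector_derivative
        by (rule vector_derivative_unique_at[OF \<psi>'(2)])
    qed
    have dP: "(?P has_vector_derivative (\<psi>' j t)\<^sup>2 - (1/4 + c\<^sup>2) * (\<psi> j t)\<^sup>2 / t\<^sup>2) (at t within {a j..b j})"
      if t: "t \<in> {a j..b j}" for t
    proof -
      note t1 = xI(2)[OF t]
      have dx: "(?x has_real_derivative 1 / L * (1 / t)) (at t within {a j..b j})"
        using t1 L(1) by (auto intro!: derivative_eq_intros)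
      have "(\<eta> has_real_derivative \<eta>' (?x t)) (at (?x t))"
        using \<eta>(2) by (simp add: has_real_derivative_iff_has_vector_derivative)
      then have d1: "((\<lambda>t. \<eta> (?x t)) has_real_derivative \<eta>' (?x t) * (1 / L * (1 / t))) (at t within {a j..b j})"
        by (rule DERIV_chain2[OF _ dx])
      have "(K has_real_derivative ?q (?x t)) (at (?x t) within ?x ` {a j..b j})"
        by (rule DERIV_subset[OF dK[OF xI(1)[OF t]]]) (use xI(1) in blast)
      from DERIV_image_chain[OF this dx]
      have d2: "((\<lambda>t. K (?x t)) has_real_derivative ?q (?x t) * (1 / L * (1 / t))) (at t within {a j..b j})"
        by (simp add: o_def)
      have "(?P has_real_derivative \<eta> (?x t) * (\<eta>' (?x t) * (1 / L * (1 / t))) + L * (?q (?x t) * (1 / L * (1 / t)))) (at t within {a j..b j})"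
        by (rule derivative_eq_intros d1 d2 refl | simp)+
      moreover have "\<eta> (?x t) * (\<eta>' (?x t) * (1 / L * (1 / t))) + L * (?q (?x t) * (1 / L * (1 / t))) =
        (\<psi>' j t)\<^sup>2 - (1/4 + c\<^sup>2) * (\<psi> j t)\<^sup>2 / t\<^sup>2"
      proof -
        define X where "X = \<eta> (?x t)" define Y where "Y = \<eta>' (?x t)"
        have p1: "(t powr (- 1/2))\<^sup>2 = 1 / t"
          using t1 by (simp add: power2_eq_square powr_add[symmetric] powr_minus_divide)
        have p2: "(t powr (1/2))\<^sup>2 = t"
          using t1 by (simp add: power2_eq_square powr_add[symmetric])
        have "(\<psi>' j t)\<^sup>2 = 1 / t * (X / 2 + Y / L)\<^sup>2"
          unfolding dpsi[OF t1] power_mult_distrib p1 X_def Y_def ..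
        moreover have "(\<psi> j t)\<^sup>2 = t * X\<^sup>2"
          using t1 unfolding \<psi>_def X_def by (simp add: power_mult_distrib p2)
        ultimately show ?thesis
          using t1 L(1) unfolding X_def[symmetric] Y_def[symmetric] by (simp add: field_simps power2_eq_square)
      qed
      ultimately show ?thesis unfolding has_real_derivative_iff_has_vector_derivative by simp
    qed
    have "((\<lambda>t. (\<psi>' j t)\<^sup>2 - (1/4 + c\<^sup>2) * (\<psi> j t)\<^sup>2 / t\<^sup>2) has_integral ?P (b j) - ?P (a j)) {a j..b j}"
      using ab(2)[of j] dP by (intro fundamental_theorem_of_calculus) auto
    then have "integral {a j..b j} (\<lambda>t. (\<psi>' j t)\<^sup>2 - (1/4 + c\<^sup>2) * (\<psi> j t)\<^sup>2 / t\<^sup>2) = ?P (b j) - ?P (a j)"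
      by (rule integral_unique)
    moreover have "?x (b j) = 1" "?x (a j) = 0" using L(1) by (simp_all add: a_def b_def)
    moreover have "\<eta> 1 = 0" "\<eta> 0 = 0" by (simp_all add: \<eta>(3))
    moreover have "K 0 = 0" by (simp add: K_def)
    ultimately have "integral {a j..b j} (\<lambda>t. (\<psi>' j t)\<^sup>2 - (1/4 + c\<^sup>2) * (\<psi> j t)\<^sup>2 / t\<^sup>2) = L * K 1"
      by simp
    also have "\<dots> < 0" using neg L(1) by (simp add: K_def mult_pos_neg)
    finally show ?thesis .
  qed
  show ?thesis
    using test \<psi>' \<psi>'' ab zero int
    by (intro exI[of _ \<psi>] exI[of _ \<psi>'] exI[of _ \<psi>''] exI[of _ a] exI[of _ b] allI conjI impI)
qed

context extension
begin

text \<open>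
  By the disjointness of their supports distinct test functions are orthogonal for the form, and on
  each of them \<open>R t\<close> may be replaced by its upper bound.
\<close>

theorem infinite_morse_index:
  assumes c: "c > 0" and T: "T \<ge> 1"
    and neg: "\<And>t v. T \<le> t \<Longrightarrow> v \<bullet> (R t *v v) \<le> - (1/4 + c\<^sup>2) * (norm v)\<^sup>2"
  shows "morse_index A = \<infinity>"
proof -
  obtain \<psi> \<psi>' \<psi>'' a b where all: "\<forall>j::nat. test_function (\<psi> j) \<and> test_function (\<psi>' j) \<and> test_function (\<psi>'' j) \<and>
    (\<forall>t. (\<psi> j has_vector_derivative \<psi>' j t) (at t)) \<and> (\<forall>t. (\<psi>' j has_vector_derivative \<psi>'' j t) (at t)) \<and>
    1 < a j \<and> T \<le> a j \<and> a j < b j \<and> b j \<le> a (Suc j) \<and> (\<forall>t. t \<notin> {a j<..<b j} \<longrightarrow> \<psi> j t = (0::real)) \<and>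
    integral {a j..b j} (\<lambda>t. (\<psi>' j t)\<^sup>2 - (1/4 + c\<^sup>2) * (\<psi> j t)\<^sup>2 / t\<^sup>2) < 0"
    using negative_test_functions[OF c, of T] by (elim exE) (rule that)
  have test: "test_function (\<psi> j)" "test_function (\<psi>' j)" "test_function (\<psi>'' j)"
    and d: "(\<psi> j has_vector_derivative \<psi>' j t) (at t)" "(\<psi>' j has_vector_derivative \<psi>'' j t) (at t)"
    and ab: "1 < a j" "T \<le> a j" "a j < b j" "b j \<le> a (Suc j)"
    and zero: "t \<notin> {a j<..<b j} \<Longrightarrow> \<psi> j t = 0"
    and int: "integral {a j..b j} (\<lambda>t. (\<psi>' j t)\<^sup>2 - (1/4 + c\<^sup>2) * (\<psi> j t)\<^sup>2 / t\<^sup>2) < 0" for j t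
    using spec[OF all, of j] by - ((elim conjE), blast)+
  have zero': "\<psi>' j t = 0" if "t \<notin> {a j..b j}" for j t
    by (rule has_vector_derivative_0_outside[OF _ d(1) that]) (rule zero, auto)
  have zero'': "\<psi>'' j t = 0" if "t \<notin> {a j..b j}" for j t
    by (rule has_vector_derivative_0_outside[OF _ d(2) that]) (rule zero')
  have sep: "b i \<le> a j" if "i < j" for i j
    using that
  proof (induction j)
    case (Suc j)
    then show ?case using ab(3,4)[of j] by (cases "i = j") (auto simp: less_Suc_eq intro: order_trans)
  qed simp
  obtain e :: "real^'n" where e: "e \<in> Basis" using nonempty_Basis by blast
  have ee: "e \<bullet> e = 1" using e by simp
  let ?\<phi> = "\<lambda>j t. \<psi> j t *\<^sub>R e"
  let ?x = "\<lambda>j. L2_class (?\<phi> j)" and ?y = "\<lambda>j. L2_class (l_expr R (?\<phi> j))"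
  have \<phi>: "test_function (?\<phi> j)" for j by (rule test_function_bounded_linear[OF bounded_linear_scaleR_left test(1)])
  note sq = test_function_square_integrable[OF \<phi>]
  have l: "square_integrable (l_expr R (?\<phi> j))" for j
    by (rule l_expr_scalar_square_integrable[OF continuous_R test(1,3) d])
  have lval: "l_expr R (?\<phi> i) t \<bullet> ?\<phi> j t = - (\<psi>'' i t * \<psi> j t) + \<psi> i t * \<psi> j t / t\<^sup>2 * (e \<bullet> (R t *v e))" for i j t
    using ee by (simp add: l_expr_scalar[OF d] inner_add_left inner_commute algebra_simps)
  show ?thesis
  proof (rule morse_index_infinite[OF self_adjoint_A, of ?x ?y])
    show "(?x j, ?y j) \<in> A" for j using test_function_in_minimal_operator[OF \<phi>] extends by blast
    fix i j :: nat
    assume ij: "i \<noteq> j"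
    have "l_expr R (?\<phi> i) t \<bullet> ?\<phi> j t = 0" for t
    proof (cases "t \<in> {a j<..<b j}")
      case True
      then have "t \<notin> {a i..b i}" using sep[of i j] sep[of j i] ij by (cases "i < j") auto
      then have "\<psi>'' i t = 0" "\<psi> i t = 0" using zero'' zero[of t i] by auto
      then show ?thesis unfolding lval by simp
    qed (simp add: zero)
    then have "(\<lambda>t. l_expr R (?\<phi> i) t \<bullet> ?\<phi> j t) = (\<lambda>_. 0)" by blast
    then show "?y i \<bullet> ?x j = 0" unfolding L2_class_inner[OF l sq] by simp
  next
    fix j
    let ?D = "{a j..b j}"
    have Dsub: "?D \<subseteq> {1..}" using ab(1)[of j] by auto
    have c\<psi>: "continuous_on S (\<psi> j)" "continuous_on S (\<psi>' j)" "continuous_on S (\<psi>'' j)" for S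
      by (rule smooth_imp_continuous[OF test_function_smooth[OF test(1)]]
        smooth_imp_continuous[OF test_function_smooth[OF test(2)]]
        smooth_imp_continuous[OF test_function_smooth[OF test(3)]])+
    have cont: "continuous_on ?D (\<lambda>t. (\<psi>' j t)\<^sup>2 + (\<psi> j t)\<^sup>2 / t\<^sup>2 * (e \<bullet> (R t *v e)))"
      using ab(1)[of j] by (intro continuous_intros c\<psi> continuous_on_subset[OF continuous_R Dsub]) auto
    have cont2: "continuous_on ?D (\<lambda>t. (\<psi>' j t)\<^sup>2 - (1/4 + c\<^sup>2) * (\<psi> j t)\<^sup>2 / t\<^sup>2)"
      using ab(1)[of j] by (intro continuous_intros c\<psi>) auto
    note hc = halfline_integral_compact[OF _ ab(1)[of j]]
    have dprod: "((\<lambda>t. \<psi> j t * \<psi>' j t) has_vector_derivative \<psi> j t * \<psi>'' j t + \<psi>' j t * \<psi>' j t) (at t)" for t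
      by (intro has_vector_derivative_mult d)
    have tprod: "test_function (\<lambda>t. \<psi> j t * \<psi>' j t)"
      by (rule test_functionI[OF smooth_mult[OF test_function_smooth[OF test(1)] test_function_smooth[OF test(2)]] ab(1)[of j], where b="b j"])
         (use zero in auto)
    have i0: "(\<integral>t. \<psi> j t * \<psi>'' j t + \<psi>' j t * \<psi>' j t \<partial>halfline) = 0"
      by (rule integral_derivative_test_function[OF tprod dprod]) (intro continuous_intros c\<psi>)
    have ip: "integrable halfline (\<lambda>t. \<psi> j t * \<psi>'' j t + \<psi>' j t * \<psi>' j t)"
      by (rule hc(1)[where b="b j"]) (intro continuous_intros c\<psi>, use zero zero' in auto)
    have "?y j \<bullet> ?x j = (\<integral>t. l_expr R (?\<phi> j) t \<bullet> ?\<phi> j t \<partial>halfline)" by (rule L2_class_inner[OF l sq])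
    also have "\<dots> = (\<integral>t. l_expr R (?\<phi> j) t \<bullet> ?\<phi> j t \<partial>halfline) + (\<integral>t. \<psi> j t * \<psi>'' j t + \<psi>' j t * \<psi>' j t \<partial>halfline)"
      using i0 by simp
    also have "\<dots> = (\<integral>t. l_expr R (?\<phi> j) t \<bullet> ?\<phi> j t + (\<psi> j t * \<psi>'' j t + \<psi>' j t * \<psi>' j t) \<partial>halfline)"
      by (intro Bochner_Integration.integral_add[symmetric] square_integrable_inner l sq ip)
    also have "\<dots> = (\<integral>t. (\<psi>' j t)\<^sup>2 + (\<psi> j t)\<^sup>2 / t\<^sup>2 * (e \<bullet> (R t *v e)) \<partial>halfline)"
      by (intro Bochner_Integration.integral_cong refl) (unfold lval, simp add: power2_eq_square)
    also have "\<dots> \<le> (\<integral>t. (\<psi>' j t)\<^sup>2 - (1/4 + c\<^sup>2) * (\<psi> j t)\<^sup>2 / t\<^sup>2 \<partial>halfline)"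
    proof (rule integral_mono)
      show "integrable halfline (\<lambda>t. (\<psi>' j t)\<^sup>2 + (\<psi> j t)\<^sup>2 / t\<^sup>2 * (e \<bullet> (R t *v e)))"
        by (rule hc(1)[OF cont]) (use zero zero' in auto)
      show "integrable halfline (\<lambda>t. (\<psi>' j t)\<^sup>2 - (1/4 + c\<^sup>2) * (\<psi> j t)\<^sup>2 / t\<^sup>2)"
        by (rule hc(1)[OF cont2]) (use zero zero' in auto)
      fix t
      show "(\<psi>' j t)\<^sup>2 + (\<psi> j t)\<^sup>2 / t\<^sup>2 * (e \<bullet> (R t *v e)) \<le> (\<psi>' j t)\<^sup>2 - (1/4 + c\<^sup>2) * (\<psi> j t)\<^sup>2 / t\<^sup>2"
      proof (cases "t \<in> {a j<..<b j}")
        case True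
        then have "T \<le> t" using ab(2)[of j] by auto
        then have "e \<bullet> (R t *v e) \<le> - (1/4 + c\<^sup>2)" using neg[of t e] ee by (simp add: power2_norm_eq_inner)
        then have "(\<psi> j t)\<^sup>2 / t\<^sup>2 * (e \<bullet> (R t *v e)) \<le> (\<psi> j t)\<^sup>2 / t\<^sup>2 * (- (1/4 + c\<^sup>2))"
          by (rule mult_left_mono) simp
        moreover have "(\<psi> j t)\<^sup>2 / t\<^sup>2 * (- (1/4 + c\<^sup>2)) = - ((1/4 + c\<^sup>2) * (\<psi> j t)\<^sup>2 / t\<^sup>2)"
          by (simp only: mult_minus_right times_divide_eq_left mult.commute[of "(\<psi> j t)\<^sup>2"])
        ultimately show ?thesis by linarith
      qed (simp add: zero)
    qed
    also have "\<dots> = integral ?D (\<lambda>t. (\<psi>' j t)\<^sup>2 - (1/4 + c\<^sup>2) * (\<psi> j t)\<^sup>2 / t\<^sup>2)"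
      by (rule hc(2)[OF cont2]) (use zero zero' in auto)
    also have "\<dots> < 0" by (rule int)
    finally show "?y j \<bullet> ?x j < 0" .
  qed
qed

end

theorem theorem5:
  fixes R :: "real \<Rightarrow> real^'n^'n"
  assumes "continuous_on {1..} R"
    and "\<And>t. t \<ge> 1 \<Longrightarrow> transpose (R t) = R t"
  shows "(Liminf at_top (\<lambda>t. ereal (smallest_eigenvalue (R t))) > ereal (- 1 / 4) \<longrightarrow>
      (\<forall>A. self_adjoint A \<and> minimal_operator R \<subseteq> A \<longrightarrow> morse_index A < \<infinity>)) \<and>
    (Limsup at_top (\<lambda>t. ereal (largest_eigenvalue (R t))) < ereal (- 1 / 4) \<longrightarrow>
      (\<forall>A. self_adjoint A \<and> minimal_operator R \<subseteq> A \<longrightarrow> morse_index A = \<infinity>))"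
proof (intro conjI impI allI)
  fix A assume "Liminf at_top (\<lambda>t. ereal (smallest_eigenvalue (R t))) > ereal (- 1 / 4)"
    and A: "self_adjoint A \<and> minimal_operator R \<subseteq> A"
  then have "\<forall>\<^sub>F t in at_top. ereal (- 1 / 4) < ereal (smallest_eigenvalue (R t))"
    by (intro less_LiminfD)
  then obtain T0 where T0: "\<And>t. t \<ge> T0 \<Longrightarrow> - 1 / 4 < smallest_eigenvalue (R t)"
    unfolding eventually_at_top_linorder by auto
  interpret extension R A by unfold_locales (use assms A in auto)
  show "morse_index A < \<infinity>"
  proof (rule finite_morse_index[of "max 1 T0"])
    fix t and v :: "real^'n" assume t: "max 1 T0 \<le> t"
    have "- (1 / 4) * (norm v)\<^sup>2 \<le> smallest_eigenvalue (R t) * (norm v)\<^sup>2"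
      using T0[of t] t by (intro mult_right_mono) auto
    also have "\<dots> \<le> v \<bullet> (R t *v v)"
      using smallest_eigenvalue_le[of "R t" v] assms(2)[of t] t by (simp add: power2_norm_eq_inner)
    finally show "- (1 / 4) * (norm v)\<^sup>2 \<le> v \<bullet> (R t *v v)" .
  qed simp
next
  fix A assume "Limsup at_top (\<lambda>t. ereal (largest_eigenvalue (R t))) < ereal (- 1 / 4)"
    and A: "self_adjoint A \<and> minimal_operator R \<subseteq> A"
  then obtain r where r: "Limsup at_top (\<lambda>t. ereal (largest_eigenvalue (R t))) < ereal r" "ereal r < ereal (- 1 / 4)"
    using ereal_dense2 by blast
  have "\<forall>\<^sub>F t in at_top. ereal (largest_eigenvalue (R t)) < ereal r"
    using r(1) by (rule Limsup_lessD)
  then obtain T0 where T0: "\<And>t. t \<ge> T0 \<Longrightarrow> largest_eigenvalue (R t) < r"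
    unfolding eventually_at_top_linorder by auto
  define c where "c = sqrt (- r - 1 / 4)"
  have c: "c > 0" "r = - (1/4 + c\<^sup>2)" using r(2) by (auto simp: c_def)
  interpret extension R A by unfold_locales (use assms A in auto)
  show "morse_index A = \<infinity>"
  proof (rule infinite_morse_index[OF c(1), of "max 1 T0"])
    fix t and v :: "real^'n" assume t: "max 1 T0 \<le> t"
    have "v \<bullet> (R t *v v) \<le> largest_eigenvalue (R t) * (norm v)\<^sup>2"
      using largest_eigenvalue_ge[of "R t" v] assms(2)[of t] t by (simp add: power2_norm_eq_inner)
    also have "\<dots> \<le> r * (norm v)\<^sup>2" using T0[of t] t by (intro mult_right_mono) auto
    finally show "v \<bullet> (R t *v v) \<le> - (1/4 + c\<^sup>2) * (norm v)\<^sup>2" using c(2) by simp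
  qed simp
qed

end
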